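(* Let $D$ be a period domain of odd weight polarized Hodge structures on $(V,Q)$. Let $\varphi\in D$ be irreducible, CM and nondegenerate. Let $M$ be a Mumford-Tate group whose Mumford-Tate domain passes through $\varphi$, with Lie algebra $\mathfrak{m}$. Let $N\in\mathfrak{m}_{\mathbb{Q}}$ be nilpotent. If $N^{l-1}\neq 0$ for some integer $l>\dim_{\mathbb{Q}}(V)/2$, then $\mathfrak{m}_{\mathbb{C}}=\mathfrak{g}_{\mathbb{C}}$.
   Context: $V$ is a finite-dimensional $\mathbb{Q}$-vector space with polarization form $Q$ (alternating, as the weight is odd); the period domain $D$ parametrizes Hodge structures on $V$ polarized by $Q$ with fixed weight and Hodge numbers. $G=\{g\in \mathrm{Aut}(V)\mid Q(gu,gv)=Q(u,v)\ \forall u,v\in V\}$, with Lie algebra $\mathfrak{g}$, so $\mathfrak{g}_{\mathbb{Q}}=\{X\in \mathrm{End}(V)\mid Q(Xu,v)+Q(u,Xv)=0\ \forall u,v\}$ and $\mathfrak{g}_{\mathbb{C}}=\mathfrak{g}_{\mathbb{Q}}\otimes\mathbb{C}$. Elements of $\mathfrak{g}_{\mathbb{Q}}$ are regarded as endomorphisms of $V$; nilpotency and powers of $N$ are taken in $\mathrm{End}(V)$. For $\varphi\in D$, regarded as a real representation of $\mathbb{C}^*$ on $V_{\mathbb{R}}$, the Mumford-Tate group $M_\varphi\subseteq G$ is the smallest $\mathbb{Q}$-algebraic group whose real points contain $\varphi(S^1)$. A Mumford-Tate group $M$ is the Mumford-Tate group $M_{\varphi'}$ of some $\varphi'\in D$;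 its Mumford-Tate domain is the orbit $M(\mathbb{R})\cdot\varphi'\subseteq D$, and it passes through $\varphi$ if $\varphi$ lies in this orbit. $\mathfrak{m}_{\mathbb{Q}}\subseteq\mathfrak{g}_{\mathbb{Q}}$ is the Lie algebra of $M$ and $\mathfrak{m}_{\mathbb{C}}=\mathfrak{m}_{\mathbb{Q}}\otimes\mathbb{C}$. $\varphi$ is CM if $M_\varphi$ is abelian; a CM $\varphi$ is nondegenerate if $\dim(M_\varphi)=\dim_{\mathbb{Q}}(V)/2$. $\varphi$ is irreducible if $V$ has no rational sub-Hodge structures other than $0$ and $V$. *)

theory Defs
  imports "HOL-Analysis.Analysis"
begin

text \<open>
  The rational vector space is V = \<open>rat ^ 'n\<close>, so V_R = \<open>real ^ 'n\<close>, V_C = \<open>complex ^ 'n\<close>, and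
  endomorphisms are square matrices; extension of scalars is \<open>map_matrix\<close> of the coercion.
  A linear algebraic group over Q is given by its complex points, as a subset of
  \<open>complex ^ 'n ^ 'n\<close> cut out by polynomials with rational coefficients.
\<close>

definition cscale :: "complex \<Rightarrow> complex ^ 'n ^ 'n \<Rightarrow> complex ^ 'n ^ 'n" where
  "cscale c A = map_matrix (\<lambda>x. c * x) A"

interpretation cmat: vector_space "cscale :: complex \<Rightarrow> complex ^ 'n ^ 'n \<Rightarrow> complex ^ 'n ^ 'n"
  by unfold_locales (simp_all add: cscale_def vec_eq_iff algebra_simps)

primrec mat_power :: "'a::semiring_1 ^ 'n ^ 'n \<Rightarrow> nat \<Rightarrow> 'a ^ 'n ^ 'n" where
  "mat_power A 0 = mat 1"
| "mat_power A (Suc k) = A ** mat_power A k"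

definition nilpotent_mat :: "'a::semiring_1 ^ 'n ^ 'n \<Rightarrow> bool" where
  "nilpotent_mat A \<longleftrightarrow> (\<exists>k. mat_power A k = 0)"

definition complexification :: "(rat ^ 'n) set \<Rightarrow> (complex ^ 'n) set" where
  "complexification W = vec.span ((\<lambda>u. \<chi> i. of_rat (u $ i)) ` W)"

definition lie_complexification :: "(rat ^ 'n ^ 'n) set \<Rightarrow> (complex ^ 'n ^ 'n) set" where
  "lie_complexification L = cmat.span (map_matrix of_rat ` L)"


subsection \<open>Polarized Hodge structures and period domains\<close>

definition polarization_form :: "int \<Rightarrow> (rat ^ 'n \<Rightarrow> rat ^ 'n \<Rightarrow> rat) \<Rightarrow> bool" where
  "polarization_form w Q \<longleftrightarrow>
     (\<forall>u. Vector_Spaces.linear (*s) (*) (Q u)) \<and>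
     (\<forall>v. Vector_Spaces.linear (*s) (*) (\<lambda>u. Q u v)) \<and>
     (\<forall>u v. Q u v = (if even w then Q v u else - Q v u)) \<and>
     (\<forall>u. (\<forall>v. Q u v = 0) \<longrightarrow> u = 0)"

text \<open>The extension of Q to a C-bilinear form on V_C.\<close>

definition bilin_ext :: "(rat ^ 'n \<Rightarrow> rat ^ 'n \<Rightarrow> rat) \<Rightarrow> complex ^ 'n \<Rightarrow> complex ^ 'n \<Rightarrow> complex" where
  "bilin_ext Q u v = (\<Sum>i\<in>UNIV. \<Sum>j\<in>UNIV. u $ i * v $ j * of_rat (Q (axis i 1) (axis j 1)))"

definition vec_cnj :: "complex ^ 'n \<Rightarrow> complex ^ 'n" where
  "vec_cnj v = (\<chi> i. cnj (v $ i))"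

definition is_direct_sum :: "(complex ^ 'n) set \<Rightarrow> (int \<Rightarrow> (complex ^ 'n) set) \<Rightarrow> bool" where
  "is_direct_sum U F \<longleftrightarrow>
     (\<forall>p. vec.subspace (F p) \<and> F p \<subseteq> U) \<and>
     (\<forall>v\<in>U. \<exists>!f. (\<forall>p. f p \<in> F p) \<and> finite {p. f p \<noteq> 0} \<and> v = (\<Sum>p | f p \<noteq> 0. f p))"

text \<open>
  A Hodge structure is represented by the real representation \<open>\<phi>\<close> of C* on V_R; the piece
  \<open>V\<^sup>p\<^sup>,\<^sup>q\<close> is the part of V_C where z acts as \<open>z\<^sup>p cnj(z)\<^sup>q\<close>.  As \<open>\<phi> z\<close> is real, the symmetry
  \<open>cnj V\<^sup>p\<^sup>,\<^sup>q = V\<^sup>q\<^sup>,\<^sup>p\<close> is automatic.  The value \<open>\<phi> 0\<close> is never used.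
\<close>

definition hodge_piece :: "(complex \<Rightarrow> real ^ 'n ^ 'n) \<Rightarrow> int \<Rightarrow> int \<Rightarrow> (complex ^ 'n) set" where
  "hodge_piece \<phi> p q =
     {v. \<forall>z. z \<noteq> 0 \<longrightarrow> map_matrix complex_of_real (\<phi> z) *v v = (z powi p * cnj z powi q) *s v}"

definition hodge_structure :: "int \<Rightarrow> (complex \<Rightarrow> real ^ 'n ^ 'n) \<Rightarrow> bool" where
  "hodge_structure w \<phi> \<longleftrightarrow>
     \<phi> 1 = mat 1 \<and>
     (\<forall>x y. x \<noteq> 0 \<longrightarrow> y \<noteq> 0 \<longrightarrow> \<phi> (x * y) = \<phi> x ** \<phi> y) \<and>
     is_direct_sum UNIV (\<lambda>p. hodge_piece \<phi> p (w - p))"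

text \<open>The two Hodge-Riemann bilinear relations.\<close>

definition polarized_by :: "(rat ^ 'n \<Rightarrow> rat ^ 'n \<Rightarrow> rat) \<Rightarrow> (complex \<Rightarrow> real ^ 'n ^ 'n) \<Rightarrow> bool" where
  "polarized_by Q \<phi> \<longleftrightarrow>
     (\<forall>p q p' q' u v. u \<in> hodge_piece \<phi> p q \<longrightarrow> v \<in> hodge_piece \<phi> p' q' \<longrightarrow> (p', q') \<noteq> (q, p)
        \<longrightarrow> bilin_ext Q u v = 0) \<and>
     (\<forall>p q v. v \<in> hodge_piece \<phi> p q \<longrightarrow> v \<noteq> 0 \<longrightarrow>
        \<i> powi (p - q) * bilin_ext Q v (vec_cnj v) \<in> \<real> \<and>
        Re (\<i> powi (p - q) * bilin_ext Q v (vec_cnj v)) > 0)"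

definition period_domain ::
  "(rat ^ 'n \<Rightarrow> rat ^ 'n \<Rightarrow> rat) \<Rightarrow> int \<Rightarrow> (int \<Rightarrow> int \<Rightarrow> nat) \<Rightarrow> (complex \<Rightarrow> real ^ 'n ^ 'n) set" where
  "period_domain Q w h =
     {\<phi>. hodge_structure w \<phi> \<and> polarized_by Q \<phi> \<and>
         (\<forall>p q. p + q = w \<longrightarrow> vec.dim (hodge_piece \<phi> p q) = h p q)}"

definition sub_hodge_structure :: "int \<Rightarrow> (complex \<Rightarrow> real ^ 'n ^ 'n) \<Rightarrow> (rat ^ 'n) set \<Rightarrow> bool" where
  "sub_hodge_structure w \<phi> W \<longleftrightarrow>
     vec.subspace W \<and>
     is_direct_sum (complexification W) (\<lambda>p. complexification W \<inter> hodge_piece \<phi> p (w - p))"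

definition hodge_irreducible :: "int \<Rightarrow> (complex \<Rightarrow> real ^ 'n ^ 'n) \<Rightarrow> bool" where
  "hodge_irreducible w \<phi> \<longleftrightarrow> (\<forall>W. sub_hodge_structure w \<phi> W \<longrightarrow> W = {0} \<or> W = UNIV)"


subsection \<open>Algebraic groups, their dimension and Lie algebra\<close>

text \<open>
  Polynomials with coefficients in K in the functions from B, as functions.  Since the
  field is infinite, polynomials in coordinate functions and polynomial functions agree.
\<close>

inductive_set poly_funs :: "complex set \<Rightarrow> ('x \<Rightarrow> complex) set \<Rightarrow> ('x \<Rightarrow> complex) set"
  for K :: "complex set" and B :: "('x \<Rightarrow> complex) set" where
  const: "c \<in> K \<Longrightarrow> (\<lambda>_. c) \<in> poly_funs K B"
| gen: "b \<in> B \<Longrightarrow> b \<in> poly_funs K B"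
| add: "p \<in> poly_funs K B \<Longrightarrow> q \<in> poly_funs K B \<Longrightarrow> (\<lambda>x. p x + q x) \<in> poly_funs K B"
| mult: "p \<in> poly_funs K B \<Longrightarrow> q \<in> poly_funs K B \<Longrightarrow> (\<lambda>x. p x * q x) \<in> poly_funs K B"

definition mat_polys :: "complex set \<Rightarrow> (complex ^ 'n ^ 'n \<Rightarrow> complex) set" where
  "mat_polys K = poly_funs K {\<lambda>A. A $ i $ j | i j. True}"

text \<open>
  Closed Q-subgroups of GL(V).  Multiplying by powers of the determinant shows that
  equations in the matrix entries suffice to cut out every closed subset of GL(V).
\<close>

definition rat_algebraic_group :: "(complex ^ 'n ^ 'n) set \<Rightarrow> bool" where
  "rat_algebraic_group H \<longleftrightarrow>
     (\<exists>S \<subseteq> mat_polys \<rat>. H = {A. invertible A \<and> (\<forall>p\<in>S. p A = 0)}) \<and>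
     mat 1 \<in> H \<and> (\<forall>A\<in>H. \<forall>B\<in>H. A ** B \<in> H) \<and> (\<forall>A\<in>H. matrix_inv A \<in> H)"

lemma rat_algebraic_group_Inter:
  fixes \<H> :: "(complex ^ 'n ^ 'n) set set"
  assumes ne: "\<H> \<noteq> {}" and alg: "\<And>H. H \<in> \<H> \<Longrightarrow> rat_algebraic_group H"
  shows "rat_algebraic_group (\<Inter>\<H>)"
proof -
  define I where "I = (\<lambda>H :: (complex ^ 'n ^ 'n) set. {p \<in> mat_polys \<rat>. \<forall>A\<in>H. p A = 0})"
  have mem: "A \<in> H \<longleftrightarrow> invertible A \<and> (\<forall>p\<in>I H. p A = 0)" if H: "H \<in> \<H>" for A H
  proof -
    obtain S where S: "S \<subseteq> mat_polys \<rat>" "H = {A. invertible A \<and> (\<forall>p\<in>S. p A = 0)}"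
      using alg[OF H] unfolding rat_algebraic_group_def by (elim conjE exE)
    have "S \<subseteq> I H"
      using S(1) unfolding I_def by (subst S(2)) auto
    then show ?thesis
      using S(2) unfolding I_def by auto
  qed
  have "\<Inter>\<H> = {A. invertible A \<and> (\<forall>p\<in>(\<Union>H\<in>\<H>. I H). p A = 0)}"
  proof (rule set_eqI)
    fix A
    have "A \<in> \<Inter>\<H> \<longleftrightarrow> (\<forall>H\<in>\<H>. invertible A \<and> (\<forall>p\<in>I H. p A = 0))"
      unfolding Inter_iff by (intro ball_cong refl) (rule mem)
    then show "A \<in> \<Inter>\<H> \<longleftrightarrow> A \<in> {A. invertible A \<and> (\<forall>p\<in>(\<Union>H\<in>\<H>. I H). p A = 0)}"
      using ne by auto
  qed
  moreover have "(\<Union>H\<in>\<H>. I H) \<subseteq> mat_polys \<rat>"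
    by (auto simp: I_def)
  ultimately have "\<exists>S \<subseteq> mat_polys \<rat>. \<Inter>\<H> = {A. invertible A \<and> (\<forall>p\<in>S. p A = 0)}"
    by (intro exI[of _ "\<Union>H\<in>\<H>. I H"] conjI)
  moreover have "mat 1 \<in> \<Inter>\<H>"
    using alg unfolding rat_algebraic_group_def by simp
  moreover have "A ** B \<in> \<Inter>\<H>" if "A \<in> \<Inter>\<H>" "B \<in> \<Inter>\<H>" for A B
    using alg that unfolding rat_algebraic_group_def by simp
  moreover have "matrix_inv A \<in> \<Inter>\<H>" if "A \<in> \<Inter>\<H>" for A
    using alg that unfolding rat_algebraic_group_def by simp
  ultimately show ?thesis
    unfolding rat_algebraic_group_def by (intro conjI ballI)
qed

lemma rat_algebraic_group_GL: "rat_algebraic_group {A :: complex ^ 'n ^ 'n. invertible A}"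
proof -
  have "invertible (matrix_inv A)" if "invertible A" for A :: "complex ^ 'n ^ 'n"
  proof -
    have "A ** matrix_inv A = mat 1 \<and> matrix_inv A ** A = mat 1"
      using that unfolding invertible_def matrix_inv_def by (rule someI_ex)
    then show ?thesis
      unfolding invertible_def by (intro exI[of _ A]) simp
  qed
  moreover have "invertible (mat 1 :: complex ^ 'n ^ 'n)"
    unfolding invertible_def by (intro exI[of _ "mat 1"]) simp
  moreover have "\<exists>S \<subseteq> mat_polys \<rat>. {A :: complex ^ 'n ^ 'n. invertible A} =
      {A. invertible A \<and> (\<forall>p\<in>S. p A = 0)}"
    by (intro exI[of _ "{}"]) simp
  ultimately show ?thesis
    unfolding rat_algebraic_group_def by (simp add: invertible_mult)
qed

definition real_points :: "(complex ^ 'n ^ 'n) set \<Rightarrow> (real ^ 'n ^ 'n) set" where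
  "real_points H = {g. map_matrix complex_of_real g \<in> H}"

text \<open>
  The dimension of an algebraic set is the transcendence degree of its coordinate ring:
  the largest number of regular functions on X that are algebraically independent over C.
  (For reducible X this is the maximum over the components.  A function \<open>f/det\<^sup>k\<close> on a subset
  of GL(V) is algebraic over the functions f and det, so polynomial functions are enough.
  The set below is bounded by the number of matrix entries, so that \<open>Sup\<close> is a maximum.)
\<close>

definition alg_independent_on ::
  "(complex ^ 'n ^ 'n) set \<Rightarrow> nat \<Rightarrow> (nat \<Rightarrow> complex ^ 'n ^ 'n \<Rightarrow> complex) \<Rightarrow> bool" where
  "alg_independent_on X d f \<longleftrightarrow>
     (\<forall>P \<in> poly_funs UNIV {\<lambda>x::nat \<Rightarrow> complex. x i | i. i < d}.
        (\<forall>A\<in>X. P (\<lambda>i. f i A) = 0) \<longrightarrow> P = (\<lambda>_. 0))"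

definition alg_dim :: "(complex ^ 'n ^ 'n) set \<Rightarrow> nat" where
  "alg_dim X = Sup {d. \<exists>f. (\<forall>i<d. f i \<in> mat_polys UNIV) \<and> alg_independent_on X d f}"

text \<open>
  The rational Lie algebra is the Zariski tangent space at the identity: the rational X
  that are annihilated by the differential at 1 of every rational equation of the group.
\<close>

definition rat_lie_algebra :: "(complex ^ 'n ^ 'n) set \<Rightarrow> (rat ^ 'n ^ 'n) set" where
  "rat_lie_algebra H =
     {X. \<forall>p \<in> mat_polys \<rat>. (\<forall>A\<in>H. p A = 0) \<longrightarrow>
           ((\<lambda>t. p (mat 1 + cscale t (map_matrix of_rat X))) has_field_derivative 0) (at 0)}"

text \<open>The Lie algebra of G = Aut(V, Q).\<close>

definition isometry_lie_algebra :: "(rat ^ 'n \<Rightarrow> rat ^ 'n \<Rightarrow> rat) \<Rightarrow> (rat ^ 'n ^ 'n) set" where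
  "isometry_lie_algebra Q = {X. \<forall>u v. Q (X *v u) v + Q u (X *v v) = 0}"


subsection \<open>Mumford-Tate groups and domains\<close>

text \<open>
  The smallest Q-algebraic subgroup of GL(V) whose real points contain the image of the unit
  circle.  For polarized \<open>\<phi>\<close> it lies in G, as G is itself such a group.
\<close>

definition mumford_tate_group :: "(complex \<Rightarrow> real ^ 'n ^ 'n) \<Rightarrow> (complex ^ 'n ^ 'n) set" where
  "mumford_tate_group \<phi> = \<Inter>{H. rat_algebraic_group H \<and> \<phi> ` sphere 0 1 \<subseteq> real_points H}"

lemma mumford_tate_group_algebraic:
  fixes \<phi> :: "complex \<Rightarrow> real ^ 'n ^ 'n"
  assumes "\<phi> 1 = mat 1" and "\<And>x y. x \<noteq> 0 \<Longrightarrow> y \<noteq> 0 \<Longrightarrow> \<phi> (x * y) = \<phi> x ** \<phi> y"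
  shows "rat_algebraic_group (mumford_tate_group \<phi>)"
  unfolding mumford_tate_group_def
proof (rule rat_algebraic_group_Inter)
  have "invertible (map_matrix complex_of_real (\<phi> z))" if "z \<in> sphere 0 1" for z
  proof -
    have z: "z \<noteq> 0" using that by auto
    have map_mult: "map_matrix complex_of_real (A ** B) =
        map_matrix complex_of_real A ** map_matrix complex_of_real B" for A B :: "real ^ 'n ^ 'n"
      by (simp add: vec_eq_iff matrix_matrix_mult_def)
    have map_1: "map_matrix complex_of_real (mat 1) = mat 1"
      by (simp add: vec_eq_iff mat_def)
    have "\<phi> z ** \<phi> (inverse z) = mat 1" "\<phi> (inverse z) ** \<phi> z = mat 1"
      using assms(2)[of z "inverse z"] assms(2)[of "inverse z" z] z assms(1) by auto
    then show ?thesis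
      unfolding invertible_def by (metis map_mult map_1)
  qed
  then show "{H. rat_algebraic_group H \<and> \<phi> ` sphere 0 1 \<subseteq> real_points H} \<noteq> {}"
    using rat_algebraic_group_GL by (force simp: real_points_def)
qed auto

definition mumford_tate_domain ::
  "(complex ^ 'n ^ 'n) set \<Rightarrow> (complex \<Rightarrow> real ^ 'n ^ 'n) \<Rightarrow> (complex \<Rightarrow> real ^ 'n ^ 'n) set" where
  "mumford_tate_domain M \<phi>' =
     {\<psi>. \<exists>g \<in> real_points M. \<forall>z. z \<noteq> 0 \<longrightarrow> \<psi> z = g ** \<phi>' z ** matrix_inv g}"

definition is_CM :: "(complex \<Rightarrow> real ^ 'n ^ 'n) \<Rightarrow> bool" where
  "is_CM \<phi> \<longleftrightarrow> (\<forall>A \<in> mumford_tate_group \<phi>. \<forall>B \<in> mumford_tate_group \<phi>. A ** B = B ** A)"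

definition nondegenerate :: "(complex \<Rightarrow> real ^ 'n ^ 'n) \<Rightarrow> bool" where
  "nondegenerate (\<phi> :: complex \<Rightarrow> real ^ 'n ^ 'n) \<longleftrightarrow>
     real (alg_dim (mumford_tate_group \<phi>)) = real CARD('n) / 2"

end

theory Submission
  imports Defs "HOL-Computational_Algebra.Fundamental_Theorem_Algebra" "HOL-Library.Function_Algebras"
begin

text \<open>
  The Mumford-Tate group T of \<open>\<phi>\<close> is commutative, so T has a common eigenvector; its Galois conjugates
  span a rational subspace, hence a basis of eigenvectors exists.  Nondegeneracy makes the
  characters of T on this basis as independent as the form permits: they come in n pairs of
  mutually inverse ones, without further relations, and the roots of the symplectic Lie algebra are
  pairwise distinct on T.  The Lie algebra of M is stable under T, hence it is determined by the
  relation "the difference of a and b is a root of M" on the eigenlines, a preorder that is invariant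
  under the Galois group.  By irreducibility the Galois group permutes the eigenlines
  transitively.  Hence it is an equivalence relation with classes of equal size, and N respects the
  classes.  If there were at least two of them, the n-th power of N would vanish.  So all
  roots occur and the Lie algebra of M is everything.

  Galois conjugation is realized by embeddings of finitely generated subfields of the complex
  numbers, which suffice for descent: a subspace that they preserve is spanned by rational vectors.
\<close>

section \<open>Embeddings of fields of complex numbers\<close>

text \<open>Three obstacles shape the proof. An automorphism of all complex numbers would need
  transfinite extension, so conjugation is a map on a countable subfield, extended by one number at
  a time; countability leaves room for the image of a transcendental number. Such maps need not
  compose, so transitivity on eigenlines is proved for chains of conjugations. Second,
  \<open>alg_dim\<close> counts independent functions, and its link to the rank r of the character
  group is a growth estimate: monomials in the characters of degree up to K have only about K^r
  restrictions to T, while d independent functions have k^d independent monomials. So r is at least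
  half the number of eigenlines, and duality allows no more. Third, two roots agree on T only at
  positions (a, b) and (bar b, bar a), which the alternating form ties to each other; this makes the
  root spaces lines. The diagonal part is recovered from brackets of opposite root vectors. As for
  the bound on l: the dimension is even, so l - 1 is at least half of it, and no class can be larger
  than this half when there are two.\<close>

locale field_embedding =
  fixes F :: "complex set" and \<sigma> :: "complex \<Rightarrow> complex"
  assumes one_mem: "1 \<in> F"
    and diff_mem: "\<And>x y. x \<in> F \<Longrightarrow> y \<in> F \<Longrightarrow> x - y \<in> F"
    and mult_mem: "\<And>x y. x \<in> F \<Longrightarrow> y \<in> F \<Longrightarrow> x * y \<in> F"
    and inverse_mem: "\<And>x. x \<in> F \<Longrightarrow> inverse x \<in> F"
    and hom_one: "\<sigma> 1 = 1"
    and hom_diff: "\<And>x y. x \<in> F \<Longrightarrow> y \<in> F \<Longrightarrow> \<sigma> (x - y) = \<sigma> x - \<sigma> y"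
    and hom_mult: "\<And>x y. x \<in> F \<Longrightarrow> y \<in> F \<Longrightarrow> \<sigma> (x * y) = \<sigma> x * \<sigma> y"
begin

lemma zero_mem: "0 \<in> F"
  using diff_mem[OF one_mem one_mem] by simp

lemma hom_zero: "\<sigma> 0 = 0"
  using hom_diff[OF one_mem one_mem] by simp

lemma uminus_mem: "x \<in> F \<Longrightarrow> - x \<in> F"
  using diff_mem[OF zero_mem, of x] by simp

lemma hom_uminus: "x \<in> F \<Longrightarrow> \<sigma> (- x) = - \<sigma> x"
  using hom_diff[OF zero_mem, of x] by (simp add: hom_zero)

lemma add_mem: "x \<in> F \<Longrightarrow> y \<in> F \<Longrightarrow> x + y \<in> F"
  using diff_mem[of x "- y"] by (simp add: uminus_mem)

lemma hom_add: "x \<in> F \<Longrightarrow> y \<in> F \<Longrightarrow> \<sigma> (x + y) = \<sigma> x + \<sigma> y"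
  using hom_diff[of x "- y"] by (simp add: uminus_mem hom_uminus)

lemma divide_mem: "x \<in> F \<Longrightarrow> y \<in> F \<Longrightarrow> x / y \<in> F"
  by (simp add: divide_inverse mult_mem inverse_mem)

lemma hom_eq_0_iff: assumes "x \<in> F" shows "\<sigma> x = 0 \<longleftrightarrow> x = 0"
proof
  assume "\<sigma> x = 0"
  show "x = 0"
  proof (rule ccontr)
    assume "x \<noteq> 0"
    then have "\<sigma> x * \<sigma> (inverse x) = 1"
      using hom_mult[OF assms inverse_mem[OF assms]] by (simp add: hom_one)
    with \<open>\<sigma> x = 0\<close> show False by simp
  qed
qed (simp add: hom_zero)

lemma sum_mem: "(\<And>i. i \<in> A \<Longrightarrow> f i \<in> F) \<Longrightarrow> sum f A \<in> F"
  by (induction A rule: infinite_finite_induct) (auto simp: zero_mem add_mem)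

lemma hom_sum: "(\<And>i. i \<in> A \<Longrightarrow> f i \<in> F) \<Longrightarrow> \<sigma> (sum f A) = (\<Sum>i\<in>A. \<sigma> (f i))"
  by (induction A rule: infinite_finite_induct) (auto simp: hom_zero sum_mem hom_add)

lemma of_nat_mem: "of_nat n \<in> F"
  by (induction n) (auto simp: zero_mem one_mem add_mem)

lemma hom_of_nat: "\<sigma> (of_nat n) = of_nat n"
  by (induction n) (auto simp: hom_zero hom_one hom_add one_mem of_nat_mem)

lemma of_int_mem: "of_int n \<in> F"
  by (cases n rule: int_cases2) (auto simp: of_nat_mem uminus_mem)

lemma hom_of_int: "\<sigma> (of_int n) = of_int n"
  by (cases n rule: int_cases2) (auto simp: hom_of_nat of_nat_mem hom_uminus)

lemma Rats_mem: "x \<in> \<rat> \<Longrightarrow> x \<in> F"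
  by (elim Rats_cases') (simp add: divide_mem of_int_mem)

lemma hom_Rats: assumes "x \<in> \<rat>" shows "\<sigma> x = x"
proof -
  from assms obtain a b where ab: "b > 0" "x = of_int a / of_int b"
    by (elim Rats_cases')
  have "\<sigma> x * \<sigma> (of_int b) = \<sigma> (of_int a)"
    using hom_mult[OF Rats_mem[OF assms] of_int_mem[of b]] ab by simp
  then have "\<sigma> x * of_int b = x * of_int b"
    using ab by (simp add: hom_of_int)
  then show ?thesis
    using ab(1) by simp
qed

section \<open>Polynomials over F and the action of \<sigma> on them\<close>

definition polys :: "complex poly set" where
  "polys = {p. \<forall>i. coeff p i \<in> F}"

abbreviation conj_poly :: "complex poly \<Rightarrow> complex poly" where
  "conj_poly \<equiv> map_poly \<sigma>"

lemma polys_diff: "p \<in> polys \<Longrightarrow> q \<in> polys \<Longrightarrow> p - q \<in> polys"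
  by (simp add: polys_def diff_mem)

lemma polys_add: "p \<in> polys \<Longrightarrow> q \<in> polys \<Longrightarrow> p + q \<in> polys"
  by (simp add: polys_def add_mem)

lemma polys_mult: "p \<in> polys \<Longrightarrow> q \<in> polys \<Longrightarrow> p * q \<in> polys"
  by (auto simp: polys_def coeff_mult intro!: sum_mem mult_mem)

lemma polys_monom: "c \<in> F \<Longrightarrow> monom c n \<in> polys"
  by (auto simp: polys_def zero_mem)

lemma coeff_conj: "coeff (conj_poly p) i = \<sigma> (coeff p i)"
  by (simp add: coeff_map_poly hom_zero)

lemma conj_diff: "p \<in> polys \<Longrightarrow> q \<in> polys \<Longrightarrow> conj_poly (p - q) = conj_poly p - conj_poly q"
  by (simp add: poly_eq_iff coeff_conj polys_def hom_diff)

lemma conj_mult: "p \<in> polys \<Longrightarrow> q \<in> polys \<Longrightarrow> conj_poly (p * q) = conj_poly p * conj_poly q"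
  by (simp add: poly_eq_iff coeff_conj polys_def coeff_mult hom_sum hom_mult mult_mem)

lemma conj_eq_0_iff: "p \<in> polys \<Longrightarrow> conj_poly p = 0 \<longleftrightarrow> p = 0"
  by (simp add: poly_eq_iff coeff_conj polys_def hom_eq_0_iff)

lemma degree_conj: assumes "p \<in> polys" shows "degree (conj_poly p) = degree p"
proof (cases "p = 0")
  case False
  then have "\<sigma> (lead_coeff p) \<noteq> 0"
    using assms hom_eq_0_iff by (simp add: polys_def)
  then show ?thesis
    by (intro antisym degree_le le_degree) (auto simp: coeff_conj coeff_eq_0 hom_zero)
qed simp

lemma countable_polys: assumes "countable F" shows "countable polys"
proof (rule countable_subset)
  show "polys \<subseteq> Poly ` lists F"
  proof
    fix p assume "p \<in> polys"
    then have "set (coeffs p) \<subseteq> F"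
      by (auto simp: polys_def coeffs_def)
    then show "p \<in> Poly ` lists F"
      by (intro image_eqI[of _ _ "coeffs p"]) auto
  qed
qed (use assms in auto)

text \<open>Long division by g divides only by its leading coefficient, so it never leaves F. As F
  is a set and not a type, the descent on the degree is carried out with membership in
  \<open>polys\<close> kept along.\<close>

lemma polys_division:
  assumes "g \<in> polys" "g \<noteq> 0" "p \<in> polys"
  shows "\<exists>q\<in>polys. \<exists>r\<in>polys. p = g * q + r \<and> (r = 0 \<or> degree r < degree g)"
  using assms(3)
proof (induction "degree p" arbitrary: p rule: less_induct)
  case less
  show ?case
  proof (cases "p = 0 \<or> degree p < degree g")
    case True
    then show ?thesis
      using less.prems polys_monom[OF zero_mem, of 0] by (intro bexI[of _ 0] bexI[of _ p]) auto
  next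
    case False
    define c where "c = monom (lead_coeff p / lead_coeff g) (degree p - degree g)"
    have c: "c \<in> polys"
      unfolding c_def using less.prems assms(1) by (intro polys_monom divide_mem) (auto simp: polys_def)
    have gc: "g * c \<in> polys" using c assms(1) by (rule polys_mult[rotated])
    have lc: "lead_coeff p / lead_coeff g \<noteq> 0" using False assms(2) by simp
    have c0: "c \<noteq> 0" using lc by (simp add: c_def)
    have dc: "degree (g * c) = degree p"
      using False c0 assms(2) lc by (simp add: degree_mult_eq c_def degree_monom_eq)
    have lcc: "coeff (g * c) (degree p) = lead_coeff p"
      using dc assms(2) lead_coeff_mult[of g c] lc by (simp add: c_def degree_monom_eq)
    show ?thesis
    proof (cases "p - g * c = 0")
      case True
      then show ?thesis
        using c polys_monom[OF zero_mem, of 0] by (intro bexI[of _ c] bexI[of _ 0]) auto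
    next
      case nz: False
      have "degree (p - g * c) < degree p"
      proof (rule ccontr)
        assume "\<not> degree (p - g * c) < degree p"
        moreover have "degree (p - g * c) \<le> degree p"
          using dc by (intro degree_diff_le) auto
        ultimately have "degree (p - g * c) = degree p" by simp
        then have "lead_coeff (p - g * c) = 0" using lcc by (simp only: coeff_diff) simp
        then show False using nz by (simp only: leading_coeff_0_iff)
      qed
      from less.hyps[OF this polys_diff[OF less.prems gc]]
      obtain q r where qr: "q \<in> polys" "r \<in> polys" "p - g * c = g * q + r"
        "r = 0 \<or> degree r < degree g" by blast
      then have "p = g * (q + c) + r" by (simp add: algebra_simps)
      then show ?thesis using qr c polys_add by blast
    qed
  qed
qed

text \<open>The remainder of p by an element of least degree lies in I and must vanish. I has to
  behave like an ideal only inside \<open>polys\<close>, so it can be the condition of vanishing at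
  a point, with or without conjugation.\<close>

lemma ideal_generator:
  assumes ideal: "\<And>p q. p \<in> polys \<Longrightarrow> q \<in> polys \<Longrightarrow> p \<in> I \<Longrightarrow> p * q \<in> I"
    "\<And>p q. p \<in> polys \<Longrightarrow> q \<in> polys \<Longrightarrow> p \<in> I \<Longrightarrow> q \<in> I \<Longrightarrow> p - q \<in> I"
    and nz: "p \<in> polys" "p \<in> I" "p \<noteq> 0"
  obtains g where "g \<in> polys" "g \<in> I" "g \<noteq> 0"
    "\<And>p. p \<in> polys \<Longrightarrow> p \<in> I \<Longrightarrow> p \<noteq> 0 \<Longrightarrow> degree g \<le> degree p"
    "\<And>p. p \<in> polys \<Longrightarrow> p \<in> I \<Longrightarrow> \<exists>q\<in>polys. p = g * q"
proof -
  obtain g where g: "g \<in> polys \<and> g \<in> I \<and> g \<noteq> 0"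
    and min: "\<And>p. p \<in> polys \<and> p \<in> I \<and> p \<noteq> 0 \<Longrightarrow> degree g \<le> degree p"
    using exists_least_lemma[of "\<lambda>d. \<exists>p. p \<in> polys \<and> p \<in> I \<and> p \<noteq> 0 \<and> degree p = d"] nz
      arg_min_nat_lemma[of "\<lambda>p. p \<in> polys \<and> p \<in> I \<and> p \<noteq> 0" p degree] by blast
  have "\<exists>q\<in>polys. p = g * q" if p: "p \<in> polys" "p \<in> I" for p
  proof -
    obtain q r where qr: "q \<in> polys" "r \<in> polys" "p = g * q + r" "r = 0 \<or> degree r < degree g"
      using polys_division[of g p] g p by blast
    have "g * q \<in> I" using ideal(1) g qr by blast
    then have "p - g * q \<in> I" using ideal(2) p qr g polys_mult by blast
    then have "r \<in> I" using qr by simp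
    then have "r = 0" using min[of r] qr by force
    then show ?thesis using qr by auto
  qed
  then show thesis using g min that by blast
qed

lemma minimal_polynomial:
  assumes "p \<in> polys" "poly p x = 0" "p \<noteq> 0"
  obtains f where "f \<in> polys" "poly f x = 0" "f \<noteq> 0"
    "\<And>p. p \<in> polys \<Longrightarrow> poly p x = 0 \<Longrightarrow> p \<noteq> 0 \<Longrightarrow> degree f \<le> degree p"
  by (rule ideal_generator[of "{p. poly p x = 0}" p]) (use assms in auto)

text \<open>This is the irreducibility of a minimal polynomial f. From left to right, f divides p.
  Conversely, the polynomials whose conjugate kills y have a generator g, which divides f and is not
  constant; the cofactor is then too small in degree to vanish at x, so g vanishes there, and with
  it p.\<close>

lemma root_transfer:
  assumes f: "f \<in> polys" "f \<noteq> 0" "poly f x = 0"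
    and min: "\<And>p. p \<in> polys \<Longrightarrow> poly p x = 0 \<Longrightarrow> p \<noteq> 0 \<Longrightarrow> degree f \<le> degree p"
    and y: "poly (conj_poly f) y = 0" and p: "p \<in> polys"
  shows "poly p x = 0 \<longleftrightarrow> poly (conj_poly p) y = 0"
proof
  assume "poly p x = 0"
  then obtain q where "q \<in> polys" "p = f * q"
  proof -
    obtain q r where qr: "q \<in> polys" "r \<in> polys" "p = f * q + r" "r = 0 \<or> degree r < degree f"
      using polys_division[of f p] f p by blast
    then have "poly r x = 0" using f \<open>poly p x = 0\<close> by simp
    then have "r = 0" using min[of r] qr by force
    then show thesis using that qr by auto
  qed
  then show "poly (conj_poly p) y = 0" using y f by (simp add: conj_mult)
next
  assume py: "poly (conj_poly p) y = 0"
  let ?I = "{p. poly (conj_poly p) y = 0}"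
  obtain g where g: "g \<in> polys" "g \<in> ?I" "g \<noteq> 0"
    and div: "\<And>p. p \<in> polys \<Longrightarrow> p \<in> ?I \<Longrightarrow> \<exists>q\<in>polys. p = g * q"
    by (rule ideal_generator[of ?I f]) (use f y in \<open>auto simp: conj_mult conj_diff\<close>)
  obtain h where h: "h \<in> polys" "f = g * h" using div[of f] f y by auto
  have h0: "h \<noteq> 0" using h f by auto
  have dg: "degree g \<noteq> 0"
  proof
    assume "degree g = 0"
    then obtain c where c: "g = [:c:]" by (rule degree_eq_zeroE)
    then have "conj_poly g = [:\<sigma> c:]" by (simp add: map_poly_pCons hom_zero)
    then have "\<sigma> c = 0" using g by simp
    moreover have "c \<in> F" using g(1) c by (auto simp: polys_def dest: spec[of _ 0])
    ultimately show False using c g hom_eq_0_iff by auto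
  qed
  have "poly h x \<noteq> 0"
  proof
    assume "poly h x = 0"
    then have "degree f \<le> degree h" using min h h0 by blast
    then show False using h dg h0 g by (simp add: degree_mult_eq)
  qed
  then have "poly g x = 0" using f h by simp
  moreover obtain q where "p = g * q" using div[of p] p py by auto
  ultimately show "poly p x = 0" by simp
qed

text \<open>The larger field consists of the fractions p(x)/q(x), which go to the conjugate
  fractions at y. The assumption makes the value independent of the fraction and keeps denominators
  nonzero. It holds for conjugate algebraic numbers and also for transcendental ones, where no
  nonzero polynomial vanishes on either side.\<close>

lemma extend_by_conjugate:
  assumes xy: "\<And>p. p \<in> polys \<Longrightarrow> poly p x = 0 \<longleftrightarrow> poly (conj_poly p) y = 0"
  obtains F' \<sigma>' where "field_embedding F' \<sigma>'" "F \<subseteq> F'" "x \<in> F'" "\<sigma>' x = y"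
    "\<And>z. z \<in> F \<Longrightarrow> \<sigma>' z = \<sigma> z" "countable F \<Longrightarrow> countable F'"
proof -
  define fr where "fr = (\<lambda>(p, q). poly p x / poly q x)"
  define fr' where "fr' = (\<lambda>(p, q). poly (conj_poly p) y / poly (conj_poly q) y)"
  define R where "R = {pq \<in> polys \<times> polys. poly (snd pq) x \<noteq> 0}"
  \<comment> \<open>One fraction is chosen for each z; \<open>eq\<close> shows that every other one
    gives the same value.\<close>
  define \<sigma>' where "\<sigma>' = (\<lambda>z. fr' (SOME pq. pq \<in> R \<and> z = fr pq))"
  have eq: "\<sigma>' (fr a) = fr' a" if a: "a \<in> R" for a
  proof -
    define b where "b = (SOME pq. pq \<in> R \<and> fr a = fr pq)"
    have b: "b \<in> R \<and> fr a = fr b"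
      unfolding b_def by (rule someI[of _ a]) (use a in simp)
    obtain p q where pq: "a = (p, q)" by force
    obtain p' q' where pq': "b = (p', q')" by force
    have mem: "p \<in> polys" "q \<in> polys" "p' \<in> polys" "q' \<in> polys" "poly q x \<noteq> 0" "poly q' x \<noteq> 0"
      using a b pq pq' by (auto simp: R_def)
    have "poly (p * q' - p' * q) x = 0"
      using b mem pq pq' by (simp add: fr_def field_simps)
    then have "poly (conj_poly (p * q' - p' * q)) y = 0"
      using xy[of "p * q' - p' * q"] mem by (simp add: polys_diff polys_mult)
    moreover have "poly (conj_poly q) y \<noteq> 0" "poly (conj_poly q') y \<noteq> 0"
      using xy mem by auto
    ultimately have "fr' b = fr' a"
      using mem pq pq' by (simp add: fr'_def conj_diff conj_mult polys_mult field_simps)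
    then show ?thesis by (simp add: \<sigma>'_def b_def)
  qed
  have const: "[:c:] \<in> polys" if "c \<in> F" for c
    using polys_monom[of c 0] that by (simp add: monom_0)
  have cconst: "conj_poly [:c:] = [:\<sigma> c:]" for c
    by (simp add: map_poly_pCons hom_zero)
  have embF: "z = fr ([:z:], [:1:])" "([:z:], [:1:]) \<in> R" "fr' ([:z:], [:1:]) = \<sigma> z" if "z \<in> F" for z
    using that const[OF that] const[OF one_mem] by (auto simp: fr_def R_def fr'_def cconst hom_one)
  have X: "x = fr ([:0, 1:], [:1:])" "([:0,1:], [:1:]) \<in> R" "fr' ([:0,1:], [:1:]) = y"
    using polys_monom[OF one_mem, of 1] const[OF one_mem]
    by (auto simp: fr_def R_def fr'_def map_poly_pCons hom_zero hom_one monom_altdef)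
  have xy': "poly (conj_poly p) y \<noteq> 0" if "p \<in> polys" "poly p x \<noteq> 0" for p
    using xy that by auto
  have emb: "field_embedding (fr ` R) \<sigma>'"
  proof
    show "1 \<in> fr ` R" using embF[OF one_mem] by blast
    show "\<sigma>' 1 = 1" using eq[OF embF(2)[OF one_mem]] embF[OF one_mem] hom_one by simp
    fix u v assume "u \<in> fr ` R" "v \<in> fr ` R"
    then obtain p q p' q' where uv: "u = fr (p, q)" "v = fr (p', q')" "(p, q) \<in> R" "(p', q') \<in> R"
      by force
    then have mem: "p \<in> polys" "q \<in> polys" "p' \<in> polys" "q' \<in> polys" "poly q x \<noteq> 0" "poly q' x \<noteq> 0"
      by (auto simp: R_def)
    have d: "u - v = fr (p * q' - p' * q, q * q')" "(p * q' - p' * q, q * q') \<in> R"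
      using mem uv by (auto simp: R_def fr_def diff_frac_eq polys_mult polys_diff)
    have m: "u * v = fr (p * p', q * q')" "(p * p', q * q') \<in> R"
      using mem uv by (auto simp: R_def fr_def polys_mult)
    show "u - v \<in> fr ` R" "u * v \<in> fr ` R" using d m by blast+
    show "\<sigma>' (u - v) = \<sigma>' u - \<sigma>' v"
      unfolding d(1) eq[OF d(2)] unfolding uv eq[OF uv(3)] eq[OF uv(4)] using mem xy'[of q] xy'[of q']
      by (simp add: fr'_def conj_diff conj_mult polys_mult field_simps)
    show "\<sigma>' (u * v) = \<sigma>' u * \<sigma>' v"
      unfolding m(1) eq[OF m(2)] unfolding uv eq[OF uv(3)] eq[OF uv(4)] using mem
      by (simp add: fr'_def conj_mult)
  next
    fix u assume "u \<in> fr ` R"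
    then obtain p q where u: "u = fr (p, q)" "(p, q) \<in> R" by force
    show "inverse u \<in> fr ` R"
    proof (cases "poly p x = 0")
      case True
      then have "inverse u = 0" using u by (simp add: fr_def)
      then show ?thesis using embF(1,2)[OF zero_mem] by (metis imageI)
    next
      case False
      then have "(q, p) \<in> R" "inverse u = fr (q, p)" using u by (auto simp: R_def fr_def)
      then show ?thesis by blast
    qed
  qed
  show thesis
  proof (rule that[OF emb])
    show "F \<subseteq> fr ` R" using embF by blast
    show "x \<in> fr ` R" using X by blast
    show "\<sigma>' x = y" using eq[OF X(2)] X by simp
    show "\<sigma>' z = \<sigma> z" if "z \<in> F" for z
      using eq[OF embF(2)[OF that]] embF[OF that] by simp
    show "countable (fr ` R)" if "countable F"
      using countable_polys[OF that] by (intro countable_image countable_subset[of R "polys \<times> polys"])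
        (auto simp: R_def)
  qed
qed

text \<open>These are the values that the image of a transcendental number has to avoid.\<close>

lemma countable_conj_roots:
  assumes "countable F"
  shows "countable (\<Union>p\<in>polys - {0}. {y. poly (conj_poly p) y = 0})"
proof (rule countable_UN)
  show "countable (polys - {0})"
    using countable_polys[OF assms] by blast
  show "countable {y. poly (conj_poly p) y = 0}" if "p \<in> polys - {0}" for p
    using that by (intro countable_finite poly_roots_finite) (auto simp: conj_eq_0_iff)
qed

text \<open>An algebraic x goes to any root of the conjugate of its minimal polynomial. A
  transcendental x goes to a number outside the roots of all nonzero conjugate polynomials, which
  exists because F is countable.\<close>

lemma extend_embedding:
  assumes "countable F"
  obtains F' \<sigma>' where "field_embedding F' \<sigma>'" "F \<subseteq> F'" "x \<in> F'" "\<And>z. z \<in> F \<Longrightarrow> \<sigma>' z = \<sigma> z" "countable F'"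
proof -
  have "\<exists>y. \<forall>p\<in>polys. poly p x = 0 \<longleftrightarrow> poly (conj_poly p) y = 0"
  proof (cases "\<exists>p\<in>polys. poly p x = 0 \<and> p \<noteq> 0")
    case True
    then obtain f where f: "f \<in> polys" "poly f x = 0" "f \<noteq> 0"
      and min: "\<And>p. p \<in> polys \<Longrightarrow> poly p x = 0 \<Longrightarrow> p \<noteq> 0 \<Longrightarrow> degree f \<le> degree p"
      using minimal_polynomial by (metis (no_types, lifting))
    have "degree f \<noteq> 0"
    proof
      assume "degree f = 0"
      then obtain c where "f = [:c:]" by (rule degree_eq_zeroE)
      then show False using f by simp
    qed
    then have "\<not> constant (poly (conj_poly f))"
      using degree_conj[OF f(1)] by (simp add: constant_degree)
    then obtain y where "poly (conj_poly f) y = 0"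
      using fundamental_theorem_of_algebra by blast
    then show ?thesis
      using root_transfer[of f x y] f min by blast
  next
    case False
    obtain y where "y \<notin> (\<Union>p\<in>polys - {0}. {y. poly (conj_poly p) y = 0})"
      using countable_conj_roots[OF assms] uncountable_UNIV_complex
      by (metis UNIV_eq_I)
    then show ?thesis
      using False conj_eq_0_iff by (intro exI[of _ y]) auto
  qed
  then obtain y where "\<And>p. p \<in> polys \<Longrightarrow> poly p x = 0 \<longleftrightarrow> poly (conj_poly p) y = 0" by blast
  from extend_by_conjugate[OF this] assms show thesis using that by metis
qed

end

lemma field_embedding_Rats: "field_embedding \<rat> id"
  by unfold_locales auto

text \<open>If \<beta> is algebraic, its minimal polynomial over the rationals has degree above 1
  and a simple root at \<beta>, hence another root. If \<beta> is transcendental, any other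
  transcendental number will do.\<close>

lemma rational_conjugate_exists:
  assumes "\<beta> \<notin> \<rat>"
  obtains F \<sigma> where "field_embedding F \<sigma>" "countable F" "\<beta> \<in> F" "\<sigma> \<beta> \<noteq> \<beta>"
proof -
  interpret field_embedding \<rat> id by (rule field_embedding_Rats)
  have id: "conj_poly p = p" for p by (simp add: poly_eq_iff coeff_conj)
  have "\<exists>y. y \<noteq> \<beta> \<and> (\<forall>p\<in>polys. poly p \<beta> = 0 \<longleftrightarrow> poly (conj_poly p) y = 0)"
  proof (cases "\<exists>p\<in>polys. poly p \<beta> = 0 \<and> p \<noteq> 0")
    case True
    then obtain f where f: "f \<in> polys" "poly f \<beta> = 0" "f \<noteq> 0"
      and min: "\<And>p. p \<in> polys \<Longrightarrow> poly p \<beta> = 0 \<Longrightarrow> p \<noteq> 0 \<Longrightarrow> degree f \<le> degree p"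
      using minimal_polynomial by (metis (no_types, lifting))
    obtain g where g: "f = [:- \<beta>, 1:] * g" using f(2) by (auto simp: poly_eq_0_iff_dvd)
    have g0: "g \<noteq> 0" using g f by auto
    have df: "degree f = Suc (degree g)" using g0 by (simp add: g degree_mult_eq del: mult_pCons_left)
    have pd: "pderiv f \<in> polys"
      using f(1) by (auto simp: polys_def coeff_pderiv simp del: of_nat_Suc intro!: mult_mem of_nat_mem)
    \<comment> \<open>The derivative is nonzero in characteristic 0 and of smaller degree, so
      minimality of f forbids a zero at \<beta>. Hence \<beta> is not a root of the cofactor g, and
      every root of g is a different conjugate.\<close>
    have "poly (pderiv f) \<beta> \<noteq> 0"
    proof
      assume "poly (pderiv f) \<beta> = 0"
      moreover have "pderiv f \<noteq> 0" using df by (simp add: pderiv_eq_0_iff)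
      ultimately have "degree f \<le> degree (pderiv f)" using min pd by blast
      then show False using df by (simp add: degree_pderiv)
    qed
    then have gb: "poly g \<beta> \<noteq> 0"
      by (simp add: g pderiv_mult pderiv_pCons del: mult_pCons_left)
    have "degree g \<noteq> 0"
    proof
      assume "degree g = 0"
      then obtain c where c: "g = [:c:]" by (rule degree_eq_zeroE)
      then have "f = [:- \<beta> * c, c:]" using g by simp
      then have "c \<in> \<rat>" "- \<beta> * c \<in> \<rat>" using f(1)
        by (auto simp: polys_def dest: spec[of _ 0] spec[of _ 1])
      moreover have "\<beta> = - (- \<beta> * c / c)" using c g0 by simp
      ultimately show False using assms by (metis Rats_divide Rats_minus_iff)
    qed
    then obtain y where y: "poly g y = 0"
      using fundamental_theorem_of_algebra[of g] by (auto simp: constant_degree)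
    then have "y \<noteq> \<beta>" "poly (conj_poly f) y = 0" using gb g by (auto simp: id)
    then show ?thesis using root_transfer[of f \<beta> y] f min by blast
  next
    case False
    have "countable (insert \<beta> (\<Union>p\<in>polys - {0}. {y. poly (conj_poly p) y = 0}))"
      using countable_conj_roots countable_rat by simp
    then obtain y where "y \<notin> insert \<beta> (\<Union>p\<in>polys - {0}. {y. poly (conj_poly p) y = 0})"
      using uncountable_UNIV_complex by (metis UNIV_eq_I)
    then show ?thesis
      using False conj_eq_0_iff by (intro exI[of _ y]) auto
  qed
  then obtain y where "y \<noteq> \<beta>" "\<And>p. p \<in> polys \<Longrightarrow> poly p \<beta> = 0 \<longleftrightarrow> poly (conj_poly p) y = 0" by blast
  from extend_by_conjugate[OF this(2)] this(1) show thesis using that countable_rat by metis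
qed

text \<open>\<beta> is moved first, over the rationals, and Y is adjoined afterwards. In the
  opposite order \<beta> could already lie in the field generated by Y, with its image
  decided.\<close>

lemma conjugation_exists:
  assumes "finite Y" "\<beta> \<notin> \<rat>"
  obtains F \<sigma> where "field_embedding F \<sigma>" "Y \<subseteq> F" "\<beta> \<in> F" "\<sigma> \<beta> \<noteq> \<beta>"
proof -
  have "\<exists>F \<sigma>. field_embedding F \<sigma> \<and> countable F \<and> Y \<subseteq> F \<and> \<beta> \<in> F \<and> \<sigma> \<beta> \<noteq> \<beta>"
    using assms(1)
  proof induction
    case empty
    show ?case using rational_conjugate_exists[OF assms(2)] by (metis empty_subsetI)
  next
    case (insert x Y)
    then obtain F \<sigma> where F: "field_embedding F \<sigma>" "countable F" "Y \<subseteq> F" "\<beta> \<in> F" "\<sigma> \<beta> \<noteq> \<beta>" by blast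
    from field_embedding.extend_embedding[OF F(1,2), of x] obtain F' \<sigma>' where
      "field_embedding F' \<sigma>'" "F \<subseteq> F'" "x \<in> F'" "\<And>z. z \<in> F \<Longrightarrow> \<sigma>' z = \<sigma> z" "countable F'" by blast
    then show ?case using F by (intro exI[of _ F'] exI[of _ \<sigma>']) auto
  qed
  then show thesis using that by blast
qed


section \<open>Galois descent\<close>

text \<open>Functions on an arbitrary type rather than vectors: descent is applied to coordinates
  and also to families indexed by a finite set of complex numbers, and spans of polynomial functions
  are needed too.\<close>

interpretation fun_space: vector_space "\<lambda>(c::complex) (f::'i \<Rightarrow> complex) i. c * f i"
  by unfold_locales (auto simp: fun_eq_iff algebra_simps)

interpretation rat_space: vector_space "\<lambda>(q::rat) (x::complex). of_rat q * x"
  by unfold_locales (auto simp: algebra_simps of_rat_add of_rat_mult)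

lemma sum_fun_apply: "(\<Sum>k\<in>A. f k) x = (\<Sum>k\<in>A. f k x)"
  for f :: "'k \<Rightarrow> 'a \<Rightarrow> 'b::comm_monoid_add"
  by (induction A rule: infinite_finite_induct) auto

lemma span_vanish:
  assumes "u \<in> fun_space.span Z" "\<And>z. z \<in> Z \<Longrightarrow> z i = 0"
  shows "u i = 0"
  using assms(1) by (induction rule: fun_space.span_induct_alt) (auto simp: assms(2))

lemma finite_range_of_support:
  fixes u :: "'i \<Rightarrow> 'b::zero"
  assumes "finite I" "\<And>i. i \<notin> I \<Longrightarrow> u i = 0"
  shows "finite (range u)"
proof (rule finite_subset)
  show "range u \<subseteq> insert 0 (u ` I)"
    using assms(2) by blast
qed (use assms in simp)

text \<open>
  A subspace that is stable under all embeddings is spanned by rational vectors: a vector of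
  minimal support, normalized to have an entry 1, differs from its conjugates by vectors of
  smaller support, hence is fixed.
\<close>

context
  fixes Z :: "('i \<Rightarrow> complex) set" and I :: "'i set"
  assumes fin: "finite I" and supp: "\<And>z i. z \<in> Z \<Longrightarrow> i \<notin> I \<Longrightarrow> z i = 0"
    and stable: "\<And>z. z \<in> Z \<Longrightarrow> \<exists>Y. finite Y \<and>
      (\<forall>F \<sigma>. field_embedding F \<sigma> \<longrightarrow> Y \<subseteq> F \<longrightarrow> range z \<subseteq> F \<longrightarrow> \<sigma> \<circ> z \<in> fun_space.span Z)"
begin

lemma span_support: "u \<in> fun_space.span Z \<Longrightarrow> i \<notin> I \<Longrightarrow> u i = 0"
  using span_vanish supp by metis

text \<open>Y collects the coefficients and entries of a linear combination of elements of Z, so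
  that \<sigma> can be moved inside it. Membership in the span is carried through the induction
  because it shows that each partial sum has only finitely many values.\<close>

lemma span_conj:
  assumes "u \<in> fun_space.span Z"
  shows "\<exists>Y. finite Y \<and> (\<forall>F \<sigma>. field_embedding F \<sigma> \<longrightarrow> Y \<subseteq> F \<longrightarrow> \<sigma> \<circ> u \<in> fun_space.span Z)"
proof -
  have "u \<in> fun_space.span Z \<and>
    (\<exists>Y. finite Y \<and> (\<forall>F \<sigma>. field_embedding F \<sigma> \<longrightarrow> Y \<subseteq> F \<longrightarrow> \<sigma> \<circ> u \<in> fun_space.span Z))"
    using assms
  proof (induction rule: fun_space.span_induct_alt)
    case base
    have "\<sigma> \<circ> 0 \<in> fun_space.span Z" if "field_embedding F \<sigma>" for F \<sigma>
    proof -
      have "\<sigma> \<circ> 0 = (0 :: 'i \<Rightarrow> complex)"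
        using field_embedding.hom_zero[OF that] by (simp add: fun_eq_iff)
      then show ?thesis using fun_space.span_zero by metis
    qed
    then show ?case using fun_space.span_zero by (intro conjI exI[of _ "{}"]) blast+
  next
    case (step c z y)
    obtain Yy where Yy: "finite Yy"
      "\<And>F \<sigma>. field_embedding F \<sigma> \<Longrightarrow> Yy \<subseteq> F \<Longrightarrow> \<sigma> \<circ> y \<in> fun_space.span Z" using step by blast
    obtain Yz where Yz: "finite Yz"
      "\<And>F \<sigma>. field_embedding F \<sigma> \<Longrightarrow> Yz \<subseteq> F \<Longrightarrow> range z \<subseteq> F \<Longrightarrow> \<sigma> \<circ> z \<in> fun_space.span Z"
      using stable[OF step(1)] by blast
    have fy: "finite (range y)"
      by (rule finite_range_of_support[OF fin]) (use span_support step(2) in blast)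
    have fz: "finite (range z)"
      by (rule finite_range_of_support[OF fin]) (use supp step(1) in blast)
    show ?case
    proof (intro exI conjI allI impI)
      show "(\<lambda>i. c * z i) + y \<in> fun_space.span Z"
        using step by (intro fun_space.span_add fun_space.span_scale) (auto intro: fun_space.span_base)
      show "finite ({c} \<union> range z \<union> range y \<union> Yz \<union> Yy)"
        using fy fz Yy Yz by auto
      fix F \<sigma> assume emb: "field_embedding F \<sigma>" and sub: "{c} \<union> range z \<union> range y \<union> Yz \<union> Yy \<subseteq> F"
      have mem: "c \<in> F" "\<And>i. z i \<in> F" "\<And>i. y i \<in> F" using sub by auto
      interpret field_embedding F \<sigma> by (rule emb)
      have "\<sigma> \<circ> ((\<lambda>i. c * z i) + y) = (\<lambda>i. \<sigma> c * (\<sigma> \<circ> z) i) + (\<sigma> \<circ> y)"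
        using mem by (simp add: fun_eq_iff hom_add hom_mult mult_mem)
      also have "\<dots> \<in> fun_space.span Z"
        using Yz(2)[OF emb] Yy(2)[OF emb] sub
        by (intro fun_space.span_add fun_space.span_scale) (simp_all del: comp_apply)
      finally show "\<sigma> \<circ> ((\<lambda>i. c * z i) + y) \<in> fun_space.span Z" .
    qed
  qed
  then show ?thesis ..
qed

lemma minimal_support_rational:
  assumes m: "m \<in> fun_space.span Z" "m i0 = 1"
    and min: "\<And>v. v \<in> fun_space.span Z \<Longrightarrow> {i. v i \<noteq> 0} \<subset> {i. m i \<noteq> 0} \<Longrightarrow> v = 0"
  shows "range m \<subseteq> \<rat>"
proof (rule ccontr)
  assume "\<not> range m \<subseteq> \<rat>"
  then obtain i1 where i1: "m i1 \<notin> \<rat>" by auto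
  obtain Y where Y: "finite Y"
    "\<And>F \<sigma>. field_embedding F \<sigma> \<Longrightarrow> Y \<subseteq> F \<Longrightarrow> \<sigma> \<circ> m \<in> fun_space.span Z" using span_conj[OF m(1)] by blast
  obtain F \<sigma> where F: "field_embedding F \<sigma>" "Y \<subseteq> F" "\<sigma> (m i1) \<noteq> m i1"
    using conjugation_exists[OF Y(1) i1] .
  interpret field_embedding F \<sigma> by (rule F(1))
  have "m - (\<sigma> \<circ> m) \<in> fun_space.span Z"
    using m(1) Y(2)[OF F(1,2)] by (rule fun_space.span_diff)
  moreover have "{i. (m - (\<sigma> \<circ> m)) i \<noteq> 0} \<subset> {i. m i \<noteq> 0}"
  proof
    show "{i. (m - (\<sigma> \<circ> m)) i \<noteq> 0} \<subseteq> {i. m i \<noteq> 0}" by (auto simp: hom_zero)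
    have "(m - (\<sigma> \<circ> m)) i0 = 0" "m i0 \<noteq> 0" using m(2) by (auto simp: hom_one)
    then show "{i. (m - (\<sigma> \<circ> m)) i \<noteq> 0} \<noteq> {i. m i \<noteq> 0}" by blast
  qed
  ultimately have "m - (\<sigma> \<circ> m) = 0" by (rule min)
  then have "(m - (\<sigma> \<circ> m)) i1 = 0" by simp
  then show False using F(3) by simp
qed

theorem galois_descent:
  assumes "u \<in> fun_space.span Z"
  shows "u \<in> fun_space.span {r \<in> fun_space.span Z. range r \<subseteq> \<rat>}" (is "u \<in> fun_space.span ?R")
  using assms
proof (induction "card {i. u i \<noteq> 0}" arbitrary: u rule: less_induct)
  case less
  have fs: "finite {i. v i \<noteq> 0}" if "v \<in> fun_space.span Z" for v
    using span_support[OF that] by (intro finite_subset[OF _ fin]) auto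
  show ?case
  proof (cases "u = 0")
    case True
    then show ?thesis by (simp add: fun_space.span_zero)
  next
    case False
    \<comment> \<open>Minimality is asked only among nonzero vectors supported within u; a nonzero
      vector supported strictly inside m is again one of them.\<close>
    define P where "P v \<longleftrightarrow> v \<in> fun_space.span Z \<and> v \<noteq> 0 \<and> {i. v i \<noteq> 0} \<subseteq> {i. u i \<noteq> 0}" for v
    obtain m where m: "P m" and min: "\<And>v. P v \<Longrightarrow> card {i. m i \<noteq> 0} \<le> card {i. v i \<noteq> 0}"
      using arg_min_nat_lemma[of P u "\<lambda>v. card {i. v i \<noteq> 0}"] less.prems False
      unfolding P_def by blast
    obtain i0 where i0: "m i0 \<noteq> 0" using m by (auto simp: P_def fun_eq_iff)
    define r where "r = (\<lambda>i. inverse (m i0) * m i)"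
    have r: "r \<in> fun_space.span Z" "r i0 = 1"
      unfolding r_def using m i0 fun_space.span_scale[of m Z "inverse (m i0)"] by (auto simp: P_def)
    have supp_r: "{i. r i \<noteq> 0} = {i. m i \<noteq> 0}" using i0 by (auto simp: r_def)
    have "range r \<subseteq> \<rat>"
    proof (rule minimal_support_rational[OF r])
      fix v assume v: "v \<in> fun_space.span Z" "{i. v i \<noteq> 0} \<subset> {i. r i \<noteq> 0}"
      have "card {i. v i \<noteq> 0} < card {i. m i \<noteq> 0}"
        using v m by (intro psubset_card_mono fs) (auto simp: supp_r P_def)
      then show "v = 0" using min[of v] v m unfolding P_def supp_r by force
    qed
    then have rR: "r \<in> ?R" using r by simp
    \<comment> \<open>This removes i0 from the support and adds nothing, as the support of r lies in
      that of u.\<close>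
    define v where "v = u - (\<lambda>i. u i0 * r i)"
    have v: "v \<in> fun_space.span Z"
      unfolding v_def using less.prems r by (intro fun_space.span_diff fun_space.span_scale)
    have sub: "{i. m i \<noteq> 0} \<subseteq> {i. u i \<noteq> 0}" using m by (auto simp: P_def)
    have "{i. v i \<noteq> 0} \<subset> {i. u i \<noteq> 0}"
    proof (rule psubsetI)
      show "{i. v i \<noteq> 0} \<subseteq> {i. u i \<noteq> 0}" using sub supp_r by (auto simp: v_def)
      have "v i0 = 0" "u i0 \<noteq> 0" using r i0 sub by (auto simp: v_def)
      then show "{i. v i \<noteq> 0} \<noteq> {i. u i \<noteq> 0}" by auto
    qed
    then have "card {i. v i \<noteq> 0} < card {i. u i \<noteq> 0}"
      using fs[OF less.prems] by (rule psubset_card_mono[rotated])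
    then have "v \<in> fun_space.span ?R" using less.hyps v by blast
    moreover have "(\<lambda>i. u i0 * r i) \<in> fun_space.span ?R"
      using fun_space.span_scale[OF fun_space.span_base[OF rR], of "u i0"] .
    ultimately have "v + (\<lambda>i. u i0 * r i) \<in> fun_space.span ?R"
      by (intro fun_space.span_add)
    then show ?thesis
      unfolding v_def by (simp only: diff_add_cancel)
  qed
qed

end

text \<open>Splits complex coefficients into rational ones along a basis over the rationals. The
  basis is taken from the coefficients themselves, so every field that contains them contains
  it.\<close>

lemma rational_expansion:
  assumes "finite K"
  obtains B q where "finite B" "B \<subseteq> c ` K" "rat_space.independent B"
    "\<And>k. k \<in> K \<Longrightarrow> c k = (\<Sum>b\<in>B. of_rat (q k b) * b)"
proof -
  obtain B where B: "B \<subseteq> c ` K" "rat_space.independent B" "c ` K \<subseteq> rat_space.span B"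
    using rat_space.maximal_independent_subset by blast
  have fin: "finite B" using B(1) assms finite_subset by blast
  have "\<exists>q. c k = (\<Sum>b\<in>B. of_rat (q b) * b)" if "k \<in> K" for k
  proof -
    have "c k \<in> rat_space.span B" using B(3) that by blast
    then show ?thesis unfolding rat_space.span_finite[OF fin] by blast
  qed
  then show thesis using that[OF fin B(1,2)] by metis
qed

lemma rat_independent_sum_zero:
  assumes "finite B" "rat_space.independent B" "(\<Sum>b\<in>B. of_rat (q b) * b) = 0" "b \<in> B"
  shows "q b = 0"
  using assms rat_space.independentD by blast

section \<open>Polynomial functions of matrices and rational equations\<close>

lemma mat_polys_mono: "K \<subseteq> L \<Longrightarrow> mat_polys K \<subseteq> mat_polys L"
proof
  fix p assume "K \<subseteq> L" "p \<in> mat_polys K"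
  from this(2) this(1) show "p \<in> mat_polys L" unfolding mat_polys_def
    by (induction rule: poly_funs.induct) (auto intro: poly_funs.intros)
qed

lemma mat_polys_const: "c \<in> K \<Longrightarrow> (\<lambda>_. c) \<in> mat_polys K"
  and mat_polys_entry: "(\<lambda>A. A $ i $ j) \<in> mat_polys K"
  and mat_polys_add: "p \<in> mat_polys K \<Longrightarrow> q \<in> mat_polys K \<Longrightarrow> (\<lambda>A. p A + q A) \<in> mat_polys K"
  and mat_polys_mult: "p \<in> mat_polys K \<Longrightarrow> q \<in> mat_polys K \<Longrightarrow> (\<lambda>A. p A * q A) \<in> mat_polys K"
  unfolding mat_polys_def by (rule poly_funs.intros; force)+

lemma mat_polys_sum:
  assumes "0 \<in> K" "\<And>i. i \<in> I \<Longrightarrow> p i \<in> mat_polys K"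
  shows "(\<lambda>A. \<Sum>i\<in>I. p i A) \<in> mat_polys K"
  using assms(2) by (induction I rule: infinite_finite_induct)
    (auto intro: mat_polys_add mat_polys_const assms(1))

lemma mat_polys_induct [consumes 1, case_names const entry add mult]:
  assumes "p \<in> mat_polys K" "\<And>c. c \<in> K \<Longrightarrow> P (\<lambda>_. c)" "\<And>i j. P (\<lambda>A. A $ i $ j)"
    "\<And>p q. p \<in> mat_polys K \<Longrightarrow> q \<in> mat_polys K \<Longrightarrow> P p \<Longrightarrow> P q \<Longrightarrow> P (\<lambda>A. p A + q A)"
    "\<And>p q. p \<in> mat_polys K \<Longrightarrow> q \<in> mat_polys K \<Longrightarrow> P p \<Longrightarrow> P q \<Longrightarrow> P (\<lambda>A. p A * q A)"
  shows "P p"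
  using assms(1) unfolding mat_polys_def
  by (induction rule: poly_funs.induct) (use assms(2-) in \<open>auto simp: mat_polys_def\<close>)

lemma mat_polys_complex_span: "p \<in> mat_polys UNIV \<Longrightarrow> p \<in> fun_space.span (mat_polys \<rat>)"
proof (induction rule: mat_polys_induct)
  case (const c)
  have "(\<lambda>A. c * (\<lambda>_. 1) A) \<in> fun_space.span (mat_polys \<rat>)"
    by (intro fun_space.span_scale fun_space.span_base mat_polys_const) simp
  then show ?case by simp
next
  case (entry i j)
  then show ?case by (intro fun_space.span_base mat_polys_entry)
next
  case (add p q)
  then show ?case using fun_space.span_add[of p _ q] by (simp add: plus_fun_def)
next
  case (mult p q)
  from mult(3) show ?case
  proof (induction rule: fun_space.span_induct_alt)
    case base
    then show ?case using fun_space.span_zero by (simp add: zero_fun_def)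
  next
    case (step c f g)
    from mult(4) have "(\<lambda>A. f A * q A) \<in> fun_space.span (mat_polys \<rat>)"
    proof (induction rule: fun_space.span_induct_alt)
      case base
      then show ?case using fun_space.span_zero by (simp add: zero_fun_def)
    next
      case (step c' f' g')
      have "(\<lambda>A. c' * (f A * f' A)) + (\<lambda>A. f A * g' A) \<in> fun_space.span (mat_polys \<rat>)"
        by (intro fun_space.span_add fun_space.span_scale fun_space.span_base mat_polys_mult step \<open>f \<in> mat_polys \<rat>\<close>)
      then show ?case by (simp add: plus_fun_def algebra_simps)
    qed
    then have "(\<lambda>A. c * (f A * q A)) + (\<lambda>A. g A * q A) \<in> fun_space.span (mat_polys \<rat>)"
      by (intro fun_space.span_add fun_space.span_scale step)
    then show ?case by (simp add: plus_fun_def algebra_simps)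
  qed
qed

lemma (in field_embedding) mat_polys_conj:
  assumes "p \<in> mat_polys \<rat>" "\<And>i j. A $ i $ j \<in> F"
  shows "p A \<in> F \<and> p (map_matrix \<sigma> A) = \<sigma> (p A)"
  using assms(1)
proof (induction rule: mat_polys_induct)
  case (const c)
  then show ?case using Rats_mem hom_Rats by simp
qed (auto simp: assms(2) add_mem mult_mem hom_add hom_mult)

lemma map_matrix_nth [simp]: "map_matrix f A $ i $ j = f (A $ i $ j)"
  by (simp add: map_matrix_def)

lemma (in field_embedding) map_matrix_mult:
  assumes "\<And>i j. A $ i $ j \<in> F" "\<And>i j. B $ i $ j \<in> F"
  shows "map_matrix \<sigma> (A ** B) = map_matrix \<sigma> A ** map_matrix \<sigma> B"
  using assms by (simp add: vec_eq_iff matrix_matrix_mult_def hom_sum hom_mult mult_mem)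

lemma (in field_embedding) map_matrix_mat_1: "map_matrix \<sigma> (mat 1) = mat 1"
  by (simp add: vec_eq_iff mat_def hom_one hom_zero)

lemma rat_algebraic_group_conj:
  assumes alg: "rat_algebraic_group H" and A: "A \<in> H"
  obtains Y where "finite Y" "\<And>i j. A $ i $ j \<in> Y"
    "\<And>F \<sigma>. field_embedding F \<sigma> \<Longrightarrow> Y \<subseteq> F \<Longrightarrow> map_matrix \<sigma> A \<in> H"
proof -
  obtain S where S: "S \<subseteq> mat_polys \<rat>" "H = {A. invertible A \<and> (\<forall>p\<in>S. p A = 0)}"
    using alg unfolding rat_algebraic_group_def by auto
  obtain B where B: "A ** B = mat 1" "B ** A = mat 1" using A S by (auto simp: invertible_def)
  \<comment> \<open>The entries of an inverse are included, so that the conjugate of B inverts the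
    conjugate of A.\<close>
  define Y where "Y = (\<lambda>(i, j). A $ i $ j) ` UNIV \<union> (\<lambda>(i, j). B $ i $ j) ` UNIV"
  show thesis
  proof (rule that[of Y])
    show "finite Y" "\<And>i j. A $ i $ j \<in> Y" by (auto simp: Y_def)
    fix F \<sigma> assume "field_embedding F \<sigma>" "Y \<subseteq> F"
    then interpret field_embedding F \<sigma> by simp
    have mem: "\<And>i j. A $ i $ j \<in> F" "\<And>i j. B $ i $ j \<in> F" using \<open>Y \<subseteq> F\<close> by (auto simp: Y_def)
    have "invertible (map_matrix \<sigma> A)"
      unfolding invertible_def using map_matrix_mult mem B map_matrix_mat_1 by metis
    moreover have "p (map_matrix \<sigma> A) = 0" if "p \<in> S" for p
      using mat_polys_conj[of p A, OF _ mem(1)] subsetD[OF S(1) that] A S(2) that hom_zero by auto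
    ultimately show "map_matrix \<sigma> A \<in> H" using S by simp
  qed
qed

text \<open>The vectors of values (h b A), for A in H, span a space stable under conjugation,
  because conjugates of A stay in H. By descent it is spanned by rational vectors. On a rational
  vector the relation is a rational one between the independent b, so that vector is zero.\<close>

lemma rat_independent_vanish:
  assumes alg: "rat_algebraic_group H" and B: "finite B" "rat_space.independent B"
    and h: "\<And>b. b \<in> B \<Longrightarrow> h b \<in> mat_polys \<rat>"
    and van: "\<And>A. A \<in> H \<Longrightarrow> (\<Sum>b\<in>B. b * h b A) = 0"
    and "b \<in> B" "A \<in> H"
  shows "h b A = 0"
proof -
  \<comment> \<open>Extension by zero outside B provides the finite support that descent asks
    for.\<close>
  define z where "z A = (\<lambda>b. if b \<in> B then h b A else 0)" for A
  have stable: "\<exists>Y. finite Y \<and> (\<forall>F \<sigma>. field_embedding F \<sigma> \<longrightarrow> Y \<subseteq> F \<longrightarrow> range x \<subseteq> F \<longrightarrow>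
      \<sigma> \<circ> x \<in> fun_space.span (z ` H))" if x: "x \<in> z ` H" for x
  proof -
    obtain A where A: "A \<in> H" "x = z A" using x by auto
    obtain Y where Y: "finite Y" "\<And>i j. A $ i $ j \<in> Y"
      "\<And>F \<sigma>. field_embedding F \<sigma> \<Longrightarrow> Y \<subseteq> F \<Longrightarrow> map_matrix \<sigma> A \<in> H"
      using rat_algebraic_group_conj[OF alg A(1)] by blast
    have "\<sigma> \<circ> x \<in> fun_space.span (z ` H)" if F: "field_embedding F \<sigma>" "Y \<subseteq> F" for F \<sigma>
    proof -
      interpret field_embedding F \<sigma> by (rule F(1))
      have "\<sigma> \<circ> x = z (map_matrix \<sigma> A)"
        using mat_polys_conj[OF h, of _ A] Y(2) F(2) subsetD
        by (fastforce simp: A z_def fun_eq_iff hom_zero)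
      then show ?thesis using Y(3)[OF F] by (simp add: fun_space.span_base)
    qed
    then show ?thesis using Y(1) by blast
  qed
  have zero: "r = 0" if r: "r \<in> fun_space.span (z ` H)" "range r \<subseteq> \<rat>" for r
  proof
    fix b
    have "\<forall>b. \<exists>a. r b = of_rat a"
      using r(2) unfolding Rats_def by blast
    from choice[OF this] obtain q where q: "\<And>b. r b = of_rat (q b)" by blast
    have "(\<Sum>b\<in>B. b * r b) = 0"
      using r(1)
    proof (induction rule: fun_space.span_induct_alt)
      case (step c x y)
      then obtain A where A: "A \<in> H" "x = z A" by auto
      have "(\<Sum>b\<in>B. b * x b) = (\<Sum>b\<in>B. b * h b A)" by (intro sum.cong) (auto simp: A z_def)
      then have "(\<Sum>b\<in>B. b * x b) = 0" using van A by simp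
      moreover have "(\<Sum>b\<in>B. b * ((\<lambda>i. c * x i) + y) b) = c * (\<Sum>b\<in>B. b * x b) + (\<Sum>b\<in>B. b * y b)"
        by (simp add: sum.distrib sum_distrib_left algebra_simps)
      ultimately show ?case using step by simp
    qed simp
    then have "(\<Sum>b\<in>B. of_rat (q b) * b) = 0" by (simp add: q mult.commute)
    then have "r b = 0" if "b \<in> B" using rat_independent_sum_zero[OF B] q that by auto
    moreover have "r b = 0" if "b \<notin> B" using r(1) by (rule span_vanish) (auto simp: z_def that)
    ultimately show "r b = 0 b" by auto
  qed
  have "z A \<in> fun_space.span {r \<in> fun_space.span (z ` H). range r \<subseteq> \<rat>}"
    using B(1) _ stable fun_space.span_base[OF imageI[OF \<open>A \<in> H\<close>]]
    by (rule galois_descent) (auto simp: z_def)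
  also have "\<dots> \<subseteq> fun_space.span {0}" using zero by (intro fun_space.span_mono) auto
  finally have "z A = 0" by (simp add: fun_space.span_insert_0)
  then show ?thesis using \<open>b \<in> B\<close> by (auto simp: z_def fun_eq_iff split: if_splits)
qed

text \<open>Expanding the c k along a rationally independent B splits the equation into rational
  equations \<open>h b\<close> that vanish on H separately, so each b may be replaced by \<sigma> b.
  Only the coefficients are conjugated; A stays as it is, and its entries may lie outside F.\<close>

lemma vanishing_conj:
  assumes alg: "rat_algebraic_group H" and K: "finite K"
    and g: "\<And>k. k \<in> K \<Longrightarrow> g k \<in> mat_polys \<rat>"
    and van: "\<And>A. A \<in> H \<Longrightarrow> (\<Sum>k\<in>K. c k * g k A) = 0"
    and F: "field_embedding F \<sigma>" "c ` K \<subseteq> F" and A: "A \<in> H"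
  shows "(\<Sum>k\<in>K. \<sigma> (c k) * g k A) = 0"
proof -
  interpret field_embedding F \<sigma> by (rule F(1))
  obtain B q where B: "finite B" "B \<subseteq> c ` K" "rat_space.independent B"
    and q: "\<And>k. k \<in> K \<Longrightarrow> c k = (\<Sum>b\<in>B. of_rat (q k b) * b)"
    using rational_expansion[OF K, of c] by blast
  define h where "h b A = (\<Sum>k\<in>K. of_rat (q k b) * g k A)" for b A
  have h: "h b \<in> mat_polys \<rat>" for b
    unfolding h_def by (intro mat_polys_sum mat_polys_mult mat_polys_const g) auto
  have expand: "(\<Sum>k\<in>K. (\<Sum>b\<in>B. of_rat (q k b) * f b) * g k A) = (\<Sum>b\<in>B. f b * h b A)" for f A
  proof -
    have "(\<Sum>k\<in>K. (\<Sum>b\<in>B. of_rat (q k b) * f b) * g k A) =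
        (\<Sum>k\<in>K. \<Sum>b\<in>B. f b * (of_rat (q k b) * g k A))"
      by (simp add: sum_distrib_right) (simp add: mult_ac)
    also have "\<dots> = (\<Sum>b\<in>B. f b * h b A)"
      by (subst sum.swap) (simp add: h_def sum_distrib_left)
    finally show ?thesis .
  qed
  have "(\<Sum>b\<in>B. b * h b A) = 0" if "A \<in> H" for A
    using van[OF that] q expand[of "\<lambda>b. b" A] by simp
  from rat_independent_vanish[OF alg B(1,3) h this _ A] have "h b A = 0" if "b \<in> B" for b
    using that by blast
  moreover have "\<sigma> (c k) = (\<Sum>b\<in>B. of_rat (q k b) * \<sigma> b)" if "k \<in> K" for k
  proof -
    have "b \<in> F" if "b \<in> B" for b using that B(2) F(2) by blast
    moreover have "of_rat (q k b) \<in> F" for b by (simp add: Rats_mem)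
    ultimately show ?thesis
      unfolding q[OF that] by (subst hom_sum) (simp_all add: mult_mem hom_mult hom_Rats)
  qed
  ultimately show ?thesis using expand[of \<sigma> A] by simp
qed

text \<open>Translating a rational equation by a complex element of H gives a complex equation. This
  brings it back to rational ones, which are the only ones that the Lie algebra is defined
  by.\<close>

lemma complex_vanishing_span:
  assumes alg: "rat_algebraic_group H" and p: "p \<in> mat_polys UNIV"
    and van: "\<And>A. A \<in> H \<Longrightarrow> p A = 0"
  shows "p \<in> fun_space.span {h \<in> mat_polys \<rat>. \<forall>A\<in>H. h A = 0}"
proof -
  obtain K c where K: "finite K" "K \<subseteq> mat_polys \<rat>" "p = (\<Sum>g\<in>K. (\<lambda>A. c g * g A))"
    using mat_polys_complex_span[OF p] by (auto simp: fun_space.span_explicit)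
  obtain B q where B: "finite B" "B \<subseteq> c ` K" "rat_space.independent B"
    and q: "\<And>k. k \<in> K \<Longrightarrow> c k = (\<Sum>b\<in>B. of_rat (q k b) * b)"
    using rational_expansion[OF K(1), of c] by blast
  define h where "h b A = (\<Sum>g\<in>K. of_rat (q g b) * g A)" for b A
  have h: "h b \<in> mat_polys \<rat>" for b
    unfolding h_def using K(2) by (intro mat_polys_sum mat_polys_mult mat_polys_const) auto
  have expand: "p A = (\<Sum>b\<in>B. b * h b A)" for A
  proof -
    have "p A = (\<Sum>g\<in>K. (\<Sum>b\<in>B. of_rat (q g b) * b) * g A)"
      using q by (simp add: K(3) sum_fun_apply)
    also have "\<dots> = (\<Sum>b\<in>B. b * h b A)"
    proof -
      have "(\<Sum>g\<in>K. (\<Sum>b\<in>B. of_rat (q g b) * b) * g A) =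
          (\<Sum>g\<in>K. \<Sum>b\<in>B. b * (of_rat (q g b) * g A))"
        by (simp add: sum_distrib_right) (simp add: mult_ac)
      also have "\<dots> = (\<Sum>b\<in>B. b * h b A)"
        by (subst sum.swap) (simp add: h_def sum_distrib_left)
      finally show ?thesis .
    qed
    finally show ?thesis .
  qed
  have "h b A = 0" if "b \<in> B" "A \<in> H" for b A
    by (rule rat_independent_vanish[OF alg B(1,3), of h]) (use h van that in \<open>simp_all flip: expand\<close>)
  then have "(\<Sum>b\<in>B. (\<lambda>A. b * h b A)) \<in> fun_space.span {h \<in> mat_polys \<rat>. \<forall>A\<in>H. h A = 0}"
    using h by (intro fun_space.span_sum fun_space.span_scale fun_space.span_base) auto
  moreover have "p = (\<Sum>b\<in>B. (\<lambda>A. b * h b A))"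
    by (rule ext) (simp add: expand sum_fun_apply)
  ultimately show ?thesis by simp
qed


section \<open>The Lie algebra of a rational group\<close>

text \<open>The derivation of the coordinate ring given by the left-invariant vector field of X.\<close>

definition der :: "complex^'n^'n \<Rightarrow> (complex^'n^'n \<Rightarrow> complex) \<Rightarrow> complex^'n^'n \<Rightarrow> complex" where
  "der X p A = deriv (\<lambda>t. p (A ** (mat 1 + cscale t X))) 0"

lemma cscale_nth [simp]: "cscale c A $ i $ j = c * A $ i $ j"
  by (simp add: cscale_def)

lemma matrix_mult_nth: "(A ** B) $ i $ j = (\<Sum>k\<in>UNIV. A $ i $ k * B $ k $ j)"
  by (simp add: matrix_matrix_mult_def)

lemma cscale_0 [simp]: "cscale 0 A = 0"
  by (simp add: vec_eq_iff)

lemma matrix_mult_cscale_right: "A ** cscale c B = cscale c (A ** B)"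
  by (simp add: vec_eq_iff matrix_mult_nth sum_distrib_left mult_ac)

lemma matrix_mult_cscale_left: "cscale c A ** B = cscale c (A ** B)"
  by (simp add: vec_eq_iff matrix_mult_nth sum_distrib_left mult_ac)

lemma matrix_add_rdistrib: "(A + B) ** C = A ** C + B ** C" for A B C :: "complex^'n^'n"
  by (simp add: vec_eq_iff matrix_mult_nth distrib_right sum.distrib)

lemma matrix_diff_ldistrib: "A ** (B - C) = A ** B - A ** C" for A B C :: "complex^'n^'n"
  by (simp add: vec_eq_iff matrix_mult_nth right_diff_distrib sum_subtractf)

lemma matrix_inv_eqI:
  fixes A A' :: "complex^'n^'n"
  assumes "A ** A' = mat 1" "A' ** A = mat 1"
  shows "matrix_inv A = A'"
proof -
  have "A ** matrix_inv A = mat 1 \<and> matrix_inv A ** A = mat 1"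
    unfolding matrix_inv_def by (rule someI_ex) (use assms in blast)
  then show ?thesis using assms by (metis matrix_mul_assoc matrix_mul_lid matrix_mul_rid)
qed

lemma one_parameter_entry:
  fixes A X :: "complex^'n^'n"
  shows "(A ** (mat 1 + cscale t X)) $ i $ j = A $ i $ j + t * (A ** X) $ i $ j"
  by (simp add: matrix_add_ldistrib matrix_mult_cscale_right)

lemma has_der:
  assumes "p \<in> mat_polys K"
  shows "((\<lambda>t. p (A ** (mat 1 + cscale t X))) has_field_derivative der X p A) (at 0)"
proof -
  have "(\<lambda>t. p (A ** (mat 1 + cscale t X))) field_differentiable at 0"
    using assms
    by (induction rule: mat_polys_induct)
      (auto simp: one_parameter_entry intro!: derivative_intros)
  then show ?thesis
    unfolding der_def by (simp add: field_differentiable_derivI)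
qed

lemma der_unique:
  assumes "((\<lambda>t. p (A ** (mat 1 + cscale t X))) has_field_derivative D) (at 0)"
  shows "der X p A = D"
  unfolding der_def using assms by (rule DERIV_imp_deriv)

lemma der_const: "der X (\<lambda>_. c) = (\<lambda>_. 0)"
  by (rule ext, rule der_unique) (auto intro!: derivative_eq_intros)

lemma der_entry: "der X (\<lambda>A. A $ i $ j) = (\<lambda>A. (A ** X) $ i $ j)"
  by (rule ext, rule der_unique) (auto simp: one_parameter_entry intro!: derivative_eq_intros)

lemma der_add:
  assumes "p \<in> mat_polys K" "q \<in> mat_polys K"
  shows "der X (\<lambda>A. p A + q A) = (\<lambda>A. der X p A + der X q A)"
  by (rule ext, rule der_unique) (intro DERIV_add has_der[OF assms(1)] has_der[OF assms(2)])

lemma der_mult: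
  assumes "p \<in> mat_polys K" "q \<in> mat_polys K"
  shows "der X (\<lambda>A. p A * q A) = (\<lambda>A. der X p A * q A + p A * der X q A)"
proof (rule ext, rule der_unique)
  fix A
  have "((\<lambda>t. p (A ** (mat 1 + cscale t X)) * q (A ** (mat 1 + cscale t X))) has_field_derivative
      der X p A * q (A ** (mat 1 + cscale 0 X)) + der X q A * p (A ** (mat 1 + cscale 0 X))) (at 0)"
    by (intro DERIV_mult has_der[OF assms(1)] has_der[OF assms(2)])
  then show "((\<lambda>t. p (A ** (mat 1 + cscale t X)) * q (A ** (mat 1 + cscale t X))) has_field_derivative
      der X p A * q A + p A * der X q A) (at 0)"
    by (simp add: mult.commute)
qed

lemma der_sum:
  assumes "\<And>k. k \<in> I \<Longrightarrow> p k \<in> mat_polys UNIV"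
  shows "der X (\<lambda>A. \<Sum>k\<in>I. p k A) = (\<lambda>A. \<Sum>k\<in>I. der X (p k) A)"
  using assms
proof (induction I rule: infinite_finite_induct)
  case (insert k I)
  have "der X (\<lambda>A. p k A + (\<Sum>k\<in>I. p k A)) = (\<lambda>A. der X (p k) A + der X (\<lambda>A. \<Sum>k\<in>I. p k A) A)"
    using insert.prems by (intro der_add mat_polys_sum) auto
  then show ?case using insert by simp
qed (simp_all add: der_const)

lemma der_mem:
  assumes "p \<in> mat_polys K" "0 \<in> K" "\<And>i j. X $ i $ j \<in> K"
  shows "der X p \<in> mat_polys K"
  using assms(1)
proof (induction rule: mat_polys_induct)
  case (const c)
  then show ?case by (simp add: der_const mat_polys_const assms)
next
  case (entry i j)
  then show ?case unfolding der_entry matrix_mult_nth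
    by (intro mat_polys_sum mat_polys_mult mat_polys_entry mat_polys_const assms)
next
  case (add p q)
  then show ?case by (simp add: der_add[of _ K] mat_polys_add)
next
  case (mult p q)
  then show ?case by (simp add: der_mult[of _ K] mat_polys_add mat_polys_mult)
qed

lemma der_linear:
  assumes "p \<in> mat_polys K"
  shows "der (cscale c X + Y) p A = c * der X p A + der Y p A"
  using assms
  by (induction rule: mat_polys_induct)
    (simp_all add: der_const der_entry der_add[of _ K] der_mult[of _ K]
       matrix_add_ldistrib matrix_mult_cscale_right algebra_simps)

lemma der_cscale: "p \<in> mat_polys K \<Longrightarrow> der (cscale c X) p A = c * der X p A"
  by (induction rule: mat_polys_induct)
    (simp_all add: der_const der_entry der_add[of _ K] der_mult[of _ K]
       matrix_mult_cscale_right algebra_simps)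

text \<open>Left-invariant vector fields are closed under commutators; by the Leibniz rule the
  matrix entries decide. On these, \<open>der X\<close> followed by \<open>der Y\<close> gives A Y
  X, which explains the order of the products on the right.\<close>

lemma der_bracket:
  assumes "p \<in> mat_polys UNIV"
  shows "der Y (der X p) A - der X (der Y p) A = der (Y ** X - X ** Y) p A"
  using assms
proof (induction arbitrary: A rule: mat_polys_induct)
  case (const c)
  then show ?case by (simp add: der_const)
next
  case (entry i j)
  have "der Y (\<lambda>A. (A ** X) $ i $ j) A = (A ** Y ** X) $ i $ j" for X Y A
  proof -
    have "der Y (\<lambda>A. A $ i $ k * X $ k $ j) A = (A ** Y) $ i $ k * X $ k $ j" for k
      by (subst der_mult[of _ UNIV]) (auto simp: der_entry der_const intro: mat_polys_entry mat_polys_const)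
    then show ?thesis
      unfolding matrix_mult_nth[of _ X]
      by (subst der_sum) (auto intro!: mat_polys_mult mat_polys_entry mat_polys_const)
  qed
  then show ?case
    by (simp add: der_entry matrix_mul_assoc matrix_diff_ldistrib)
next
  case (add p q)
  then show ?case
    by (simp add: der_add[of _ UNIV] der_mem algebra_simps add.IH[symmetric] del: add.IH)
next
  case (mult p q)
  have d: "der X p \<in> mat_polys UNIV" if "p \<in> mat_polys UNIV" for X p using that by (simp add: der_mem)
  have "der Y (der X (\<lambda>A. p A * q A)) A = der Y (der X p) A * q A + der X p A * der Y q A
      + (der Y p A * der X q A + p A * der Y (der X q) A)" for X Y A
    using mult by (simp add: der_mult[of _ UNIV] der_add[of _ UNIV] mat_polys_mult d)
  then show ?case using mult(3)[of A] mult(4)[of A]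
    by (simp add: der_mult[OF mult(1,2)] algebra_simps flip: mult(3,4))
qed

lemma mat_polys_Rats_eval:
  assumes "p \<in> mat_polys \<rat>" "\<And>i j. A $ i $ j \<in> \<rat>"
  shows "p A \<in> \<rat>"
  using assms(1) by (induction rule: mat_polys_induct) (auto simp: assms(2))

lemma mat_polys_compose:
  assumes "p \<in> mat_polys UNIV" "\<And>i j. (\<lambda>B. f B $ i $ j) \<in> mat_polys UNIV"
  shows "(\<lambda>B. p (f B)) \<in> mat_polys UNIV"
  using assms(1)
  by (induction rule: mat_polys_induct) (auto intro: assms(2) mat_polys_const mat_polys_add mat_polys_mult)

text \<open>The complex solutions of the equations behind \<open>rat_lie_algebra\<close>; root
  vectors, which need not be rational, live here.\<close>

definition tangent :: "(complex^'n^'n) set \<Rightarrow> (complex^'n^'n) set" where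
  "tangent H = {X. \<forall>p \<in> mat_polys \<rat>. (\<forall>A\<in>H. p A = 0) \<longrightarrow> der X p (mat 1) = 0}"

lemma rat_lie_algebra_iff: "X \<in> rat_lie_algebra H \<longleftrightarrow> map_matrix of_rat X \<in> tangent H"
proof -
  have "((\<lambda>t. p (mat 1 + cscale t (map_matrix of_rat X))) has_field_derivative 0) (at 0) \<longleftrightarrow>
      der (map_matrix of_rat X) p (mat 1) = 0" if "p \<in> mat_polys \<rat>" for p
    using has_der[OF that, of "mat 1" "map_matrix of_rat X"] DERIV_unique by fastforce
  then show ?thesis by (simp add: rat_lie_algebra_def tangent_def)
qed

lemma subspace_tangent:
  fixes H :: "(complex^'n^'n) set"
  shows "cmat.subspace (tangent H)"
proof (rule cmat.subspaceI)
  have "der 0 p A = 0" if "p \<in> mat_polys \<rat>" for p :: "complex^'n^'n \<Rightarrow> complex" and A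
    using der_cscale[OF that, of 0 0 A] by simp
  then show "0 \<in> tangent H" by (simp add: tangent_def)
next
  fix X Y assume "X \<in> tangent H" "Y \<in> tangent H"
  then show "X + Y \<in> tangent H"
    using der_linear[of _ \<rat> 1 X Y "mat 1"] by (simp add: tangent_def)
next
  fix c X assume "X \<in> tangent H"
  then show "cscale c X \<in> tangent H" by (simp add: tangent_def der_cscale[of _ \<rat>])
qed

lemma der_matrix_sum:
  assumes "p \<in> mat_polys K" "finite B"
  shows "der (\<Sum>b\<in>B. cscale (c b) (X b)) p A = (\<Sum>b\<in>B. c b * der (X b) p A)"
  using assms(2)
proof induction
  case empty
  then show ?case using der_cscale[OF assms(1), of 0 0 A] by simp
next
  case (insert b B)
  then show ?case by (simp add: der_linear[OF assms(1)])
qed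

text \<open>The tangent space is the solution space of a linear system with rational coefficients.\<close>

lemma lie_complexification_eq_tangent: "lie_complexification (rat_lie_algebra H) = tangent H"
proof (rule antisym)
  show "lie_complexification (rat_lie_algebra H) \<subseteq> tangent H"
    unfolding lie_complexification_def
    by (intro cmat.span_minimal subspace_tangent) (auto simp: rat_lie_algebra_iff)
  show "tangent H \<subseteq> lie_complexification (rat_lie_algebra H)"
  proof
    fix X assume X: "X \<in> tangent H"
    define f where "f = (\<lambda>(i, j). X $ i $ j)"
    obtain B q where B: "finite B" "rat_space.independent B"
      and q: "\<And>k. k \<in> UNIV \<Longrightarrow> f k = (\<Sum>b\<in>B. of_rat (q k b) * b)"
      by (rule rational_expansion[of UNIV f, OF finite]) (rule that)
    define R where "R b = (\<chi> i j. q (i, j) b)" for b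
    \<comment> \<open>Each component R b is rational. A rational linear equation for X is a rational
      relation between the independent b, so every component satisfies it.\<close>
    have Xeq: "X = (\<Sum>b\<in>B. cscale b (map_matrix of_rat (R b)))"
    proof -
      have "X $ i $ j = (\<Sum>b\<in>B. of_rat (q (i, j) b) * b)" for i j
        using q[of "(i, j)"] by (simp add: f_def)
      then show ?thesis by (simp add: vec_eq_iff R_def sum_component mult.commute)
    qed
    have "R b \<in> rat_lie_algebra H" if b: "b \<in> B" for b
      unfolding rat_lie_algebra_iff tangent_def
    proof (intro CollectI ballI impI)
      fix p assume p: "p \<in> mat_polys \<rat>" "\<forall>A\<in>H. p A = 0"
      have "der (map_matrix of_rat (R b)) p (mat 1) \<in> \<rat>" for b
        by (rule mat_polys_Rats_eval[OF der_mem[OF p(1)]]) (auto simp: mat_def)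
      then have "\<forall>b. \<exists>a. der (map_matrix of_rat (R b)) p (mat 1) = of_rat a"
        unfolding Rats_def by blast
      from choice[OF this] obtain a where a: "\<And>b. der (map_matrix of_rat (R b)) p (mat 1) = of_rat (a b)"
        by blast
      have "(\<Sum>b\<in>B. of_rat (a b) * b) = der X p (mat 1)"
        unfolding Xeq der_matrix_sum[OF p(1) B(1)] by (simp add: a mult.commute)
      also have "\<dots> = 0" using X p by (simp add: tangent_def)
      finally show "der (map_matrix of_rat (R b)) p (mat 1) = 0"
        using rat_independent_sum_zero[OF B] b a by simp
    qed
    then show "X \<in> lie_complexification (rat_lie_algebra H)"
      unfolding lie_complexification_def Xeq
      by (intro cmat.span_sum cmat.span_scale cmat.span_base imageI)
  qed
qed

section \<open>Equations, bracket and adjoint action on the tangent space of a rational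
  group\<close>

context
  fixes H :: "(complex^'n^'n) set"
  assumes alg: "rat_algebraic_group H"
begin

lemma tangent_complex_equation:
  assumes X: "X \<in> tangent H" and p: "p \<in> mat_polys UNIV" "\<And>A. A \<in> H \<Longrightarrow> p A = 0"
  shows "der X p (mat 1) = 0"
proof -
  have "p \<in> fun_space.span {h \<in> mat_polys \<rat>. \<forall>A\<in>H. h A = 0}"
    by (rule complex_vanishing_span[OF alg p])
  then have "p \<in> mat_polys UNIV \<and> der X p (mat 1) = 0"
  proof (induction rule: fun_space.span_induct_alt)
    case base
    then show ?case by (simp add: zero_fun_def der_const mat_polys_const)
  next
    case (step c g f)
    then have g: "g \<in> mat_polys UNIV" "der X g (mat 1) = 0"
      using mat_polys_mono[of \<rat> UNIV] X by (auto simp: tangent_def)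
    have cg: "(\<lambda>A. c * g A) \<in> mat_polys UNIV"
      using g by (intro mat_polys_mult mat_polys_const) auto
    have "der X (\<lambda>A. c * g A) (mat 1) = 0"
      using g der_mult[OF mat_polys_const[OF UNIV_I] g(1)] by (simp add: der_const)
    then show ?case
      using step cg by (simp add: plus_fun_def der_add[of _ UNIV] mat_polys_add)
  qed
  then show ?thesis ..
qed

lemma der_vanishes:
  assumes X: "X \<in> tangent H" and p: "p \<in> mat_polys UNIV" "\<And>A. A \<in> H \<Longrightarrow> p A = 0" and A: "A \<in> H"
  shows "der X p A = 0"
proof -
  have "(\<lambda>B. p (A ** B)) \<in> mat_polys UNIV"
    unfolding matrix_matrix_mult_def
    by (rule mat_polys_compose[OF p(1)])
      (auto intro!: mat_polys_sum mat_polys_mult mat_polys_entry mat_polys_const)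
  then have "der X (\<lambda>B. p (A ** B)) (mat 1) = 0"
    using p A alg by (intro tangent_complex_equation[OF X]) (auto simp: rat_algebraic_group_def)
  then show ?thesis by (simp add: der_def)
qed

text \<open>\<open>der X p\<close> vanishes on all of H and not only at the identity, so it is
  itself an equation that Y annihilates.\<close>

lemma tangent_bracket:
  assumes "X \<in> tangent H" "Y \<in> tangent H"
  shows "Y ** X - X ** Y \<in> tangent H"
proof -
  have one: "mat 1 \<in> H" using alg by (simp add: rat_algebraic_group_def)
  show ?thesis
    unfolding tangent_def
  proof (intro CollectI ballI impI)
    fix p :: "complex^'n^'n \<Rightarrow> complex" assume "p \<in> mat_polys \<rat>" and van: "\<forall>A\<in>H. p A = 0"
    then have p: "p \<in> mat_polys UNIV" using mat_polys_mono by blast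
    have "der Y (der X p) (mat 1) = 0" "der X (der Y p) (mat 1) = 0"
      using assms p van one by (auto intro!: der_vanishes der_mem)
    then show "der (Y ** X - X ** Y) p (mat 1) = 0"
      using der_bracket[OF p, of Y X "mat 1"] by simp
  qed
qed

text \<open>Conjugation by A preserves H, and its differential at the identity is the adjoint
  action.\<close>

lemma tangent_Ad:
  assumes X: "X \<in> tangent H" and A: "A \<in> H" "A ** A' = mat 1" "A' ** A = mat 1"
  shows "A ** X ** A' \<in> tangent H"
  unfolding tangent_def
proof (intro CollectI ballI impI)
  fix p :: "complex^'n^'n \<Rightarrow> complex" assume "p \<in> mat_polys \<rat>" and van: "\<forall>A\<in>H. p A = 0"
  then have p: "p \<in> mat_polys UNIV" using mat_polys_mono by blast
  have "A' = matrix_inv A"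
    using A by (metis matrix_inv_eqI)
  then have A': "A' \<in> H" using A alg by (simp add: rat_algebraic_group_def)
  have q: "(\<lambda>B. p (A ** B ** A')) \<in> mat_polys UNIV"
    unfolding matrix_matrix_mult_def
    by (rule mat_polys_compose[OF p(1)])
      (auto intro!: mat_polys_sum mat_polys_mult mat_polys_entry mat_polys_const)
  have "der X (\<lambda>B. p (A ** B ** A')) (mat 1) = 0"
    using van A(1) A' alg
    by (intro tangent_complex_equation[OF X q]) (auto simp: rat_algebraic_group_def)
  moreover have "A ** (mat 1 + cscale t X) ** A' = mat 1 + cscale t (A ** X ** A')" for t
    using A by (simp add: matrix_add_ldistrib matrix_add_rdistrib matrix_mult_cscale_left matrix_mult_cscale_right)
  ultimately show "der (A ** X ** A') p (mat 1) = 0"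
    by (simp add: der_def)
qed

lemma tangent_skew:
  assumes form: "\<And>A. A \<in> H \<Longrightarrow> transpose A ** G ** A = G" and X: "X \<in> tangent H"
  shows "transpose X ** G + G ** X = 0"
proof -
  have "(transpose X ** G + G ** X) $ i $ j = 0" for i j
  proof -
    define p where "p A = (\<Sum>k\<in>UNIV. \<Sum>m\<in>UNIV. A $ m $ i * (G $ m $ k * A $ k $ j)) + (- G $ i $ j)"
      for A :: "complex^'n^'n"
    have mem: "(\<lambda>A. A $ m $ i * (G $ m $ k * A $ k $ j)) \<in> mat_polys UNIV" for m k
      by (intro mat_polys_mult mat_polys_entry mat_polys_const) auto
    have p: "p \<in> mat_polys UNIV"
      unfolding p_def by (intro mat_polys_add mat_polys_sum mem mat_polys_const) auto
    have "p A = (transpose A ** G ** A) $ i $ j - G $ i $ j" for A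
      by (simp add: p_def matrix_mult_nth transpose_def sum_distrib_right mult.assoc)
    then have "der X p (mat 1) = 0"
      using form by (intro tangent_complex_equation[OF X p]) simp
    moreover have "der X (\<lambda>A. A $ m $ i * (G $ m $ k * A $ k $ j)) (mat 1) =
        (if k = j then X $ m $ i * G $ m $ j else 0) + (if m = i then G $ i $ k * X $ k $ j else 0)" for m k
    proof -
      have "(\<lambda>A :: complex^'n^'n. G $ m $ k * A $ k $ j) \<in> mat_polys UNIV"
        by (intro mat_polys_mult mat_polys_entry mat_polys_const UNIV_I)+
      then have "der X (\<lambda>A. A $ m $ i * (G $ m $ k * A $ k $ j)) =
          (\<lambda>A. (A ** X) $ m $ i * (G $ m $ k * A $ k $ j) + A $ m $ i * (G $ m $ k * (A ** X) $ k $ j))"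
        using der_mult[OF mat_polys_const[OF UNIV_I, of "G $ m $ k"] mat_polys_entry[of k j UNIV], of X]
          der_mult[of "\<lambda>A. A $ m $ i" UNIV "\<lambda>A. G $ m $ k * A $ k $ j" X]
        by (simp add: mat_polys_entry der_entry der_const)
      then show ?thesis
        by simp (simp add: mat_def)
    qed
    moreover have "der X p = (\<lambda>A. \<Sum>k\<in>UNIV. \<Sum>m\<in>UNIV. der X (\<lambda>A. A $ m $ i * (G $ m $ k * A $ k $ j)) A)"
      unfolding p_def
      by (subst der_add[of _ UNIV]) (auto intro!: mat_polys_sum mem mat_polys_const simp: der_sum mat_polys_sum mem der_const)
    moreover have "(\<Sum>m\<in>UNIV. if k = j then f m else 0) = (if k = j then \<Sum>m\<in>UNIV. f m else 0)"
      for k and f :: "'n \<Rightarrow> complex" by simp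
    ultimately have "der X p (mat 1) = (transpose X ** G + G ** X) $ i $ j" "der X p (mat 1) = 0"
      by (simp_all add: sum.distrib matrix_mult_nth transpose_def)
    then show ?thesis by simp
  qed
  then show ?thesis by (simp add: vec_eq_iff)
qed

end


section \<open>The dimension of a diagonalizable group\<close>

text \<open>Phrased for a family because its members may coincide; a repetition is then a relation
  by itself.\<close>

lemma indexed_dependence:
  fixes g :: "nat \<Rightarrow> 'i \<Rightarrow> complex"
  assumes "finite X" "card X < n" "\<And>s. s < n \<Longrightarrow> g s \<in> fun_space.span X"
  obtains \<beta> s where "s < n" "\<beta> s \<noteq> 0" "\<And>x. (\<Sum>s<n. \<beta> s * g s x) = 0"
proof (cases "inj_on g {..<n}")
  case False
  then obtain s s' where s: "s < n" "s' < n" "s \<noteq> s'" "g s = g s'" by (auto simp: inj_on_def)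
  define \<beta> :: "nat \<Rightarrow> complex" where "\<beta> r = (if r = s then 1 else if r = s' then - 1 else 0)" for r
  have "(\<Sum>r<n. \<beta> r * g r x) = 0" for x
  proof -
    have "(\<Sum>r<n. \<beta> r * g r x) = (\<Sum>r<n. (if r = s then g s x else 0) - (if r = s' then g s' x else 0))"
      by (intro sum.cong) (auto simp: \<beta>_def s)
    then show ?thesis using s by (simp add: sum_subtractf)
  qed
  then show thesis using that[of s \<beta>] s by (simp add: \<beta>_def)
next
  case True
  have "fun_space.dependent (g ` {..<n})"
  proof (rule ccontr)
    assume "fun_space.independent (g ` {..<n})"
    then have "card (g ` {..<n}) \<le> card X"
      using fun_space.independent_span_bound[OF assms(1)] assms(3) by blast
    then show False using card_image[OF True] assms(2) by simp
  qed
  then obtain u where u: "\<exists>v\<in>g ` {..<n}. u v \<noteq> 0" "(\<Sum>v\<in>g ` {..<n}. (\<lambda>i. u v * v i)) = 0"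
    using fun_space.dependent_finite[of "g ` {..<n}"] by auto
  then have "(\<Sum>s<n. u (g s) * g s x) = 0" for x
    using sum.reindex[OF True, of "\<lambda>v. (\<lambda>i. u v * v i)"] by (simp add: sum_fun_apply fun_eq_iff)
  then show thesis using that[of _ "\<lambda>s. u (g s)"] u(1) by blast
qed

text \<open>Base-k digits: a number s below k^d encodes a monomial in d variables with all exponents
  below k.\<close>

definition digit :: "nat \<Rightarrow> nat \<Rightarrow> nat \<Rightarrow> nat" where
  "digit k i s = (s div k ^ i) mod k"

lemma digit_expansion: "(\<Sum>i<d. digit k i s * k ^ i) = s mod k ^ d"
proof (induction d)
  case (Suc d)
  have "s mod k ^ Suc d = k ^ d * (s div k ^ d mod k) + s mod k ^ d"
    by (simp only: power_Suc2 mod_mult2_eq)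
  then show ?case by (simp add: Suc.IH) (simp add: digit_def mult.commute)
qed simp

lemma poly_funs_sum: "0 \<in> K \<Longrightarrow> (\<And>i. i \<in> I \<Longrightarrow> p i \<in> poly_funs K B) \<Longrightarrow> (\<lambda>x. \<Sum>i\<in>I. p i x) \<in> poly_funs K B"
  by (induction I rule: infinite_finite_induct) (auto intro: poly_funs.intros)

lemma poly_funs_prod: "1 \<in> K \<Longrightarrow> (\<And>i. i \<in> I \<Longrightarrow> p i \<in> poly_funs K B) \<Longrightarrow> (\<lambda>x. \<Prod>i\<in>I. p i x) \<in> poly_funs K B"
  by (induction I rule: infinite_finite_induct) (auto intro: poly_funs.intros)

lemma poly_funs_power: "1 \<in> K \<Longrightarrow> p \<in> poly_funs K B \<Longrightarrow> (\<lambda>x. p x ^ n) \<in> poly_funs K B"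
  by (induction n) (auto intro: poly_funs.intros)

text \<open>Substituting powers of one variable with base-k exponents separates the monomials.\<close>

lemma monomials_independent:
  assumes k: "k > 0" and zero: "\<And>x :: nat \<Rightarrow> complex. (\<Sum>s<k ^ d. \<beta> s * (\<Prod>i<d. x i ^ digit k i s)) = 0"
    and s: "s < k ^ d"
  shows "\<beta> s = 0"
proof -
  obtain n where n: "k ^ d = Suc n" using k by (metis gr0_implies_Suc zero_less_power)
  have "(\<Sum>s\<le>n. \<beta> s * t ^ s) = 0" for t
  proof -
    have "(\<Prod>i<d. (t ^ k ^ i) ^ digit k i s) = t ^ s" if "s < k ^ d" for s
    proof -
      have "(\<Prod>i<d. (t ^ k ^ i) ^ digit k i s) = t ^ (\<Sum>i<d. digit k i s * k ^ i)"
        by (simp add: power_sum power_mult mult.commute flip: power_mult)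
      then show ?thesis using that by (simp add: digit_expansion)
    qed
    then have "(\<Sum>s<k ^ d. \<beta> s * t ^ s) = 0" using zero[of "\<lambda>i. t ^ k ^ i"] by simp
    then show ?thesis by (simp add: n lessThan_Suc_atMost)
  qed
  then have "\<forall>i\<le>n. \<beta> i = 0" using polyfun_eq_0[of \<beta> n] by blast
  then show ?thesis using s n by simp
qed

text \<open>The characters in J generate all of them up to torsion, which the common exponent e
  absorbs. A smallest such J has the rank of the character group as its size.\<close>

definition torsion_spans :: "'x set \<Rightarrow> ('n \<Rightarrow> 'x \<Rightarrow> complex) \<Rightarrow> 'n set \<Rightarrow> bool" where
  "torsion_spans T ch J \<longleftrightarrow> (\<exists>e>0. \<exists>c :: 'n \<Rightarrow> 'n \<Rightarrow> int.
     \<forall>a. \<forall>A\<in>T. ch a A ^ e = (\<Prod>b\<in>J. ch b A powi c a b))"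

section \<open>Monomials in the characters and the growth of their number\<close>

context
  fixes T :: "(complex^'n^'n) set" and ch :: "'n \<Rightarrow> complex^'n^'n \<Rightarrow> complex"
  assumes nz: "\<And>a A. A \<in> T \<Longrightarrow> ch a A \<noteq> 0"
begin

text \<open>Zero off T, so that monomials with the same restriction to T are the same function and
  are counted once.\<close>

definition monom_on :: "('n \<Rightarrow> nat) \<Rightarrow> complex^'n^'n \<Rightarrow> complex" where
  "monom_on m A = (if A \<in> T then \<Prod>a\<in>UNIV. ch a A ^ m a else 0)"

definition monoms :: "nat \<Rightarrow> (complex^'n^'n \<Rightarrow> complex) set" where
  "monoms K = {monom_on m | m. \<forall>a. m a \<le> K}"

definition restr :: "(complex^'n^'n \<Rightarrow> complex) \<Rightarrow> complex^'n^'n \<Rightarrow> complex" where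
  "restr p A = (if A \<in> T then p A else 0)"

lemma span_monoms_mono: "f \<in> fun_space.span (monoms K) \<Longrightarrow> K \<le> L \<Longrightarrow> f \<in> fun_space.span (monoms L)"
  using fun_space.span_mono[of "monoms K" "monoms L"] le_trans unfolding monoms_def by blast

lemma monom_on_mult: "monom_on m A * monom_on m' A = monom_on (\<lambda>a. m a + m' a) A"
  by (simp add: monom_on_def power_add prod.distrib)

lemma span_monoms_mult:
  assumes "f \<in> fun_space.span (monoms K)" "g \<in> fun_space.span (monoms L)"
  shows "(\<lambda>A. f A * g A) \<in> fun_space.span (monoms (K + L))"
  using assms(1)
proof (induction rule: fun_space.span_induct_alt)
  case base
  then show ?case using fun_space.span_zero by (simp add: zero_fun_def)
next
  case (step c f f')
  then obtain m where m: "f = monom_on m" "\<forall>a. m a \<le> K" by (auto simp: monoms_def)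
  from assms(2) have "(\<lambda>A. f A * g A) \<in> fun_space.span (monoms (K + L))"
  proof (induction rule: fun_space.span_induct_alt)
    case base
    then show ?case using fun_space.span_zero by (simp add: zero_fun_def)
  next
    case (step c' h h')
    then obtain m' where m': "h = monom_on m'" "\<forall>a. m' a \<le> L" by (auto simp: monoms_def)
    have "monom_on (\<lambda>a. m a + m' a) \<in> monoms (K + L)"
      using m m' by (auto simp: monoms_def intro!: exI[of _ "\<lambda>a. m a + m' a"] add_mono)
    from fun_space.span_scale[OF fun_space.span_base[OF this], of c']
    have "(\<lambda>A. c' * monom_on (\<lambda>a. m a + m' a) A) + (\<lambda>A. f A * h' A) \<in> fun_space.span (monoms (K + L))"
      using step(2) by (rule fun_space.span_add)
    then show ?case by (simp add: plus_fun_def m m' monom_on_mult[symmetric] algebra_simps)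
  qed
  from fun_space.span_scale[OF this, of c]
  have "(\<lambda>A. c * (f A * g A)) + (\<lambda>A. f' A * g A) \<in> fun_space.span (monoms (K + L))"
    using step(2) by (rule fun_space.span_add)
  then show ?case by (simp add: plus_fun_def algebra_simps)
qed

lemma restr_one: "restr (\<lambda>_. 1) \<in> fun_space.span (monoms K)"
proof -
  have "monom_on (\<lambda>_. 0) \<in> monoms K" by (auto simp: monoms_def)
  moreover have "restr (\<lambda>_. 1) = monom_on (\<lambda>_. 0)" by (auto simp: restr_def monom_on_def)
  ultimately show ?thesis by (simp add: fun_space.span_base)
qed

lemma restr_power:
  assumes "restr f \<in> fun_space.span (monoms K)"
  shows "restr (\<lambda>A. f A ^ n) \<in> fun_space.span (monoms (n * K))"
proof (induction n)
  case 0
  then show ?case using restr_one by simp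
next
  case (Suc n)
  have "(\<lambda>A. restr f A * restr (\<lambda>A. f A ^ n) A) = restr (\<lambda>A. f A ^ Suc n)"
    by (auto simp: restr_def)
  then show ?case using span_monoms_mult[OF assms Suc.IH] by simp
qed

lemma restr_prod_power:
  fixes d :: nat
  assumes "\<And>i. i < d \<Longrightarrow> restr (f i) \<in> fun_space.span (monoms K)"
  shows "restr (\<lambda>A. \<Prod>i<d. f i A ^ \<alpha> i) \<in> fun_space.span (monoms ((\<Sum>i<d. \<alpha> i) * K))"
  using assms
proof (induction d)
  case 0
  then show ?case using restr_one by simp
next
  case (Suc d)
  have "(\<lambda>A. restr (\<lambda>A. \<Prod>i<d. f i A ^ \<alpha> i) A * restr (\<lambda>A. f d A ^ \<alpha> d) A) =
      restr (\<lambda>A. \<Prod>i<Suc d. f i A ^ \<alpha> i)"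
    by (auto simp: restr_def)
  then show ?case
    using span_monoms_mult[OF Suc.IH restr_power[of "f d" K "\<alpha> d"]] Suc.prems
    by (simp add: algebra_simps)
qed

lemma restr_poly:
  assumes entries: "\<And>A i j. A \<in> T \<Longrightarrow> A $ i $ j = (\<Sum>a\<in>UNIV. w i j a * ch a A)"
    and "p \<in> mat_polys UNIV"
  shows "\<exists>K. restr p \<in> fun_space.span (monoms K)"
  using assms(2)
proof (induction rule: mat_polys_induct)
  case (const c)
  have "(\<lambda>A. c * restr (\<lambda>_. 1) A) = restr (\<lambda>_. c)" by (auto simp: restr_def)
  then show ?case using fun_space.span_scale[OF restr_one, of c 0] by (intro exI[of _ 0]) simp
next
  case (entry i j)
  have "(\<lambda>A. w i j a * monom_on (\<lambda>b. if b = a then 1 else 0) A) \<in> fun_space.span (monoms 1)" for a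
    by (intro fun_space.span_scale fun_space.span_base) (auto simp: monoms_def)
  then have "(\<Sum>a\<in>UNIV. (\<lambda>A. w i j a * monom_on (\<lambda>b. if b = a then 1 else 0) A)) \<in> fun_space.span (monoms 1)"
    by (rule fun_space.span_sum)
  moreover have "restr (\<lambda>A. A $ i $ j) = (\<Sum>a\<in>UNIV. (\<lambda>A. w i j a * monom_on (\<lambda>b. if b = a then 1 else 0) A))"
  proof
    fix A
    have "(\<Prod>b\<in>UNIV. ch b A ^ (if b = a then 1 else 0)) = ch a A" for a
    proof -
      have "(\<Prod>b\<in>UNIV. ch b A ^ (if b = a then 1 else 0)) = (\<Prod>b\<in>UNIV. if b = a then ch b A else 1)"
        by (intro prod.cong) auto
      then show ?thesis by simp
    qed
    then show "restr (\<lambda>A. A $ i $ j) A = (\<Sum>a\<in>UNIV. (\<lambda>A. w i j a * monom_on (\<lambda>b. if b = a then 1 else 0) A)) A"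
      by (simp add: restr_def monom_on_def sum_fun_apply entries)
  qed
  ultimately show ?case by (intro exI[of _ 1]) simp
next
  case (add p q)
  then obtain K L where "restr p \<in> fun_space.span (monoms K)" "restr q \<in> fun_space.span (monoms L)" by blast
  then have "restr p + restr q \<in> fun_space.span (monoms (max K L))"
    by (intro fun_space.span_add) (auto elim: span_monoms_mono)
  moreover have "restr p + restr q = restr (\<lambda>A. p A + q A)" by (auto simp: restr_def)
  ultimately show ?case by (intro exI[of _ "max K L"]) simp
next
  case (mult p q)
  then obtain K L where "restr p \<in> fun_space.span (monoms K)" "restr q \<in> fun_space.span (monoms L)" by blast
  from span_monoms_mult[OF this] have "(\<lambda>A. restr p A * restr q A) \<in> fun_space.span (monoms (K + L))" .
  moreover have "(\<lambda>A. restr p A * restr q A) = restr (\<lambda>A. p A * q A)" by (auto simp: restr_def)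
  ultimately show ?case by (intro exI[of _ "K + L"]) simp
qed

text \<open>Division of an exponent by e leaves a remainder with e possible values and a quotient
  that is rewritten through J. The resulting exponents on J lie between -K C and K C, so the number
  of monomials grows like K to the power \<open>card J\<close>.\<close>

lemma card_monoms:
  assumes "torsion_spans T ch J"
  obtains E C where "\<And>K. finite (monoms K) \<and> card (monoms K) \<le> E * (2 * K * C + 1) ^ card J"
proof -
  obtain e c where e: "e > 0"
    and c: "\<And>a A. A \<in> T \<Longrightarrow> ch a A ^ e = (\<Prod>b\<in>J. ch b A powi c a b)"
    using assms unfolding torsion_spans_def by blast
  \<comment> \<open>A crude bound, summed over all a and b, on the growth of an exponent on J per
    unit of K.\<close>
  define C where "C = nat (\<Sum>a\<in>UNIV. \<Sum>b\<in>J. \<bar>c a b\<bar>)"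
  have C: "int C = (\<Sum>a\<in>UNIV. \<Sum>b\<in>J. \<bar>c a b\<bar>)"
    unfolding C_def by (simp add: sum_nonneg)
  define G where "G = (\<lambda>(r :: 'n \<Rightarrow> nat, s :: 'n \<Rightarrow> int) A.
    if A \<in> T then (\<Prod>a\<in>UNIV. ch a A ^ r a) * (\<Prod>b\<in>J. ch b A powi s b) else 0)"
  have "finite (monoms K) \<and> card (monoms K) \<le> e ^ CARD('n) * (2 * K * C + 1) ^ card J" for K
  proof -
    define X where "X = PiE (UNIV :: 'n set) (\<lambda>_. {..<e}) \<times> PiE J (\<lambda>_. {- int (K * C)..int (K * C)})"
    have fin: "finite X" unfolding X_def by (intro finite_cartesian_product finite_PiE) auto
    have cardX: "card X = e ^ CARD('n) * (2 * K * C + 1) ^ card J"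
      unfolding X_def by (simp add: card_cartesian_product card_PiE nat_add_distrib nat_mult_distrib mult_ac)
    have "monoms K \<subseteq> G ` X"
    proof
      fix f assume "f \<in> monoms K"
      then obtain m where m: "f = monom_on m" "\<And>a. m a \<le> K" by (auto simp: monoms_def)
      define r where "r a = m a mod e" for a
      define s where "s b = (if b \<in> J then \<Sum>a\<in>UNIV. int (m a div e) * c a b else undefined)" for b
      have "(r, s) \<in> X"
      proof -
        have "\<bar>s b\<bar> \<le> int (K * C)" if b: "b \<in> J" for b
        proof -
          have "\<bar>s b\<bar> \<le> (\<Sum>a\<in>UNIV. \<bar>int (m a div e) * c a b\<bar>)"
            using b by (simp add: s_def sum_abs)
          also have "\<dots> \<le> (\<Sum>a\<in>UNIV. int K * (\<Sum>b\<in>J. \<bar>c a b\<bar>))"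
          proof (rule sum_mono)
            fix a
            have "int (m a div e) \<le> int K" using m(2)[of a] div_le_dividend[of "m a" e] by linarith
            moreover have "\<bar>c a b\<bar> \<le> (\<Sum>b\<in>J. \<bar>c a b\<bar>)" using b by (intro member_le_sum) auto
            ultimately show "\<bar>int (m a div e) * c a b\<bar> \<le> int K * (\<Sum>b\<in>J. \<bar>c a b\<bar>)"
              unfolding abs_mult by (intro mult_mono) auto
          qed
          also have "\<dots> = int (K * C)" by (simp add: C sum_distrib_left)
          finally show ?thesis .
        qed
        then have "s b \<in> {- int (K * C)..int (K * C)}" if "b \<in> J" for b
          using that abs_le_D1 abs_le_D2 by (fastforce simp del: of_nat_mult)
        then have "s \<in> PiE J (\<lambda>_. {- int (K * C)..int (K * C)})"
          by (intro PiE_I) (auto simp: s_def)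
        then show ?thesis using e by (auto simp: X_def r_def)
      qed
      moreover have "f = G (r, s)"
      proof
        fix A
        show "f A = G (r, s) A"
        proof (cases "A \<in> T")
          case True
          have "ch a A ^ m a = ch a A ^ r a * (\<Prod>b\<in>J. ch b A powi (int (m a div e) * c a b))" for a
          proof -
            have "ch a A ^ m a = ch a A ^ r a * (ch a A ^ e) ^ (m a div e)"
              unfolding r_def power_mult[symmetric] power_add[symmetric] by simp
            also have "(ch a A ^ e) ^ (m a div e) = (\<Prod>b\<in>J. ch b A powi (int (m a div e) * c a b))"
              unfolding c[OF True] prod_power_distrib
              by (intro prod.cong refl) (simp add: power_int_power' mult.commute)
            finally show ?thesis .
          qed
          then have "f A = (\<Prod>a\<in>UNIV. ch a A ^ r a) * (\<Prod>b\<in>J. \<Prod>a\<in>UNIV. ch b A powi (int (m a div e) * c a b))"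
            using True by (subst prod.swap) (simp add: m(1) monom_on_def prod.distrib)
          also have "(\<Prod>b\<in>J. \<Prod>a\<in>UNIV. ch b A powi (int (m a div e) * c a b)) = (\<Prod>b\<in>J. ch b A powi s b)"
          proof (rule prod.cong[OF refl])
            fix b assume b: "b \<in> J"
            have "(\<Prod>a\<in>S. ch b A powi (int (m a div e) * c a b)) = ch b A powi (\<Sum>a\<in>S. int (m a div e) * c a b)"
              if "finite S" for S
              using that by induction (simp_all add: power_int_add nz[OF True])
            then show "(\<Prod>a\<in>UNIV. ch b A powi (int (m a div e) * c a b)) = ch b A powi s b"
              using b by (simp add: s_def)
          qed
          finally show ?thesis using True by (simp add: G_def)
        qed (simp add: m(1) monom_on_def G_def)
      qed
      ultimately show "f \<in> G ` X" by blast
    qed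
    then show ?thesis
      using fin cardX surj_card_le[OF fin] finite_subset by (metis finite_imageI)
  qed
  then show thesis using that by blast
qed

text \<open>If d functions are algebraically independent on T, then the k^d monomials in them with
  exponents below k are linearly independent there. They lie in a space whose dimension grows like k
  to the power \<open>card J\<close>, so d cannot exceed \<open>card J\<close>.\<close>

theorem alg_dim_le:
  assumes entries: "\<And>A i j. A \<in> T \<Longrightarrow> A $ i $ j = (\<Sum>a\<in>UNIV. w i j a * ch a A)"
    and J: "torsion_spans T ch J"
  shows "alg_dim T \<le> card J"
proof -
  have bound: "d \<le> card J" if f: "\<And>i. i < d \<Longrightarrow> f i \<in> mat_polys UNIV" and ind: "alg_independent_on T d f" for d f
  proof (rule ccontr)
    assume "\<not> d \<le> card J"
    then have d: "card J < d" by simp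
    obtain E C where card: "\<And>K. finite (monoms K) \<and> card (monoms K) \<le> E * (2 * K * C + 1) ^ card J"
      using card_monoms[OF J] by blast
    have "\<forall>i\<in>{..<d}. \<exists>K. restr (f i) \<in> fun_space.span (monoms K)" using restr_poly[OF entries f] by blast
    then obtain Kf where Kf: "\<And>i. i < d \<Longrightarrow> restr (f i) \<in> fun_space.span (monoms (Kf i))"
      by (metis bchoice lessThan_iff)
    define K0 where "K0 = (\<Sum>i<d. Kf i)"
    have K0: "restr (f i) \<in> fun_space.span (monoms K0)" if "i < d" for i
      using Kf[OF that] by (rule span_monoms_mono) (use that in \<open>auto simp: K0_def intro: member_le_sum\<close>)
    \<comment> \<open>With r = \<open>card J\<close>, the bound E (2 d k K0 C + 1)^r is at most E
      (c0 k)^r, and k is chosen just large enough to make this smaller than k^(r + 1).\<close>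
    define c0 where "c0 = 2 * (d * K0) * C + 1"
    define k where "k = E * c0 ^ card J + 1"
    define g where "g s = restr (\<lambda>A. \<Prod>i<d. f i A ^ digit k i s)" for s
    have g: "g s \<in> fun_space.span (monoms (d * k * K0))" for s
    proof -
      have "(\<Sum>i<d. digit k i s) \<le> (\<Sum>i<d. k)" by (intro sum_mono) (simp add: digit_def k_def)
      then have le: "(\<Sum>i<d. digit k i s) * K0 \<le> d * k * K0" by simp
      show ?thesis unfolding g_def by (rule span_monoms_mono[OF restr_prod_power[OF K0] le])
    qed
    have "card (monoms (d * k * K0)) \<le> E * (2 * (d * k * K0) * C + 1) ^ card J" using card by blast
    also have "\<dots> \<le> E * (c0 * k) ^ card J"
      by (intro mult_left_mono power_mono) (simp_all add: c0_def k_def algebra_simps)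
    also have "\<dots> = (E * c0 ^ card J) * k ^ card J" by (simp add: power_mult_distrib)
    also have "\<dots> < k * k ^ card J" by (simp add: k_def)
    also have "\<dots> \<le> k ^ d" using d power_increasing[of "Suc (card J)" d k] by (simp add: k_def)
    finally have lt: "card (monoms (d * k * K0)) < k ^ d" .
    obtain \<beta> s where s: "s < k ^ d" "\<beta> s \<noteq> 0" and dep: "\<And>A. (\<Sum>s<k ^ d. \<beta> s * g s A) = 0"
      by (rule indexed_dependence[OF _ lt, of g]) (use card g in auto)
    \<comment> \<open>The linear dependence of the monomials, read as a polynomial relation between
      the f i.\<close>
    define P where "P x = (\<Sum>s<k ^ d. \<beta> s * (\<Prod>i<d. x i ^ digit k i s))" for x :: "nat \<Rightarrow> complex"
    have "P \<in> poly_funs UNIV {\<lambda>x. x i | i. i < d}"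
      unfolding P_def
      by (intro poly_funs_sum poly_funs.mult poly_funs_prod poly_funs_power poly_funs.const)
        (auto intro: poly_funs.gen)
    moreover have "P (\<lambda>i. f i A) = 0" if "A \<in> T" for A
      using dep[of A] that by (simp add: P_def g_def restr_def)
    ultimately have "P = (\<lambda>_. 0)" using ind unfolding alg_independent_on_def by blast
    then have "\<beta> s = 0"
      by (intro monomials_independent[where k = k and d = d and \<beta> = \<beta>] s) (auto simp: k_def P_def fun_eq_iff)
    then show False using s by simp
  qed
  let ?D = "{d. \<exists>f. (\<forall>i<d. f i \<in> mat_polys UNIV) \<and> alg_independent_on T d f}"
  have le: "d \<le> card J" if "d \<in> ?D" for d using that bound by blast
  \<comment> \<open>For an infinite set of natural numbers \<open>Sup\<close> would not be a genuine
    maximum.\<close>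
  then have "finite ?D" by (meson finite_nat_set_iff_bounded_le mem_Collect_eq)
  then show ?thesis
    unfolding alg_dim_def Sup_nat_def using le by (auto simp del: mem_Collect_eq)
qed

end


section \<open>Eigenvectors of an irreducible torus\<close>

lemma fun_span_vec: "fun_space.span (vec_nth ` Z) = vec_nth ` vec.span Z"
  for Z :: "(complex^'n) set"
proof (rule antisym)
  have "fun_space.subspace (vec_nth ` vec.span Z)"
  proof (rule fun_space.subspaceI)
    have "(0 :: 'n \<Rightarrow> complex) = vec_nth 0" by (simp add: fun_eq_iff)
    then show "0 \<in> vec_nth ` vec.span Z" using vec.span_zero by blast
  next
    fix x y assume "x \<in> vec_nth ` vec.span Z" "y \<in> vec_nth ` vec.span Z"
    then obtain u v where uv: "x = vec_nth u" "y = vec_nth v" "u \<in> vec.span Z" "v \<in> vec.span Z" by blast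
    then have "x + y = vec_nth (u + v)" by (simp add: fun_eq_iff)
    then show "x + y \<in> vec_nth ` vec.span Z" using vec.span_add[OF uv(3,4)] by blast
  next
    fix c x assume "x \<in> vec_nth ` vec.span Z"
    then obtain u where u: "x = vec_nth u" "u \<in> vec.span Z" by blast
    then have "(\<lambda>i. c * x i) = vec_nth (c *s u)" by (simp add: fun_eq_iff)
    then show "(\<lambda>i. c * x i) \<in> vec_nth ` vec.span Z" using vec.span_scale[OF u(2), of c] by blast
  qed
  then show "fun_space.span (vec_nth ` Z) \<subseteq> vec_nth ` vec.span Z"
    by (intro fun_space.span_minimal) (auto intro: vec.span_base)
  show "vec_nth ` vec.span Z \<subseteq> fun_space.span (vec_nth ` Z)"
  proof safe
    fix u assume "u \<in> vec.span Z"
    then show "vec_nth u \<in> fun_space.span (vec_nth ` Z)"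
    proof (induction rule: vec.span_induct_alt)
      case base
      have "vec_nth 0 = (0 :: 'n \<Rightarrow> complex)" by (simp add: fun_eq_iff)
      then show ?case using fun_space.span_zero by metis
    next
      case (step c x y)
      have "vec_nth (c *s x + y) = (\<lambda>i. c * x $ i) + vec_nth y" by (simp add: fun_eq_iff)
      moreover have "(\<lambda>i. c * x $ i) + vec_nth y \<in> fun_space.span (vec_nth ` Z)"
        using step by (intro fun_space.span_add fun_space.span_scale) (auto intro: fun_space.span_base)
      ultimately show ?case by metis
    qed
  qed
qed

lemma galois_descent_vec:
  fixes Z :: "(complex^'n) set"
  assumes stable: "\<And>z. z \<in> Z \<Longrightarrow> \<exists>Y. finite Y \<and> (\<forall>F \<sigma>. field_embedding F \<sigma> \<longrightarrow> Y \<subseteq> F \<longrightarrow>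
    (\<forall>i. z $ i \<in> F) \<longrightarrow> (\<chi> i. \<sigma> (z $ i)) \<in> vec.span Z)"
  shows "vec.span Z \<subseteq> vec.span {r \<in> vec.span Z. \<forall>i. r $ i \<in> \<rat>}"
proof
  fix u assume u: "u \<in> vec.span Z"
  have "vec_nth u \<in> fun_space.span {r \<in> fun_space.span (vec_nth ` Z). range r \<subseteq> \<rat>}"
  proof (rule galois_descent[of UNIV])
    show "vec_nth u \<in> fun_space.span (vec_nth ` Z)" using u by (auto simp: fun_span_vec)
    fix x assume "x \<in> vec_nth ` Z"
    then obtain z where z: "z \<in> Z" "x = vec_nth z" by blast
    obtain Y where Y: "finite Y" "\<And>F \<sigma>. field_embedding F \<sigma> \<Longrightarrow> Y \<subseteq> F \<Longrightarrow>
        (\<forall>i. z $ i \<in> F) \<Longrightarrow> (\<chi> i. \<sigma> (z $ i)) \<in> vec.span Z"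
      using stable[OF z(1)] by blast
    have "\<sigma> \<circ> x \<in> fun_space.span (vec_nth ` Z)"
      if "field_embedding F \<sigma>" "Y \<subseteq> F" "range x \<subseteq> F" for F \<sigma>
    proof -
      have "\<sigma> \<circ> x = vec_nth (\<chi> i. \<sigma> (z $ i))" by (simp add: fun_eq_iff z)
      moreover have "(\<chi> i. \<sigma> (z $ i)) \<in> vec.span Z" using Y(2)[OF that(1,2)] that(3) z by auto
      ultimately show ?thesis unfolding fun_span_vec by (metis imageI)
    qed
    then show "\<exists>Y. finite Y \<and> (\<forall>F \<sigma>. field_embedding F \<sigma> \<longrightarrow> Y \<subseteq> F \<longrightarrow> range x \<subseteq> F \<longrightarrow>
        \<sigma> \<circ> x \<in> fun_space.span (vec_nth ` Z))"
      using Y(1) by blast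
  qed auto
  also have "{r \<in> fun_space.span (vec_nth ` Z). range r \<subseteq> \<rat>} = vec_nth ` {r \<in> vec.span Z. \<forall>i. r $ i \<in> \<rat>}"
    by (auto simp: fun_span_vec image_subset_iff)
  finally show "u \<in> vec.span {r \<in> vec.span Z. \<forall>i. r $ i \<in> \<rat>}"
    unfolding fun_span_vec by (auto simp: vec_nth_inject)
qed

section \<open>Eigenvectors of commuting matrices\<close>

lemma stable_mat_power:
  assumes "\<And>u. u \<in> U \<Longrightarrow> A *v u \<in> U" "v \<in> U"
  shows "mat_power A k *v v \<in> U"
  by (induction k) (simp_all add: assms flip: matrix_vector_mul_assoc)

text \<open>Take p of least degree with p(A) v = 0 and split off a root c, so that p is X - c times
  q. Then q(A) v is nonzero by minimality and is an eigenvector for c; it lies in U because U is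
  stable.\<close>

lemma eigenvector_in_stable_subspace:
  fixes A :: "complex^'n^'n"
  assumes U: "vec.subspace U" "\<And>u. u \<in> U \<Longrightarrow> A *v u \<in> U" and v: "v \<in> U" "v \<noteq> 0"
  obtains w c where "w \<in> U" "w \<noteq> 0" "A *v w = c *s w"
proof -
  define n where "n = CARD('n)"
  \<comment> \<open>This is p(A) v as long as the degree of p is at most n, so the degree bound is
    part of what is minimized.\<close>
  define S where "S p = (\<Sum>i\<le>n. coeff p i *s (mat_power A i *v v))" for p :: "complex poly"
  have "\<exists>p. p \<noteq> 0 \<and> degree p \<le> n \<and> S p = 0"
  proof -
    let ?X = "(\<lambda>j. vec_nth (axis j 1)) ` (UNIV :: 'n set)"
    have sp: "vec_nth (x :: complex^'n) \<in> fun_space.span ?X" for x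
    proof -
      have "vec_nth x = (\<Sum>j\<in>UNIV. (\<lambda>i. x $ j * axis j 1 $ i))"
        by (simp add: fun_eq_iff sum_fun_apply axis_def if_distrib cong: if_cong)
      also have "\<dots> \<in> fun_space.span ?X"
        by (intro fun_space.span_sum fun_space.span_scale fun_space.span_base) simp
      finally show ?thesis .
    qed
    have cd: "card ?X < Suc n" using card_image_le[of "UNIV :: 'n set"] by (simp add: n_def less_Suc_eq_le)
    obtain \<beta> s where s: "s < Suc n" "\<beta> s \<noteq> 0"
      and dep: "\<And>x. (\<Sum>s<Suc n. \<beta> s * (mat_power A s *v v) $ x) = 0"
      by (rule indexed_dependence[of ?X "Suc n" "\<lambda>s. vec_nth (mat_power A s *v v)"])
        (use sp cd that in \<open>auto simp del: sum.lessThan_Suc\<close>)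
    define p where "p = (\<Sum>i\<le>n. monom (\<beta> i) i)"
    have c: "coeff p i = (if i \<le> n then \<beta> i else 0)" for i
      by (simp add: p_def coeff_sum coeff_monom)
    have "p \<noteq> 0" using s c[of s] by auto
    moreover have "degree p \<le> n" by (rule degree_le) (simp add: c)
    moreover have "S p = 0" using dep by (simp add: S_def c vec_eq_iff sum_component lessThan_Suc_atMost)
    ultimately show ?thesis by blast
  qed
  then obtain p where p: "p \<noteq> 0" "degree p \<le> n" "S p = 0"
    and min: "\<And>q. q \<noteq> 0 \<and> degree q \<le> n \<and> S q = 0 \<Longrightarrow> degree p \<le> degree q"
    using arg_min_nat_lemma[of "\<lambda>p. p \<noteq> 0 \<and> degree p \<le> n \<and> S p = 0" _ degree] by blast
  have "degree p \<noteq> 0"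
  proof
    assume "degree p = 0"
    then obtain c where c: "p = [:c:]" by (rule degree_eq_zeroE)
    have "S p = (\<Sum>i\<le>n. if i = 0 then c *s v else 0)"
      unfolding S_def by (intro sum.cong) (auto simp: c coeff_pCons split: nat.split)
    then have "S p = c *s v" by simp
    then show False using p c v by (simp add: vec_eq_iff) 
  qed
  then obtain c where "poly p c = 0"
    using fundamental_theorem_of_algebra[of p] by (auto simp: constant_degree)
  then obtain q where q: "p = [:- c, 1:] * q" by (auto simp: poly_eq_0_iff_dvd)
  have q0: "q \<noteq> 0" using q p by auto
  have dq: "degree p = Suc (degree q)" using q0 by (simp add: q degree_mult_eq del: mult_pCons_left)
  have "S q \<noteq> 0" using min[of q] q0 dq p(2) by auto
  moreover have "S q \<in> U"
    unfolding S_def using stable_mat_power[of U A] U v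
    by (intro vec.subspace_sum vec.subspace_scale) auto
  moreover have "A *v S q = c *s S q"
  proof -
    have coeff: "coeff p i = (case i of 0 \<Rightarrow> 0 | Suc j \<Rightarrow> coeff q j) - c * coeff q i" for i
      by (simp add: q coeff_pCons split: nat.split)
    have "S p = (\<Sum>i\<le>n. (case i of 0 \<Rightarrow> 0 | Suc j \<Rightarrow> coeff q j) *s (mat_power A i *v v)) - c *s S q"
      by (simp add: S_def coeff vec.scale_left_diff_distrib sum_subtractf vec.scale_sum_right)
    also have "(\<Sum>i\<le>n. (case i of 0 \<Rightarrow> 0 | Suc j \<Rightarrow> coeff q j) *s (mat_power A i *v v)) =
        (\<Sum>j<n. coeff q j *s (mat_power A (Suc j) *v v))"
      by (subst sum.atMost_shift) simp
    also have "\<dots> = A *v (\<Sum>j<n. coeff q j *s (mat_power A j *v v))"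
      by (simp add: vec.linear_sum[OF matrix_vector_mul_linear_gen] vec.linear_scale[OF matrix_vector_mul_linear_gen]
          flip: matrix_vector_mul_assoc)
    also have "(\<Sum>j<n. coeff q j *s (mat_power A j *v v)) = S q"
    proof -
      \<comment> \<open>The degree of q is below n, so a sum that stops before n misses
        nothing.\<close>
      have "coeff q n = 0" using dq p(2) by (intro coeff_eq_0) simp
      then show ?thesis by (simp add: S_def flip: lessThan_Suc_atMost)
    qed
    finally show ?thesis using p(3) by simp
  qed
  ultimately show thesis using that by blast
qed

text \<open>In a nonzero stable subspace U of least dimension, an eigenspace of A is again stable
  because the matrices commute. It is therefore all of U, and every A acts on U as a scalar.\<close>

lemma common_eigenvector:
  fixes T :: "(complex^'n^'n) set"
  assumes comm: "\<And>A B. A \<in> T \<Longrightarrow> B \<in> T \<Longrightarrow> A ** B = B ** A"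
  obtains v where "v \<noteq> 0" "\<And>A. A \<in> T \<Longrightarrow> \<exists>c. A *v v = c *s v"
proof -
  define St where "St U \<longleftrightarrow> vec.subspace U \<and> (\<forall>A\<in>T. \<forall>u\<in>U. A *v u \<in> U) \<and> (\<exists>u\<in>U. u \<noteq> 0)"
    for U :: "(complex^'n) set"
  have "St UNIV" by (auto simp: St_def intro!: exI[of _ "axis undefined 1"] simp: axis_eq_0_iff)
  then obtain U where U: "St U" and min: "\<And>W. St W \<Longrightarrow> vec.dim U \<le> vec.dim W"
    using arg_min_nat_lemma[of St UNIV vec.dim] by blast
  obtain v where v: "v \<in> U" "v \<noteq> 0" using U by (auto simp: St_def)
  have "\<exists>c. A *v v = c *s v" if A: "A \<in> T" for A
  proof -
    obtain w c where w: "w \<in> U" "w \<noteq> 0" "A *v w = c *s w"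
      using eigenvector_in_stable_subspace[of U A v] U A v by (auto simp: St_def)
    define W where "W = {u \<in> U. A *v u = c *s u}"
    have "St W"
      unfolding St_def
    proof (intro conjI ballI)
      show "vec.subspace W"
        using U unfolding W_def St_def vec.subspace_def
        by (auto simp: matrix_vector_right_distrib vec.scale_right_distrib vector_scalar_commute mult.commute)
      show "\<exists>u\<in>W. u \<noteq> 0" using w by (auto simp: W_def)
      fix B u assume B: "B \<in> T" and u: "u \<in> W"
      have "A *v (B *v u) = B *v (A *v u)"
        using comm[OF A B] by (simp add: matrix_vector_mul_assoc)
      also have "\<dots> = c *s (B *v u)" using u by (simp add: W_def vector_scalar_commute)
      finally show "B *v u \<in> W" using u B U by (auto simp: W_def St_def)
    qed
    then have "vec.dim U \<le> vec.dim W" by (rule min)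
    then have "W = U"
      using \<open>St W\<close> U by (intro vec.subspace_dim_equal) (auto simp: St_def W_def)
    then show ?thesis using v by (auto simp: W_def)
  qed
  then show thesis using that v by blast
qed

definition eigenvectors :: "(complex^'n^'n) set \<Rightarrow> (complex^'n) set" where
  "eigenvectors T = {v. v \<noteq> 0 \<and> (\<forall>A\<in>T. \<exists>c. A *v v = c *s v)}"

lemma matrix_vector_nth: "(A *v v) $ i = (\<Sum>k\<in>UNIV. A $ i $ k * v $ k)"
  by (simp add: matrix_vector_mult_def)

text \<open>v is an eigenvector of A when all minors
  \<open>v $ i * (A *v v) $ j - v $ j * (A *v v) $ i\<close> vanish. These are linear in A with
  coefficients from v, so \<open>vanishing_conj\<close> replaces v by its conjugate while A stays
  fixed.\<close>

lemma eigenvectors_conj: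
  fixes T :: "(complex^'n^'n) set"
  assumes alg: "rat_algebraic_group T" and v: "v \<in> eigenvectors T"
    and F: "field_embedding F \<sigma>" "\<And>i. v $ i \<in> F"
  shows "(\<chi> i. \<sigma> (v $ i)) \<in> eigenvectors T"
proof -
  interpret field_embedding F \<sigma> by (rule F(1))
  let ?w = "\<chi> i. \<sigma> (v $ i)"
  obtain i0 where i0: "v $ i0 \<noteq> 0" using v by (auto simp: eigenvectors_def vec_eq_iff)
  have w0: "?w $ i0 \<noteq> 0" using i0 F(2)[of i0] hom_eq_0_iff by simp
  have cross: "?w $ i * (A *v ?w) $ j = ?w $ j * (A *v ?w) $ i" if A: "A \<in> T" for A i j
  proof -
    \<comment> \<open>The index pairs a Boolean with a coordinate, which puts both products of the
      minor into one linear expression in A.\<close>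
    define c where "c = (\<lambda>(b, k). if b then v $ i * v $ k else - (v $ j * v $ k))"
    define g where "g = (\<lambda>(b, k :: 'n) A. if b then (A :: complex^'n^'n) $ j $ k else A $ i $ k)"
    have eq: "(\<Sum>k\<in>(UNIV :: (bool \<times> 'n) set). f k) = (\<Sum>k\<in>UNIV. f (True, k)) + (\<Sum>k\<in>UNIV. f (False, k))"
      for f :: "bool \<times> 'n \<Rightarrow> complex"
    proof -
      have "(\<Sum>k\<in>UNIV. f k) = (\<Sum>b\<in>UNIV. \<Sum>k\<in>UNIV. f (b, k))"
        by (simp add: sum.cartesian_product)
      then show ?thesis by (simp add: UNIV_bool)
    qed
    have "(\<Sum>k\<in>UNIV. \<sigma> (c k) * g k A) = 0"
    proof (rule vanishing_conj[OF alg _ _ _ F(1) _ A])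
      show "g k \<in> mat_polys \<rat>" for k
        by (cases k; cases "fst k") (auto simp: g_def mat_polys_entry)
      show "c ` UNIV \<subseteq> F" using F(2) by (auto simp: c_def mult_mem uminus_mem)
      fix B assume "B \<in> T"
      then obtain e where e: "B *v v = e *s v" using v by (auto simp: eigenvectors_def)
      have "(\<Sum>k\<in>UNIV. c k * g k B) = v $ i * (B *v v) $ j - v $ j * (B *v v) $ i"
        unfolding eq c_def g_def matrix_vector_nth by (simp add: sum_distrib_left sum_negf mult_ac)
      then show "(\<Sum>k\<in>UNIV. c k * g k B) = 0" by (simp add: e)
    qed auto
    then have "?w $ i * (A *v ?w) $ j - ?w $ j * (A *v ?w) $ i = 0"
      unfolding eq c_def g_def matrix_vector_nth using F(2)
      by (simp add: hom_mult hom_uminus mult_mem sum_distrib_left sum_negf mult_ac)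
    then show ?thesis by simp
  qed
  have "\<exists>c. A *v ?w = c *s ?w" if "A \<in> T" for A
  proof
    show "A *v ?w = ((A *v ?w) $ i0 / ?w $ i0) *s ?w"
      using cross[OF that, of i0] w0 by (simp add: vec_eq_iff field_simps)
  qed
  moreover have "?w \<noteq> 0" using w0 by (metis zero_index)
  ultimately show ?thesis by (simp add: eigenvectors_def)
qed

text \<open>What the argument retains of the CM Hodge structure: its Mumford-Tate group T, the Gram
  matrix G of the form, and irreducibility restated for T-stable subspaces that are spanned by their
  rational vectors.\<close>

locale irreducible_torus =
  fixes T :: "(complex^'n^'n) set" and G :: "complex^'n^'n"
  assumes alg: "rat_algebraic_group T"
    and comm: "\<And>A B. A \<in> T \<Longrightarrow> B \<in> T \<Longrightarrow> A ** B = B ** A"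
    and irreducible: "\<And>U. vec.subspace U \<Longrightarrow> (\<And>A u. A \<in> T \<Longrightarrow> u \<in> U \<Longrightarrow> A *v u \<in> U) \<Longrightarrow>
      U \<subseteq> vec.span {r \<in> U. \<forall>i. r $ i \<in> \<rat>} \<Longrightarrow> U = {0} \<or> U = UNIV"
    and form: "\<And>A. A \<in> T \<Longrightarrow> transpose A ** G ** A = G"
    and form_rat: "\<And>i j. G $ i $ j \<in> \<rat>"
    and form_invertible: "invertible G"
    and form_alternating: "transpose G = - G"
    and dim: "2 * alg_dim T = CARD('n)"
begin

lemma span_of_eigenvectors_stable:
  assumes "Z \<subseteq> eigenvectors T" "A \<in> T" "u \<in> vec.span Z"
  shows "A *v u \<in> vec.span Z"
  using assms(3)
proof (induction rule: vec.span_induct_alt)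
  case base
  then show ?case by (simp add: vec.span_zero)
next
  case (step c x y)
  obtain e where "A *v x = e *s x" using assms(1,2) step(1) by (auto simp: eigenvectors_def)
  then have "A *v (c *s x + y) = (c * e) *s x + A *v y"
    by (simp add: matrix_vector_right_distrib vector_scalar_commute)
  moreover have "(c * e) *s x + A *v y \<in> vec.span Z"
    using step by (intro vec.span_add vec.span_scale) (auto intro: vec.span_base)
  ultimately show ?case by simp
qed

text \<open>Irreducibility combined with descent. It is applied to the set of all eigenvectors and
  later to the eigenlines reached from a given one by conjugation.\<close>

lemma span_stable_eigenvectors:
  assumes "Z \<subseteq> eigenvectors T" "z0 \<in> Z"
    and "\<And>z. z \<in> Z \<Longrightarrow> \<exists>Y. finite Y \<and> (\<forall>F \<sigma>. field_embedding F \<sigma> \<longrightarrow> Y \<subseteq> F \<longrightarrow>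
      (\<forall>i. z $ i \<in> F) \<longrightarrow> (\<chi> i. \<sigma> (z $ i)) \<in> vec.span Z)"
  shows "vec.span Z = UNIV"
proof -
  have "vec.span Z = {0} \<or> vec.span Z = UNIV"
    using galois_descent_vec[OF assms(3)] span_of_eigenvectors_stable[OF assms(1)]
    by (intro irreducible) auto
  moreover have "z0 \<in> vec.span Z" "z0 \<noteq> 0"
    using assms(1,2) by (auto simp: eigenvectors_def vec.span_base)
  ultimately show ?thesis by blast
qed

lemma span_eigenvectors: "vec.span (eigenvectors T) = UNIV"
proof -
  obtain v where "v \<in> eigenvectors T"
    by (rule common_eigenvector[OF comm]) (auto simp: eigenvectors_def)
  then show ?thesis
  proof (rule span_stable_eigenvectors[OF order_refl])
    fix z assume "z \<in> eigenvectors T"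
    then show "\<exists>Y. finite Y \<and> (\<forall>F \<sigma>. field_embedding F \<sigma> \<longrightarrow> Y \<subseteq> F \<longrightarrow>
      (\<forall>i. z $ i \<in> F) \<longrightarrow> (\<chi> i. \<sigma> (z $ i)) \<in> vec.span (eigenvectors T))"
      using eigenvectors_conj[OF alg] vec.span_base by (intro exI[of _ "{}"]) blast
  qed
qed

lemma eigenbasis:
  obtains P P' :: "complex^'n^'n" where "P ** P' = mat 1" "P' ** P = mat 1"
    "\<And>a. column a P \<in> eigenvectors T"
proof -
  obtain B where B: "B \<subseteq> eigenvectors T" "vec.independent B" "eigenvectors T \<subseteq> vec.span B"
    using vec.maximal_independent_subset by blast
  have span: "vec.span B = UNIV"
    using span_eigenvectors vec.span_minimal[OF B(3) vec.subspace_span] by auto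
  have fin: "finite B" using vec.independent_bound_general[OF B(2)] by simp
  have "card B = vec.dim (UNIV :: (complex^'n) set)"
    using B span by (intro vec.basis_card_eq_dim) auto
  then have "card B = CARD('n)" by (simp only: vec_dim_card)
  then obtain v where v: "bij_betw v (UNIV :: 'n set) B"
    using finite_same_card_bij[OF finite fin] by metis
  define P :: "complex^'n^'n" where "P = (\<chi> i a. v a $ i)"
  have col: "column a P = v a" for a by (simp add: P_def column_def vec_eq_iff)
  have "\<exists>P'. P' ** P = mat 1"
    unfolding matrix_left_invertible_independent_columns
  proof (intro allI impI)
    fix c i assume "(\<Sum>a\<in>UNIV. c a *s column a P) = 0"
    then have "(\<Sum>a\<in>UNIV. c a *s v a) = 0" by (simp add: col)
    then have "(\<Sum>b\<in>B. c (inv_into UNIV v b) *s b) = 0"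
      using v by (subst sum.reindex_bij_betw[OF v, symmetric]) (simp add: bij_betw_def inv_into_f_f)
    then have "c (inv_into UNIV v (v i)) = 0"
      using vec.independentD[OF B(2) fin order_refl, of "\<lambda>b. c (inv_into UNIV v b)" "v i"] v
      by (auto simp: bij_betw_def)
    then show "c i = 0" using v by (simp add: bij_betw_def inv_into_f_f)
  qed
  then obtain P' where P': "P' ** P = mat 1" by blast
  then have "P ** P' = mat 1" using matrix_left_right_inverse by blast
  moreover have "column a P \<in> eigenvectors T" for a using v B(1) by (auto simp: col bij_betw_def)
  ultimately show thesis using that P' by blast
qed

end


section \<open>Characters of the torus\<close>

lemma prod_power_int: "(\<Prod>b\<in>J. f b) powi n = (\<Prod>b\<in>J. f b powi n)"
  for f :: "'b \<Rightarrow> complex"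
  by (induction J rule: infinite_finite_induct) (simp_all add: power_int_mult_distrib)

lemma bilinear_entry:
  "(transpose X ** G ** Y) $ a $ b = (\<Sum>i\<in>UNIV. \<Sum>j\<in>UNIV. X $ i $ a * G $ i $ j * Y $ j $ b)"
  for X Y G :: "complex^'n^'n"
  unfolding matrix_mult_nth[of _ Y] matrix_mult_nth[of _ G] sum_distrib_right transpose_def
  by (subst sum.swap) simp

text \<open>A relation with a nonzero exponent at b0 expresses a power of that character through the
  rest of J.\<close>

lemma torsion_spans_remove:
  assumes nz: "\<And>b A. A \<in> T \<Longrightarrow> ch b A \<noteq> 0" and fin: "finite J"
    and J: "torsion_spans T ch J" and b0: "b0 \<in> J" "m b0 \<noteq> 0"
    and rel: "\<And>A. A \<in> T \<Longrightarrow> (\<Prod>b\<in>J. ch b A powi m b) = 1"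
  shows "torsion_spans T ch (J - {b0})"
proof -
  obtain e c where e: "e > 0"
    and c: "\<And>a A. A \<in> T \<Longrightarrow> ch a A ^ e = (\<Prod>b\<in>J. ch b A powi c a b)"
    using J unfolding torsion_spans_def by blast
  \<comment> \<open>The relation is subtracted with the multiplicity that cancels the exponent at
    b0; the sign keeps the new common exponent \<open>e * nat \<bar>m b0\<bar>\<close>
    positive.\<close>
  define c' where "c' a b = \<bar>m b0\<bar> * c a b - sgn (m b0) * c a b0 * m b" for a b
  have c'0: "c' a b0 = 0" for a by (simp add: c'_def abs_sgn mult_ac)
  have "ch a A ^ (e * nat \<bar>m b0\<bar>) = (\<Prod>b\<in>J - {b0}. ch b A powi c' a b)" if A: "A \<in> T" for a A
  proof -
    have "ch a A ^ (e * nat \<bar>m b0\<bar>) = (\<Prod>b\<in>J. ch b A powi c a b) powi \<bar>m b0\<bar> *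
        (\<Prod>b\<in>J. ch b A powi m b) powi (- (sgn (m b0) * c a b0))"
      unfolding rel[OF A] power_mult c[OF A] by (simp add: power_int_def)
    also have "\<dots> = (\<Prod>b\<in>J. ch b A powi c' a b)"
      unfolding prod_power_int prod.distrib[symmetric] power_int_mult[symmetric]
      using nz[OF A] by (intro prod.cong refl) (simp add: c'_def power_int_add[symmetric] algebra_simps)
    also have "\<dots> = (\<Prod>b\<in>J - {b0}. ch b A powi c' a b)"
      using prod.remove[OF fin b0(1), of "\<lambda>b. ch b A powi c' a b"] by (simp add: c'0)
    finally show ?thesis .
  qed
  moreover have "e * nat \<bar>m b0\<bar> > 0" using e b0 by simp
  ultimately show ?thesis unfolding torsion_spans_def by blast
qed

locale split_torus = irreducible_torus +
  fixes P P' :: "complex^'n^'n"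
  assumes PP': "P ** P' = mat 1" and P'P: "P' ** P = mat 1"
    and columns: "\<And>a. column a P \<in> eigenvectors T"
begin

definition ch :: "'n \<Rightarrow> complex^'n^'n \<Rightarrow> complex" where
  "ch a A = (SOME c. A *v column a P = c *s column a P)"

definition hat :: "complex^'n^'n \<Rightarrow> complex^'n^'n" where
  "hat X = P' ** X ** P"

text \<open>The Gram matrix of the form in the eigenbasis.\<close>

definition q :: "complex^'n^'n" where
  "q = transpose P ** G ** P"

lemma ch: "A \<in> T \<Longrightarrow> A *v column a P = ch a A *s column a P"
  unfolding ch_def by (rule someI_ex) (use columns in \<open>auto simp: eigenvectors_def\<close>)

lemma mult_P_nth: "(X ** P) $ i $ a = (X *v column a P) $ i"
  by (simp add: matrix_mult_nth matrix_vector_nth column_def)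

lemma T_mult_P: "A \<in> T \<Longrightarrow> (A ** P) $ i $ a = ch a A * P $ i $ a"
  by (simp add: mult_P_nth ch) (simp add: column_def)

lemma hat_T: assumes "A \<in> T" shows "hat A $ a $ b = (if a = b then ch a A else 0)"
proof -
  have "hat A $ a $ b = ch b A * (P' ** P) $ a $ b"
    unfolding hat_def matrix_mul_assoc[symmetric] matrix_mult_nth[of P']
    using assms by (simp add: T_mult_P sum_distrib_left mult_ac)
  then show ?thesis by (simp add: P'P mat_def)
qed

lemma unhat: "P ** hat X ** P' = X"
  unfolding hat_def by (metis PP' matrix_mul_assoc matrix_mul_lid matrix_mul_rid)

lemma T_entry: assumes "A \<in> T" shows "A $ i $ j = (\<Sum>a\<in>UNIV. (P $ i $ a * P' $ a $ j) * ch a A)"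
proof -
  have "(P ** hat A) $ i $ a = P $ i $ a * ch a A" for a
    using assms by (simp add: matrix_mult_nth hat_T if_distrib cong: if_cong)
  then have "(P ** hat A ** P') $ i $ j = (\<Sum>a\<in>UNIV. (P $ i $ a * P' $ a $ j) * ch a A)"
    unfolding matrix_mult_nth[of _ P'] by (simp add: mult_ac)
  then show ?thesis by (simp add: unhat)
qed

lemma ch_nonzero: assumes "A \<in> T" shows "ch a A \<noteq> 0"
proof
  assume "ch a A = 0"
  then have "A *v column a P = 0" using ch[OF assms] by simp
  moreover obtain B where "B ** A = mat 1"
    using alg assms by (auto simp: rat_algebraic_group_def invertible_def)
  ultimately have "column a P = 0"
    by (metis matrix_vector_mul_assoc matrix_vector_mul_lid matrix_vector_mult_0_right)
  then show False using columns by (auto simp: eigenvectors_def)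
qed

lemma q_skew: "q $ a $ b = - q $ b $ a"
proof -
  have "transpose q = - q"
    unfolding q_def by (simp add: matrix_transpose_mul form_alternating matrix_mul_assoc)
      (simp add: vec_eq_iff matrix_mult_nth sum_negf)
  then have "transpose q $ b $ a = - q $ b $ a" by simp
  then show ?thesis by (simp add: transpose_def)
qed

lemma q_characters: assumes "q $ a $ b \<noteq> 0" "A \<in> T" shows "ch a A * ch b A = 1"
proof -
  have "q = transpose (A ** P) ** G ** (A ** P)"
    unfolding q_def by (subst form[OF assms(2), symmetric]) (simp add: matrix_transpose_mul matrix_mul_assoc)
  then have "q $ a $ b = (transpose (A ** P) ** G ** (A ** P)) $ a $ b"
    by (rule arg_cong)
  also have "\<dots> = (\<Sum>i\<in>UNIV. \<Sum>j\<in>UNIV. (A ** P) $ i $ a * G $ i $ j * (A ** P) $ j $ b)"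
    by (rule bilinear_entry)
  also have "\<dots> = (\<Sum>i\<in>UNIV. \<Sum>j\<in>UNIV. (ch a A * ch b A) * (P $ i $ a * G $ i $ j * P $ j $ b))"
    using assms(2) by (simp add: T_mult_P mult_ac)
  also have "\<dots> = (ch a A * ch b A) * q $ a $ b"
    by (simp add: q_def bilinear_entry sum_distrib_left)
  finally have "q $ a $ b = (ch a A * ch b A) * q $ a $ b" .
  then show ?thesis using assms(1) by simp
qed

text \<open>Some term of the Leibniz formula for the determinant is nonzero. A bijection is wanted
  for comparing cardinalities, at a stage where q may still pair an index with several
  others.\<close>

lemma q_permutation: obtains \<pi> where "\<pi> permutes (UNIV :: 'n set)" "\<And>a. q $ a $ \<pi> a \<noteq> 0"
proof -
  have "invertible P" unfolding invertible_def using PP' P'P by blast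
  then have "det q \<noteq> 0"
    using form_invertible by (simp add: q_def det_mul det_transpose invertible_det_nz)
  then obtain \<pi> where "\<pi> permutes UNIV" "of_int (sign \<pi>) * (\<Prod>a\<in>UNIV. q $ a $ \<pi> a) \<noteq> 0"
    unfolding det_def using sum.not_neutral_contains_not_neutral by blast
  then show thesis using that by auto
qed

text \<open>
  A minimal set J of characters that generates all of them up to torsion has at least half the
  size of the basis, by the dimension of T; it is disjoint from its image under a duality
  permutation, so both are complementary halves and no relations are left.
\<close>

lemma basis_characters:
  obtains J \<pi> where "\<pi> permutes (UNIV :: 'n set)" "\<And>a. q $ a $ \<pi> a \<noteq> 0"
    "J \<inter> \<pi> ` J = {}" "J \<union> \<pi> ` J = UNIV"
    "\<forall>m. (\<forall>A\<in>T. (\<Prod>b\<in>J. ch b A powi m b) = 1) \<longrightarrow> (\<forall>b\<in>J. m b = 0)"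
proof -
  obtain \<pi> where \<pi>: "\<pi> permutes (UNIV :: 'n set)" "\<And>a. q $ a $ \<pi> a \<noteq> 0"
    using q_permutation by blast
  have "torsion_spans T ch UNIV"
    unfolding torsion_spans_def
    by (intro exI[of _ 1] conjI exI[of _ "\<lambda>a b. if a = b then 1 else 0"])
      (auto simp: if_distrib cong: if_cong)
  then obtain J where J: "torsion_spans T ch J"
    and min: "\<And>K. torsion_spans T ch K \<Longrightarrow> card J \<le> card K"
    using arg_min_nat_lemma[of "torsion_spans T ch" UNIV card] by blast
  have ind: "m b = 0" if rel: "\<And>A. A \<in> T \<Longrightarrow> (\<Prod>b\<in>J. ch b A powi m b) = 1" and b: "b \<in> J" for m b
  proof (rule ccontr)
    assume "m b \<noteq> 0"
    then have "torsion_spans T ch (J - {b})"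
      using torsion_spans_remove[OF ch_nonzero _ J b _ rel] by simp
    then show False using min[of "J - {b}"] b card_Diff1_less[of J b] by simp
  qed
  have disj: "J \<inter> \<pi> ` J = {}"
  proof (rule ccontr)
    assume "J \<inter> \<pi> ` J \<noteq> {}"
    then obtain a where a: "a \<in> J" "\<pi> a \<in> J" by blast
    \<comment> \<open>The exponents of the duality relation. They are added as indicators, so that
      the case \<open>\<pi> a = a\<close> gives exponent 2 and is excluded as well.\<close>
    define m :: "'n \<Rightarrow> int" where "m b = (if b = a then 1 else 0) + (if b = \<pi> a then 1 else 0)" for b
    have "(\<Prod>b\<in>J. ch b A powi m b) = 1" if A: "A \<in> T" for A
    proof -
      have "(\<Prod>b\<in>J. ch b A powi m b) = (\<Prod>b\<in>J. (if b = a then ch b A else 1) * (if b = \<pi> a then ch b A else 1))"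
        using ch_nonzero[OF A] by (intro prod.cong) (auto simp: m_def power_int_add)
      also have "\<dots> = ch a A * ch (\<pi> a) A" using a by (simp add: prod.distrib)
      finally show ?thesis using q_characters[OF \<pi>(2) A] by simp
    qed
    from ind[OF this a(1)] show False by (simp add: m_def split: if_splits)
  qed
  have "card (\<pi> ` J) = card J" using \<pi>(1) by (intro card_image) (metis inj_on_subset permutes_inj subset_UNIV)
  then have "card (J \<union> \<pi> ` J) = 2 * card J" using disj by (simp add: card_Un_disjoint)
  moreover have "CARD('n) \<le> 2 * card J"
    using alg_dim_le[OF ch_nonzero T_entry J] dim by simp
  ultimately have "J \<union> \<pi> ` J = UNIV"
    using card_mono[of UNIV "J \<union> \<pi> ` J"] by (intro card_subset_eq) auto
  then show thesis using that[OF \<pi> disj] ind by blast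
qed

text \<open>J and its image under \<pi> are complementary, so \<pi> on J and its inverse on the
  other half form an involution. Since \<open>ch (\<pi> b)\<close> is inverse to
  \<open>ch b\<close>, a relation between all characters becomes one on J with exponents
  \<open>m b - m (\<pi> b)\<close>, and these must vanish.\<close>

lemma bar_exists: "\<exists>bar. \<forall>a. bar (bar a) = a \<and> bar a \<noteq> a \<and> q $ a $ bar a \<noteq> 0 \<and>
    (\<forall>m. (\<forall>A\<in>T. (\<Prod>x\<in>UNIV. ch x A powi m x) = 1) \<longrightarrow> m a = m (bar a))"
proof -
  obtain J \<pi> where \<pi>: "\<pi> permutes (UNIV :: 'n set)" "\<And>a. q $ a $ \<pi> a \<noteq> 0"
    and J: "J \<inter> \<pi> ` J = {}" "J \<union> \<pi> ` J = UNIV"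
    and ind: "\<forall>m. (\<forall>A\<in>T. (\<Prod>b\<in>J. ch b A powi m b) = 1) \<longrightarrow> (\<forall>b\<in>J. m b = 0)"
    by (rule basis_characters) (rule that)
  have inj: "inj \<pi>" using \<pi>(1) permutes_inj by blast
  define bar where "bar a = (if a \<in> J then \<pi> a else inv \<pi> a)" for a
  have barJ: "bar a = \<pi> a" "bar (\<pi> a) = a" if "a \<in> J" for a
    using that J(1) inj by (auto simp: bar_def)
  have moved: "\<pi> a \<noteq> a" if "a \<in> J" for a
    using that J(1) by (metis IntI empty_iff imageI)
  have cases: "a \<in> J \<or> (\<exists>j\<in>J. a = \<pi> j)" for a using J(2) by blast
  have rel: "m b = m (bar b)" if m: "\<forall>A\<in>T. (\<Prod>x\<in>UNIV. ch x A powi m x) = 1" and b: "b \<in> J"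
    for m :: "'n \<Rightarrow> int" and b
  proof -
    have "(\<Prod>b\<in>J. ch b A powi (m b - m (\<pi> b))) = 1" if A: "A \<in> T" for A
    proof -
      have "(\<Prod>x\<in>UNIV. ch x A powi m x) = (\<Prod>x\<in>J. ch x A powi m x) * (\<Prod>x\<in>\<pi> ` J. ch x A powi m x)"
        unfolding J(2)[symmetric] using J(1) by (intro prod.union_disjoint) auto
      also have "(\<Prod>x\<in>\<pi> ` J. ch x A powi m x) = (\<Prod>b\<in>J. ch (\<pi> b) A powi m (\<pi> b))"
        using inj by (subst prod.reindex) (auto intro: inj_on_subset)
      also have "\<dots> = (\<Prod>b\<in>J. ch b A powi (- m (\<pi> b)))"
      proof (rule prod.cong[OF refl])
        fix b
        have "ch (\<pi> b) A = inverse (ch b A)"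
          using q_characters[OF \<pi>(2)[of b] A] by (metis inverse_unique)
        then show "ch (\<pi> b) A powi m (\<pi> b) = ch b A powi (- m (\<pi> b))"
          by (simp add: power_int_minus power_int_inverse)
      qed
      finally show ?thesis
        using m A ch_nonzero[OF A] by (simp add: prod.distrib[symmetric] power_int_add[symmetric])
    qed
    then show ?thesis using ind barJ b by fastforce
  qed
  show ?thesis
  proof (intro exI[of _ bar] allI conjI impI)
    fix a
    consider "a \<in> J" | j where "j \<in> J" "a = \<pi> j" using cases by blast
    note split = this
    show "bar (bar a) = a" by (cases rule: split) (simp_all add: barJ)
    show "bar a \<noteq> a" by (cases rule: split) (use barJ moved in force)+
    show "q $ a $ bar a \<noteq> 0"
    proof (cases rule: split)
      case 1
      then show ?thesis using \<pi>(2) barJ by simp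
    next
      case (2 j)
      then show ?thesis using \<pi>(2)[of j] barJ q_skew[of a "bar a"] by simp
    qed
    fix m assume "\<forall>A\<in>T. (\<Prod>x\<in>UNIV. ch x A powi m x) = 1"
    note r = rel[OF this]
    show "m a = m (bar a)"
    proof (cases rule: split)
      case 1
      then show ?thesis by (rule r)
    next
      case (2 j)
      then show ?thesis using r[OF 2(1)] barJ by simp
    qed
  qed
qed

definition bar :: "'n \<Rightarrow> 'n" where
  "bar = (SOME bar. \<forall>a. bar (bar a) = a \<and> bar a \<noteq> a \<and> q $ a $ bar a \<noteq> 0 \<and>
    (\<forall>m. (\<forall>A\<in>T. (\<Prod>x\<in>UNIV. ch x A powi m x) = 1) \<longrightarrow> m a = m (bar a)))"

lemma bar_bar [simp]: "bar (bar a) = a"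
  and bar_neq [simp]: "bar a \<noteq> a" "a \<noteq> bar a"
  and q_bar: "q $ a $ bar a \<noteq> 0"
  and character_relation: "(\<And>A. A \<in> T \<Longrightarrow> (\<Prod>x\<in>UNIV. ch x A powi m x) = 1) \<Longrightarrow> m a = m (bar a)"
  using someI_ex[OF bar_exists] unfolding bar_def[symmetric] by (blast, metis, metis, metis, blast)

lemma prod_powi_single: "(\<Prod>x\<in>UNIV. ch x A powi (if x = a then 1 else 0)) = ch a A"
proof -
  have "(\<Prod>x\<in>UNIV. ch x A powi (if x = a then 1 else 0)) = (\<Prod>x\<in>UNIV. if x = a then ch x A else 1)"
    by (intro prod.cong) auto
  then show ?thesis by simp
qed

text \<open>Equality of the weights of the positions (a, b) and (c, d) is a relation between
  characters, so its exponents must be symmetric under \<open>bar\<close>. Comparing them at a and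
  at b leaves only the two alternatives.\<close>

lemma weights_eq:
  assumes ab: "a \<noteq> b" and eq: "\<And>A. A \<in> T \<Longrightarrow> ch a A * ch d A = ch c A * ch b A"
  shows "(c = a \<and> d = b) \<or> (c = bar b \<and> d = bar a)"
proof -
  define \<delta> :: "'n \<Rightarrow> 'n \<Rightarrow> int" where "\<delta> y x = (if x = y then 1 else 0)" for x y
  define m where "m x = \<delta> a x + \<delta> d x - \<delta> c x - \<delta> b x" for x
  have "(\<Prod>x\<in>UNIV. ch x A powi m x) = 1" if A: "A \<in> T" for A
  proof -
    have "(\<Prod>x\<in>UNIV. ch x A powi m x) = (\<Prod>x\<in>UNIV. ch x A powi \<delta> a x) * (\<Prod>x\<in>UNIV. ch x A powi \<delta> d x) /
        (\<Prod>x\<in>UNIV. ch x A powi \<delta> c x) / (\<Prod>x\<in>UNIV. ch x A powi \<delta> b x)"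
      unfolding m_def prod.distrib[symmetric] prod_dividef[symmetric]
      using ch_nonzero[OF A] by (intro prod.cong refl) (simp add: power_int_add power_int_diff)
    then show ?thesis
      using eq[OF A] ch_nonzero[OF A] by (simp add: \<delta>_def prod_powi_single)
  qed
  from character_relation[of m, OF this] have m: "m x = m (bar x)" for x .
  have inj: "bar x = bar y \<longleftrightarrow> x = y" for x y by (metis bar_bar)
  have swap: "bar x = y \<longleftrightarrow> x = bar y" for x y by auto
  show ?thesis
    using m[of a] m[of b] ab inj swap unfolding m_def \<delta>_def by (auto split: if_splits)
qed

lemma ch_inj: assumes "\<And>A. A \<in> T \<Longrightarrow> ch a A = ch b A" shows "a = b"
proof (rule ccontr)
  assume "a \<noteq> b"
  from weights_eq[OF this, of "b" "b"] assms have "(b = a \<and> b = b) \<or> (b = bar b \<and> b = bar a)"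
    by (simp add: mult.commute)
  then show False using \<open>a \<noteq> b\<close> by auto
qed

lemma ch_bar: "A \<in> T \<Longrightarrow> ch a A * ch (bar a) A = 1"
  using q_characters[OF q_bar] .

lemma q_nonzero_iff: "q $ a $ b \<noteq> 0 \<longleftrightarrow> b = bar a"
proof
  assume "q $ a $ b \<noteq> 0"
  have "ch b A = ch (bar a) A" if "A \<in> T" for A
    using q_characters[OF \<open>q $ a $ b \<noteq> 0\<close> that] ch_bar[OF that, of a] ch_nonzero[OF that]
    by (metis mult_cancel_left)
  then show "b = bar a" by (rule ch_inj)
qed (simp add: q_bar)

text \<open>The characters are pairwise distinct, so a common eigenvector has only one nonzero
  coordinate in the eigenbasis.\<close>

lemma eigenvector_is_column:
  assumes v: "v \<in> eigenvectors T"
  obtains b c where "c \<noteq> 0" "v = c *s column b P"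
proof -
  define u where "u = P' *v v"
  have Pu: "P *v u = v" by (simp add: u_def matrix_vector_mul_assoc PP')
  have uniq: "a = b" if ab: "u $ a \<noteq> 0" "u $ b \<noteq> 0" for a b
  proof (rule ch_inj)
    fix A assume A: "A \<in> T"
    then obtain e where e: "A *v v = e *s v" using v by (auto simp: eigenvectors_def)
    have "hat A *v u = P' *v (A *v v)"
      by (simp add: hat_def u_def matrix_vector_mul_assoc) (metis PP' matrix_mul_assoc matrix_mul_rid)
    then have "hat A *v u = e *s u" by (simp add: e u_def vector_scalar_commute)
    moreover have "(hat A *v u) $ x = ch x A * u $ x" for x
      using A by (simp add: matrix_vector_nth hat_T if_distrib if_distribR cong: if_cong)
    ultimately have "ch x A * u $ x = e * u $ x" for x by (metis vector_smult_component)
    then show "ch a A = ch b A" using ab by (metis mult_right_cancel)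
  qed
  have "u \<noteq> 0" using Pu v by (auto simp: eigenvectors_def)
  then obtain b where b: "u $ b \<noteq> 0" by (auto simp: vec_eq_iff)
  have "P *v u = u $ b *s column b P"
  proof -
    have "P *v u = (\<Sum>a\<in>UNIV. if a = b then u $ b *s column b P else 0)"
      unfolding matrix_mult_sum using uniq[OF _ b] by (intro sum.cong) auto
    then show ?thesis by simp
  qed
  then have "v = u $ b *s column b P" using Pu by simp
  then show thesis by (rule that[OF b])
qed

end


section \<open>Root vectors\<close>

text \<open>The coefficients c are those that arise when the weights are eliminated one at a time.\<close>

lemma (in vector_space) weight_components:
  assumes U: "subspace U" and fin: "finite K"
    and stable: "\<And>t c. t \<in> T \<Longrightarrow> (\<Sum>k\<in>K. scale (c k) (f k)) \<in> U \<Longrightarrow> (\<Sum>k\<in>K. scale (\<psi> k t * c k) (f k)) \<in> U"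
    and sep: "\<And>k k'. k \<in> K \<Longrightarrow> k' \<in> K \<Longrightarrow> k \<noteq> k' \<Longrightarrow> \<exists>t\<in>T. \<psi> k t \<noteq> \<psi> k' t"
    and sum: "(\<Sum>k\<in>K. f k) \<in> U" and k: "k \<in> K"
  shows "f k \<in> U"
proof -
  have "f k0 \<in> U" if "(\<Sum>k\<in>K. scale (c k) (f k)) \<in> U" "k0 \<in> K" "c k0 \<noteq> 0" for c k0
    using that
  proof (induction "card {k \<in> K. c k \<noteq> 0}" arbitrary: c rule: less_induct)
    case less
    show ?case
    proof (cases "\<exists>k'\<in>K. k' \<noteq> k0 \<and> c k' \<noteq> 0")
      case True
      then obtain k' where k': "k' \<in> K" "k' \<noteq> k0" "c k' \<noteq> 0" by blast
      obtain t where t: "t \<in> T" "\<psi> k0 t \<noteq> \<psi> k' t" using sep[of k0 k'] k' less.prems by auto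
      \<comment> \<open>Acting by t and subtracting its eigenvalue at k' kills that component and
        keeps the one at k0.\<close>
      define c' where "c' k = (\<psi> k t - \<psi> k' t) * c k" for k
      have "(\<Sum>k\<in>K. scale (c' k) (f k)) = (\<Sum>k\<in>K. scale (\<psi> k t * c k) (f k)) - scale (\<psi> k' t) (\<Sum>k\<in>K. scale (c k) (f k))"
        by (simp add: c'_def left_diff_distrib scale_left_diff_distrib sum_subtractf scale_sum_right)
      then have "(\<Sum>k\<in>K. scale (c' k) (f k)) \<in> U"
        using stable[OF t(1) less.prems(1)] less.prems(1) U by (auto intro: subspace_diff subspace_scale)
      moreover have "{k \<in> K. c' k \<noteq> 0} \<subset> {k \<in> K. c k \<noteq> 0}"
        using k' by (auto simp: c'_def)
      then have "card {k \<in> K. c' k \<noteq> 0} < card {k \<in> K. c k \<noteq> 0}"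
        using fin by (intro psubset_card_mono) auto
      moreover have "c' k0 \<noteq> 0" using less.prems t(2) by (simp add: c'_def)
      ultimately show ?thesis
        using less.hyps less.prems(2) by blast
    next
      case False
      have "(\<Sum>k\<in>K. scale (c k) (f k)) = (\<Sum>k\<in>K. if k = k0 then scale (c k0) (f k0) else 0)"
        using False by (intro sum.cong) auto
      then have "scale (c k0) (f k0) \<in> U" using less.prems fin by simp
      then have "scale (inverse (c k0)) (scale (c k0) (f k0)) \<in> U" by (rule subspace_scale[OF U])
      then show ?thesis using less.prems by simp
    qed
  qed
  from this[of "\<lambda>_. 1"] show ?thesis using sum k by simp
qed

section \<open>Nilpotent matrices on stable subspaces\<close>

lemma mat_power_Suc_right: "mat_power A (Suc k) = mat_power A k ** A"
proof (induction k)
  case (Suc k)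
  then show ?case by (metis mat_power.simps(2) matrix_mul_assoc)
qed simp

text \<open>The dimension of the image drops at each application: if A mapped U onto itself, every u
  in U would lie in the image of the zero matrix \<open>mat_power A m\<close>.\<close>

lemma nilpotent_on_subspace:
  fixes A :: "complex^'n^'n"
  assumes nil: "mat_power A m = 0"
  shows "vec.subspace U \<Longrightarrow> (\<And>u. u \<in> U \<Longrightarrow> A *v u \<in> U) \<Longrightarrow> vec.dim U \<le> k \<Longrightarrow> u \<in> U \<Longrightarrow>
    mat_power A k *v u = 0"
proof (induction k arbitrary: U u)
  case 0
  then have "U \<subseteq> {0}" by (simp add: vec.dim_eq_0)
  then show ?case using 0 by auto
next
  case (Suc k)
  let ?W = "(*v) A ` U"
  have W: "vec.subspace ?W"
    using Suc.prems(1) by (rule vec.linear_subspace_image[OF matrix_vector_mul_linear_gen])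
  have WU: "?W \<subseteq> U" using Suc.prems(2) by blast
  show ?case
  proof (cases "vec.dim ?W \<le> k")
    case True
    have "mat_power A k *v (A *v u) = 0"
      by (rule Suc.IH[OF W _ True]) (use Suc.prems WU in auto)
    then show ?thesis
      unfolding mat_power_Suc_right by (simp add: matrix_vector_mul_assoc)
  next
    case False
    then have "?W = U"
      using vec.dim_subset[OF WU] Suc.prems(3) by (intro vec.subspace_dim_equal W WU Suc.prems(1)) simp
    have "\<exists>x\<in>U. u = mat_power A j *v x" for j
    proof (induction j)
      case (Suc j)
      then obtain x where x: "x \<in> U" "u = mat_power A j *v x" by blast
      then obtain y where "y \<in> U" "x = A *v y" using \<open>?W = U\<close> by blast
      then show ?case using x unfolding mat_power_Suc_right
        by (intro bexI[of _ y]) (simp_all add: matrix_vector_mul_assoc)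
    qed (use Suc.prems in auto)
    from this[of m] have "u = 0" by (auto simp: nil)
    then show ?thesis by simp
  qed
qed

locale lie_over_torus = split_torus T G P P'
  for T :: "(complex^'n^'n) set" and G P P' +
  fixes M :: "(complex^'n^'n) set"
  assumes algM: "rat_algebraic_group M" and TM: "T \<subseteq> M"
    and formM: "\<And>A. A \<in> M \<Longrightarrow> transpose A ** G ** A = G"
begin

definition hat_lie :: "(complex^'n^'n) set" where
  "hat_lie = hat ` tangent M"

lemma hat_mult: "hat (X ** Y) = hat X ** hat Y"
  unfolding hat_def by (metis PP' matrix_mul_assoc matrix_mul_rid)

lemma hat_add: "hat (X + Y) = hat X + hat Y"
  by (simp add: hat_def matrix_add_ldistrib matrix_add_rdistrib)

lemma hat_cscale: "hat (cscale c X) = cscale c (hat X)"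
  by (simp add: hat_def matrix_mult_cscale_left matrix_mult_cscale_right)

lemma hat_diff: "hat (X - Y) = hat X - hat Y"
  using hat_add[of "X - Y" Y] by (simp add: algebra_simps)

lemma subspace_hat_lie: "cmat.subspace hat_lie"
proof (rule cmat.subspaceI)
  note sub = subspace_tangent[of M]
  have "hat 0 = 0" by (simp add: hat_def)
  then show "0 \<in> hat_lie" using cmat.subspace_0[OF sub] unfolding hat_lie_def by (metis imageI)
  show "x + y \<in> hat_lie" if "x \<in> hat_lie" "y \<in> hat_lie" for x y
    using that cmat.subspace_add[OF sub] unfolding hat_lie_def by (auto simp flip: hat_add)
  show "cscale c x \<in> hat_lie" if "x \<in> hat_lie" for x c
    using that cmat.subspace_scale[OF sub] unfolding hat_lie_def by (auto simp flip: hat_cscale)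
qed

lemma hat_lie_bracket: "x \<in> hat_lie \<Longrightarrow> y \<in> hat_lie \<Longrightarrow> y ** x - x ** y \<in> hat_lie"
  using tangent_bracket[OF algM] unfolding hat_lie_def by (auto simp flip: hat_mult hat_diff)

lemma q_zero: "k \<noteq> bar b \<Longrightarrow> q $ k $ b = 0" "k \<noteq> a \<Longrightarrow> q $ bar a $ k = 0"
  using q_nonzero_iff[of k b] q_nonzero_iff[of "bar a" k] by auto

text \<open>Each row and column of q has a single nonzero entry, so skewness couples the position
  (a, b) with (bar b, bar a) and nothing else. For b = bar a the two positions coincide; these are
  the long roots.\<close>

lemma hat_skew:
  assumes "transpose X ** G + G ** X = 0"
  shows "q $ (bar a) $ a * hat X $ a $ b = q $ b $ (bar b) * hat X $ (bar b) $ (bar a)"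
proof -
  have PX: "P ** hat X = X ** P" unfolding hat_def by (metis PP' matrix_mul_assoc matrix_mul_lid)
  have "transpose (hat X) ** q + q ** hat X = transpose (P ** hat X) ** G ** P + transpose P ** G ** (P ** hat X)"
    by (simp add: q_def matrix_transpose_mul matrix_mul_assoc)
  also have "\<dots> = transpose P ** (transpose X ** G + G ** X) ** P"
    by (simp add: PX matrix_transpose_mul matrix_mul_assoc matrix_add_ldistrib matrix_add_rdistrib)
  finally have "(transpose (hat X) ** q + q ** hat X) $ (bar a) $ b = 0"
    using assms by simp
  moreover have "(transpose (hat X) ** q) $ (bar a) $ b = hat X $ (bar b) $ (bar a) * q $ (bar b) $ b"
  proof -
    have "hat X $ k $ (bar a) * q $ k $ b = (if k = bar b then hat X $ (bar b) $ (bar a) * q $ (bar b) $ b else 0)" for k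
      using q_zero(1)[of k b] by simp
    then have "(\<Sum>k\<in>UNIV. hat X $ k $ (bar a) * q $ k $ b) =
        (\<Sum>k\<in>UNIV. if k = bar b then hat X $ (bar b) $ (bar a) * q $ (bar b) $ b else 0)"
      by (intro sum.cong refl)
    also have "\<dots> = hat X $ (bar b) $ (bar a) * q $ (bar b) $ b" by simp
    finally show ?thesis by (simp add: matrix_mult_nth transpose_def)
  qed
  moreover have "(q ** hat X) $ (bar a) $ b = q $ (bar a) $ a * hat X $ a $ b"
  proof -
    have "q $ (bar a) $ k * hat X $ k $ b = (if k = a then q $ (bar a) $ a * hat X $ a $ b else 0)" for k
      using q_zero(2)[of k a] by simp
    then have "(\<Sum>k\<in>UNIV. q $ (bar a) $ k * hat X $ k $ b) =
        (\<Sum>k\<in>UNIV. if k = a then q $ (bar a) $ a * hat X $ a $ b else 0)"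
      by (intro sum.cong refl)
    also have "\<dots> = q $ (bar a) $ a * hat X $ a $ b" by simp
    finally show ?thesis by (simp add: matrix_mult_nth)
  qed
  ultimately show ?thesis
    using q_skew[of b "bar b"] by (simp add: add_eq_0_iff2 mult.commute)
qed

lemma hat_lie_skew:
  "x \<in> hat_lie \<Longrightarrow> q $ (bar a) $ a * x $ a $ b = q $ b $ (bar b) * x $ (bar b) $ (bar a)"
  using hat_skew tangent_skew[OF algM formM] unfolding hat_lie_def by blast

text \<open>Since T lies in M, its adjoint action preserves the Lie algebra; in the eigenbasis it
  scales each entry by its weight.\<close>

lemma hat_lie_Ad:
  assumes A: "A \<in> T" and x: "x \<in> hat_lie"
  shows "(\<chi> a b. ch a A / ch b A * x $ a $ b) \<in> hat_lie"
proof -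
  obtain X where X: "X \<in> tangent M" "x = hat X" using x by (auto simp: hat_lie_def)
  obtain B where B: "A ** B = mat 1" "B ** A = mat 1"
    using alg A by (auto simp: rat_algebraic_group_def invertible_def)
  have "hat A ** hat B = mat 1"
    unfolding hat_mult[symmetric] B by (simp add: P'P hat_def)
  then have hB: "hat B $ a $ b = (if a = b then inverse (ch b A) else 0)" for a b
  proof -
    assume AB: "hat A ** hat B = mat 1"
    have "(hat A ** hat B) $ a $ b = ch a A * hat B $ a $ b"
      by (simp add: matrix_mult_nth hat_T[OF A] if_distrib if_distribR cong: if_cong)
    then have "ch a A * hat B $ a $ b = (if a = b then 1 else 0)" by (simp add: AB mat_def)
    then show ?thesis using ch_nonzero[OF A, of a] by (auto simp: field_simps split: if_splits)
  qed
  have "(hat A ** x ** hat B) $ a $ b = ch a A / ch b A * x $ a $ b" for a b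
  proof -
    have "(hat A ** x) $ a $ k = ch a A * x $ a $ k" for k
      by (simp add: matrix_mult_nth hat_T[OF A] if_distrib if_distribR cong: if_cong)
    then show ?thesis
      unfolding matrix_mult_nth[of _ "hat B"]
      by (simp add: hB if_distrib if_distribR divide_inverse mult_ac cong: if_cong)
  qed
  then have "(\<chi> a b. ch a A / ch b A * x $ a $ b) = hat (A ** X ** B)"
    by (simp add: vec_eq_iff hat_mult X(2))
  moreover have "A ** X ** B \<in> tangent M"
    using A TM by (intro tangent_Ad[OF algM X(1) _ B]) auto
  ultimately show ?thesis by (simp add: hat_lie_def)
qed

text \<open>A T-stable space contains the weight components of its elements, and by
  \<open>weights_eq\<close> a nondiagonal weight occurs only at the two coupled positions.\<close>

lemma hat_lie_component:
  assumes x: "x \<in> hat_lie" and ab: "a \<noteq> b"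
  shows "(\<chi> c d. if (c = a \<and> d = b) \<or> (c = bar b \<and> d = bar a) then x $ c $ d else 0) \<in> hat_lie"
proof -
  \<comment> \<open>Zero off T, so that equality of weights as functions means equality on T and the
    functions can serve as indices.\<close>
  define wt where "wt c d A = (if A \<in> T then ch c A / ch d A else 0)" for c d A
  define K where "K = (\<lambda>(c, d). wt c d) ` UNIV"
  define f where "f k = (\<chi> c d. if wt c d = k then x $ c $ d else 0)" for k
  have fin: "finite K" by (simp add: K_def)
  have "wt c d \<in> K" for c d by (auto simp: K_def)
  then have entry: "(\<Sum>k\<in>K. cscale (e k) (f k)) $ c $ d = e (wt c d) * x $ c $ d" for e c d
    using fin by (simp add: f_def sum_component if_distrib cong: if_cong)
  have "f (wt a b) \<in> hat_lie"
  proof (rule cmat.weight_components[OF subspace_hat_lie fin, where \<psi> = "\<lambda>k. k" and T = T])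
    fix A e assume A: "A \<in> T" and s: "(\<Sum>k\<in>K. cscale (e k) (f k)) \<in> hat_lie"
    have "(\<Sum>k\<in>K. cscale (k A * e k) (f k)) $ c $ d =
        (\<chi> c d. ch c A / ch d A * (\<Sum>k\<in>K. cscale (e k) (f k)) $ c $ d) $ c $ d" for c d
      unfolding vec_lambda_beta entry entry[of "\<lambda>k. k A * e k"] using A by (simp add: wt_def)
    then have "(\<Sum>k\<in>K. cscale (k A * e k) (f k)) =
        (\<chi> c d. ch c A / ch d A * (\<Sum>k\<in>K. cscale (e k) (f k)) $ c $ d)"
      unfolding vec_eq_iff by blast
    then show "(\<Sum>k\<in>K. cscale (k A * e k) (f k)) \<in> hat_lie" using hat_lie_Ad[OF A s] by simp
  next
    fix k k' assume k: "k \<in> K" "k' \<in> K" "k \<noteq> k'"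
    show "\<exists>A\<in>T. k A \<noteq> k' A"
    proof (rule ccontr)
      assume "\<not> ?thesis"
      then have "k A = k' A" for A using k by (cases "A \<in> T") (auto simp: K_def wt_def)
      then show False using k by blast
    qed
  next
    have "(\<Sum>k\<in>K. f k) = x"
      using entry[of "\<lambda>_. 1"] by (simp add: vec_eq_iff)
    then show "(\<Sum>k\<in>K. f k) \<in> hat_lie" using x by simp
  qed (auto simp: K_def)
  moreover have "wt c d = wt a b \<longleftrightarrow> (c = a \<and> d = b) \<or> (c = bar b \<and> d = bar a)" for c d
  proof
    assume eq: "wt c d = wt a b"
    have "ch a A * ch d A = ch c A * ch b A" if A: "A \<in> T" for A
      using fun_cong[OF eq, of A] A ch_nonzero[OF A] by (simp add: wt_def field_simps)
    from weights_eq[OF ab this] show "(c = a \<and> d = b) \<or> (c = bar b \<and> d = bar a)" .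
  next
    have "ch (bar b) A / ch (bar a) A = ch a A / ch b A" if A: "A \<in> T" for A
      using ch_bar[OF A, of a] ch_bar[OF A, of b] ch_nonzero[OF A]
      by (metis divide_divide_eq_right eq_divide_imp mult.commute mult_1 times_divide_eq_left)
    then show "(c = a \<and> d = b) \<or> (c = bar b \<and> d = bar a) \<Longrightarrow> wt c d = wt a b"
      by (auto simp: wt_def fun_eq_iff)
  qed
  ultimately show ?thesis by (simp add: f_def)
qed

text \<open>
  The off-diagonal pairs are the roots of the Lie algebra of M.
  Transitivity also holds along a, b, bar a, because the bracket of two short root vectors that add up to
  a long root does not vanish.
\<close>

definition le :: "'n \<Rightarrow> 'n \<Rightarrow> bool" where
  "le a b \<longleftrightarrow> a = b \<or> (\<exists>x\<in>hat_lie. x $ a $ b \<noteq> 0)"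

lemma le_root_vector:
  assumes "le a b" "a \<noteq> b"
  obtains y where "y \<in> hat_lie" "y $ a $ b \<noteq> 0"
    "\<And>c d. \<not> ((c = a \<and> d = b) \<or> (c = bar b \<and> d = bar a)) \<Longrightarrow> y $ c $ d = 0"
proof -
  obtain x where x: "x \<in> hat_lie" "x $ a $ b \<noteq> 0" using assms by (auto simp: le_def)
  show thesis by (rule that[OF hat_lie_component[OF x(1) assms(2)]]) (use x(2) in auto)
qed

lemma le_trans: assumes "le a b" "le b c" shows "le a c"
proof (cases "a = b \<or> b = c \<or> a = c")
  case False
  then have ne: "a \<noteq> b" "b \<noteq> c" "a \<noteq> c" by auto
  obtain y where y: "y \<in> hat_lie" "y $ a $ b \<noteq> 0"
    and y0: "\<And>c d. \<not> ((c = a \<and> d = b) \<or> (c = bar b \<and> d = bar a)) \<Longrightarrow> y $ c $ d = 0"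
    using le_root_vector[OF assms(1)] False by blast
  obtain z where z: "z \<in> hat_lie" "z $ b $ c \<noteq> 0"
    and z0: "\<And>d e. \<not> ((d = b \<and> e = c) \<or> (d = bar c \<and> e = bar b)) \<Longrightarrow> z $ d $ e = 0"
    using le_root_vector[OF assms(2)] False by blast
  have yz: "(y ** z) $ a $ c = y $ a $ b * z $ b $ c"
  proof -
    have "y $ a $ k * z $ k $ c = (if k = b then y $ a $ b * z $ b $ c else 0)" for k
    proof (cases "k = b")
      case False
      then have "y $ a $ k = 0" by (intro y0) auto
      then show ?thesis using False by simp
    qed simp
    then have "(\<Sum>k\<in>UNIV. y $ a $ k * z $ k $ c) = (\<Sum>k\<in>UNIV. if k = b then y $ a $ b * z $ b $ c else 0)"
      by (intro sum.cong refl)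
    also have "\<dots> = y $ a $ b * z $ b $ c" by simp
    finally show ?thesis by (simp add: matrix_mult_nth)
  qed
  \<comment> \<open>The opposite product reaches (a, c) only through \<open>bar b\<close>, and only
    when c is \<open>bar a\<close>.\<close>
  have zy: "(z ** y) $ a $ c = (if c = bar a then z $ a $ (bar b) * y $ (bar b) $ (bar a) else 0)"
  proof -
    have "z $ a $ k * y $ k $ c =
        (if k = bar b then if c = bar a then z $ a $ (bar b) * y $ (bar b) $ (bar a) else 0 else 0)" for k
    proof (cases "k = bar b \<and> c = bar a")
      case False
      have "z $ a $ k = 0 \<or> y $ k $ c = 0"
      proof (cases "k = bar b")
        case True
        then have "y $ k $ c = 0" using False ne by (intro y0) auto
        then show ?thesis ..
      next
        case False
        then have "z $ a $ k = 0" using ne by (intro z0) auto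
        then show ?thesis ..
      qed
      then show ?thesis using False by auto
    qed simp
    then have "(\<Sum>k\<in>UNIV. z $ a $ k * y $ k $ c) = (\<Sum>k\<in>UNIV. if k = bar b then
        if c = bar a then z $ a $ (bar b) * y $ (bar b) $ (bar a) else 0 else 0)"
      by (intro sum.cong refl)
    also have "\<dots> = (if c = bar a then z $ a $ (bar b) * y $ (bar b) $ (bar a) else 0)" by simp
    finally show ?thesis by (simp add: matrix_mult_nth)
  qed
  have "(y ** z - z ** y) $ a $ c \<noteq> 0"
  proof (cases "c = bar a")
    \<comment> \<open>The short roots (a, b) and (b, bar a) add up to the long root (a, bar a).
      Skewness of y and z turns this entry of \<open>z ** y\<close> into minus that of
      \<open>y ** z\<close>, so the bracket doubles it instead of cancelling it.\<close>
    case True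
    have sy: "q $ (bar a) $ a * y $ a $ b = q $ b $ (bar b) * y $ (bar b) $ (bar a)"
      using hat_lie_skew[OF y(1)] .
    have sz: "q $ (bar a) $ a * z $ a $ (bar b) = q $ (bar b) $ b * z $ b $ (bar a)"
      using hat_lie_skew[OF z(1), of a "bar b"] by simp
    have nz: "q $ (bar a) $ a \<noteq> 0" "q $ b $ (bar b) \<noteq> 0" using q_nonzero_iff by auto
    have "(q $ (bar a) $ a * q $ b $ (bar b)) * (z $ a $ (bar b) * y $ (bar b) $ (bar a)) =
        (q $ (bar a) $ a * z $ a $ (bar b)) * (q $ b $ (bar b) * y $ (bar b) $ (bar a))"
      by (simp add: mult_ac)
    also have "\<dots> = (q $ (bar a) $ a * q $ b $ (bar b)) * - (y $ a $ b * z $ b $ (bar a))"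
      unfolding sz sy[symmetric] using q_skew[of "bar b" b] by (simp add: mult_ac)
    finally have "z $ a $ (bar b) * y $ (bar b) $ (bar a) = - (y $ a $ b * z $ b $ (bar a))"
      using nz by (metis mult_cancel_left mult_eq_0_iff)
    then have "(z ** y) $ a $ c = - (y ** z) $ a $ c" unfolding yz zy using True by simp
    moreover have "(y ** z) $ a $ c \<noteq> 0" using y(2) z(2) by (simp add: yz)
    ultimately show ?thesis by simp
  qed (use y(2) z(2) yz zy in simp)
  then show ?thesis using hat_lie_bracket[OF z(1) y(1)] unfolding le_def by blast
qed (use assms in \<open>auto simp: le_def\<close>)

text \<open>The rational elements span the complex Lie algebra, so one of them is nonzero at (a, b).
  Conjugation leaves rational matrices fixed, which is what its compatibility with \<open>le\<close>
  rests on.\<close>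

lemma le_rational:
  assumes "x \<in> hat_lie" "x $ a $ b \<noteq> 0"
  shows "\<exists>X\<in>rat_lie_algebra M. hat (map_matrix of_rat X) $ a $ b \<noteq> 0"
proof (rule ccontr)
  assume "\<not> ?thesis"
  then have zero: "hat (map_matrix of_rat X) $ a $ b = 0" if "X \<in> rat_lie_algebra M" for X
    using that by blast
  obtain X where X: "X \<in> tangent M" "x = hat X" using assms by (auto simp: hat_lie_def)
  have "X \<in> cmat.span (map_matrix of_rat ` rat_lie_algebra M)"
    using X(1) unfolding lie_complexification_eq_tangent[symmetric] lie_complexification_def .
  then have "hat X $ a $ b = 0"
  proof (induction rule: cmat.span_induct_alt)
    case base
    then show ?case by (simp add: hat_def)
  next
    case (step c x y)
    then show ?case using zero by (auto simp: hat_add hat_cscale)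
  qed
  then show False using assms X by simp
qed

text \<open>Some embedding carries the eigenline of a to that of b. Embeddings of subfields need not
  compose, so only chains of such steps give a transitive relation.\<close>

definition conj_rel :: "'n \<Rightarrow> 'n \<Rightarrow> bool" where
  "conj_rel a b \<longleftrightarrow> (\<exists>F \<sigma> c. field_embedding F \<sigma> \<and> (\<forall>i j. P $ i $ j \<in> F) \<and>
     map_matrix \<sigma> P *v axis a 1 = c *s column b P)"

lemma column_conj: "map_matrix \<sigma> P *v axis a 1 = (\<chi> i. \<sigma> (column a P $ i))"
  by (simp add: vec_eq_iff matrix_vector_nth axis_def column_def if_distrib cong: if_cong)

lemma P'_column: "P' *v column x P = axis x 1"
proof -
  have "(P' *v column x P) $ i = (P' ** P) $ i $ x" for i
    by (simp add: matrix_mult_nth matrix_vector_nth column_def)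
  then show ?thesis by (simp add: P'P vec_eq_iff mat_def axis_def)
qed

text \<open>Conjugate columns of P are eigenvectors, hence nonzero multiples of columns. For a
  rational matrix X this makes the entry (a, b) of \<open>transpose P ** X ** P\<close> conjugate to
  a nonzero multiple of the entry (s a, s b). Such bilinear expressions avoid conjugating
  P'.\<close>

lemma conj_permutation:
  assumes F: "field_embedding F \<sigma>" "\<And>i j. P $ i $ j \<in> F"
  obtains s where "inj s" "\<And>a b. le a b \<Longrightarrow> le (s a) (s b)"
    "\<And>a b c. map_matrix \<sigma> P *v axis a 1 = c *s column b P \<Longrightarrow> s a = b" "\<And>a. conj_rel a (s a)"
proof -
  interpret F: field_embedding F \<sigma> by (rule F(1))
  have "\<exists>b c. c \<noteq> 0 \<and> map_matrix \<sigma> P *v axis a 1 = c *s column b P" for a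
  proof -
    have "map_matrix \<sigma> P *v axis a 1 \<in> eigenvectors T"
      unfolding column_conj using F(2) by (intro eigenvectors_conj[OF alg columns F(1)]) (simp add: column_def)
    then show ?thesis using eigenvector_is_column by metis
  qed
  then obtain s e where se: "\<And>a. e a \<noteq> 0" "\<And>a. map_matrix \<sigma> P *v axis a 1 = e a *s column (s a) P"
    by metis
  have \<sigma>P: "\<sigma> (P $ i $ a) = e a * P $ i $ s a" for i a
    using se(2)[of a, unfolded column_conj] by (simp add: vec_eq_iff column_def)
  have bil: "\<sigma> ((transpose P ** X ** P) $ a $ b) = e a * e b * (transpose P ** X ** P) $ s a $ s b"
    if X: "\<And>i j. X $ i $ j \<in> \<rat>" for X a b
  proof -
    have XF: "X $ i $ j \<in> F" for i j using X F.Rats_mem by blast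
    have "\<sigma> ((transpose P ** X ** P) $ a $ b) =
        (\<Sum>i\<in>UNIV. \<Sum>j\<in>UNIV. \<sigma> (P $ i $ a) * \<sigma> (X $ i $ j) * \<sigma> (P $ j $ b))"
      unfolding bilinear_entry using F(2) XF by (simp add: F.hom_sum F.hom_mult F.mult_mem F.sum_mem)
    also have "\<dots> = (\<Sum>i\<in>UNIV. \<Sum>j\<in>UNIV. e a * e b * (P $ i $ s a * X $ i $ j * P $ j $ s b))"
      using X by (simp add: \<sigma>P F.hom_Rats mult_ac)
    finally show ?thesis by (simp add: bilinear_entry sum_distrib_left)
  qed
  have mem: "(transpose P ** X ** P) $ a $ b \<in> F" if X: "\<And>i j. X $ i $ j \<in> \<rat>" for X a b
    unfolding bilinear_entry using F.Rats_mem[OF X] F(2) by (intro F.sum_mem F.mult_mem) auto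
  have nz: "(transpose P ** X ** P) $ a $ b \<noteq> 0 \<longleftrightarrow> (transpose P ** X ** P) $ s a $ s b \<noteq> 0"
    if X: "\<And>i j. X $ i $ j \<in> \<rat>" for X a b
    using bil[OF X, of a b] F.hom_eq_0_iff[OF mem[OF X, of a b]] se(1) by auto
  \<comment> \<open>X = G shows that s commutes with duality, and injectivity follows because
    \<open>bar\<close> is an involution.\<close>
  have sq: "s b = bar (s a) \<longleftrightarrow> b = bar a" for a b
    using nz[of G a b, OF form_rat] q_nonzero_iff unfolding q_def by metis
  have inj: "inj s"
  proof (rule injI)
    fix a b assume "s a = s b"
    then have "s b = bar (s (bar a))" using sq[where a = "bar a" and b = a] by simp
    then show "a = b" using sq[where a = "bar a" and b = b] by simp
  qed
  show thesis
  proof (rule that[OF inj])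
    fix a b assume ab: "le a b"
    show "le (s a) (s b)"
    proof (cases "a = b")
      case False
      then obtain x where "x \<in> hat_lie" "x $ a $ b \<noteq> 0" using ab by (auto simp: le_def)
      then obtain X where X: "X \<in> rat_lie_algebra M" "hat (map_matrix of_rat X) $ a $ b \<noteq> 0"
        using le_rational by blast
      let ?X = "map_matrix of_rat X :: complex^'n^'n"
      \<comment> \<open>Multiplication by G turns the operator X into a rational bilinear form, to
        which the comparison applies.\<close>
      have GX: "(G ** ?X) $ i $ j \<in> \<rat>" for i j
        unfolding matrix_mult_nth by (intro Rats_sum Rats_mult form_rat) auto
      have *: "(transpose P ** (G ** ?X) ** P) $ bar c $ d = q $ bar c $ c * hat ?X $ c $ d" for c d
      proof -
        have "P ** hat ?X = ?X ** P" unfolding hat_def by (metis PP' matrix_mul_assoc matrix_mul_lid)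
        then have "transpose P ** (G ** ?X) ** P = q ** hat ?X"
          unfolding q_def by (metis matrix_mul_assoc)
        moreover have "q $ (bar c) $ k * hat ?X $ k $ d = (if k = c then q $ (bar c) $ c * hat ?X $ c $ d else 0)" for k
          using q_zero(2)[of k c] by simp
        then have "(\<Sum>k\<in>UNIV. q $ (bar c) $ k * hat ?X $ k $ d) =
            (\<Sum>k\<in>UNIV. if k = c then q $ (bar c) $ c * hat ?X $ c $ d else 0)"
          by (intro sum.cong refl)
        ultimately show ?thesis by (simp add: matrix_mult_nth)
      qed
      have "(transpose P ** (G ** ?X) ** P) $ bar a $ b \<noteq> 0"
        using X(2) q_nonzero_iff[of "bar a" a] by (simp add: *)
      then have "(transpose P ** (G ** ?X) ** P) $ s (bar a) $ s b \<noteq> 0" using nz[OF GX] by simp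
      moreover have "s (bar a) = bar (s a)" using sq[of "bar a" a] by simp
      ultimately have "hat ?X $ s a $ s b \<noteq> 0" by (simp add: *)
      moreover have "hat ?X \<in> hat_lie" using X(1) by (simp add: hat_lie_def rat_lie_algebra_iff)
      ultimately show ?thesis by (auto simp: le_def)
    qed (simp add: le_def)
  next
    fix a b c assume eq: "map_matrix \<sigma> P *v axis a 1 = c *s column b P"
    have "P' *v (e a *s column (s a) P) = P' *v (c *s column b P)" using eq se(2) by simp
    then have "e a *s axis (s a) 1 = c *s (axis b 1 :: complex^'n)"
      by (simp add: vector_scalar_commute P'_column)
    then have "(e a *s axis (s a) 1) $ s a = (c *s (axis b 1 :: complex^'n)) $ s a" by simp
    then show "s a = b" using se(1)[of a] by (simp add: axis_def split: if_splits)
  next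
    show "conj_rel a (s a)" for a unfolding conj_rel_def using F se(2) by blast
  qed
qed


text \<open>The conjugate of a column reachable from a is a multiple of another reachable column.
  The reachable columns therefore span everything, by irreducibility, whereas without b their b-th
  coordinates in the eigenbasis would all vanish.\<close>

lemma conj_transitive: "conj_rel\<^sup>*\<^sup>* a b"
proof (rule ccontr)
  assume not: "\<not> conj_rel\<^sup>*\<^sup>* a b"
  define Z where "Z = {column c P | c. conj_rel\<^sup>*\<^sup>* a c}"
  have "vec.span Z = UNIV"
  proof (rule span_stable_eigenvectors)
    show "Z \<subseteq> eigenvectors T" using columns by (auto simp: Z_def)
    show "column a P \<in> Z" by (auto simp: Z_def)
    fix z assume "z \<in> Z"
    then obtain c where c: "z = column c P" "conj_rel\<^sup>*\<^sup>* a c" by (auto simp: Z_def)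
    define Y where "Y = (\<lambda>(i, j). P $ i $ j) ` UNIV"
    have "(\<chi> i. \<sigma> (z $ i)) \<in> vec.span Z" if F: "field_embedding F \<sigma>" "Y \<subseteq> F" for F \<sigma>
    proof -
      have PF: "P $ i $ j \<in> F" for i j using F(2) by (auto simp: Y_def)
      have "(\<chi> i. \<sigma> (z $ i)) \<in> eigenvectors T"
        unfolding c using PF by (intro eigenvectors_conj[OF alg columns F(1)]) (simp add: column_def)
      then obtain d e where de: "(\<chi> i. \<sigma> (z $ i)) = e *s column d P"
        using eigenvector_is_column by metis
      then have "conj_rel c d"
        unfolding conj_rel_def column_conj using F(1) PF c by blast
      then have "column d P \<in> Z" using c(2) by (auto simp: Z_def intro: rtranclp.rtrancl_into_rtrancl)
      then show ?thesis unfolding de by (intro vec.span_scale vec.span_base)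
    qed
    then show "\<exists>Y. finite Y \<and> (\<forall>F \<sigma>. field_embedding F \<sigma> \<longrightarrow> Y \<subseteq> F \<longrightarrow>
      (\<forall>i. z $ i \<in> F) \<longrightarrow> (\<chi> i. \<sigma> (z $ i)) \<in> vec.span Z)"
      by (intro exI[of _ Y]) (auto simp: Y_def)
  qed
  then have "column b P \<in> vec.span Z" by simp
  then have "(P' *v column b P) $ b = 0"
  proof (induction rule: vec.span_induct_alt)
    case (step c x y)
    then obtain d where "x = column d P" "conj_rel\<^sup>*\<^sup>* a d" by (auto simp: Z_def)
    then have "(P' *v x) $ b = 0" using not by (auto simp: P'_column axis_def)
    then show ?case using step by (simp add: matrix_vector_right_distrib vector_scalar_commute)
  qed simp
  then show False by (simp add: P'_column)
qed

section \<open>Classes of eigenlines and the powers of N\<close>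

definition up_set :: "'n \<Rightarrow> 'n set" where
  "up_set a = {b. le a b}"

lemma card_up_set_le: "card (up_set a) \<le> card (up_set b)"
  using conj_transitive[of a b]
proof induction
  case (step b c)
  from step(2) obtain F \<sigma> e where F: "field_embedding F \<sigma>" "\<And>i j. P $ i $ j \<in> F"
    and e: "map_matrix \<sigma> P *v axis b 1 = e *s column c P"
    by (auto simp: conj_rel_def)
  obtain s where s: "inj s" "\<And>a b. le a b \<Longrightarrow> le (s a) (s b)" "s b = c"
    using conj_permutation[OF F] e by metis
  have "card (up_set b) = card (s ` up_set b)" using s(1) by (metis card_image inj_on_subset subset_UNIV)
  also have "\<dots> \<le> card (up_set c)" using s(2,3) by (intro card_mono) (auto simp: up_set_def)
  finally show ?case using step.IH by simp
qed simp

text \<open>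
  The up-sets all have the same size because conjugation permutes the eigenlines transitively,
  which forces the preorder to be symmetric.
\<close>

lemma le_sym: assumes "le a b" shows "le b a"
proof -
  have "up_set b \<subseteq> up_set a" using assms le_trans by (auto simp: up_set_def)
  then have "up_set b = up_set a" using card_up_set_le by (intro card_subset_eq) (auto intro: antisym)
  then show ?thesis by (auto simp: up_set_def le_def)
qed

lemma hat_mat_power: "hat (mat_power N k) = mat_power (hat N) k"
  by (induction k) (simp_all add: hat_mult, simp add: hat_def P'P)

text \<open>The vectors supported on the class of b form a stable subspace whose dimension is at
  most the size of the class. The nilpotent matrix dies on it after that many steps, and one
  exponent serves all b because the classes have equal size.\<close>

lemma mat_power_vanishes:
  assumes N: "N \<in> tangent M" "mat_power N m = 0"
  shows "mat_power N (card (up_set a)) = 0"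
proof -
  define x where "x = hat N"
  have x: "x \<in> hat_lie" "mat_power x m = 0"
    using N by (auto simp: x_def hat_lie_def simp flip: hat_mat_power) (simp add: hat_def)
  have "mat_power x (card (up_set a)) *v axis b 1 = 0" for b
  proof (rule nilpotent_on_subspace[OF x(2)])
    define U where "U = {v :: complex^'n. \<forall>c. v $ c \<noteq> 0 \<longrightarrow> le b c}"
    show "vec.subspace U"
    proof (rule vec.subspaceI)
      show "u + v \<in> U" if "u \<in> U" "v \<in> U" for u v
        using that unfolding U_def by (auto simp: ) (metis add_0)
    qed (auto simp: U_def)
    show "axis b 1 \<in> U" by (auto simp: U_def axis_def le_def)
    show "x *v v \<in> U" if v: "v \<in> U" for v
      unfolding U_def
    proof (intro CollectI allI impI)
      fix c assume "(x *v v) $ c \<noteq> 0"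
      then obtain d where "x $ c $ d * v $ d \<noteq> 0"
        unfolding matrix_vector_nth using sum.not_neutral_contains_not_neutral by blast
      \<comment> \<open>The nonzero entry relates its row c to its column d; symmetry is needed to
        get from d back to c.\<close>
      then have "le b d" "le c d" using v x(1) by (auto simp: U_def le_def)
      then show "le b c" using le_sym le_trans by blast
    qed
    have "U \<subseteq> vec.span ((\<lambda>c. axis c 1) ` up_set b)"
    proof
      fix v assume v: "v \<in> U"
      have "v = (\<Sum>c\<in>UNIV. v $ c *s axis c 1)" by (simp add: basis_expansion)
      also have "\<dots> = (\<Sum>c\<in>up_set b. v $ c *s axis c 1)"
        using v by (intro sum.mono_neutral_right) (auto simp: U_def up_set_def)
      also have "\<dots> \<in> vec.span ((\<lambda>c. axis c 1) ` up_set b)"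
        by (intro vec.span_sum vec.span_scale vec.span_base) auto
      finally show "v \<in> vec.span ((\<lambda>c. axis c 1) ` up_set b)" .
    qed
    then have "vec.dim U \<le> card ((\<lambda>c. axis c 1 :: complex^'n) ` up_set b)"
      by (intro vec.dim_le_card) auto
    also have "\<dots> \<le> card (up_set b)" by (intro card_image_le) simp
    also have "\<dots> \<le> card (up_set a)" by (rule card_up_set_le)
    finally show "vec.dim U \<le> card (up_set a)" .
  qed
  then have "mat_power x (card (up_set a)) $ i $ b = 0" for i b
  proof -
    have "(mat_power x (card (up_set a)) *v axis b 1) $ i = mat_power x (card (up_set a)) $ i $ b"
      by (simp add: matrix_vector_nth axis_def if_distrib cong: if_cong)
    then show ?thesis using \<open>\<And>b. mat_power x (card (up_set a)) *v axis b 1 = 0\<close> by simp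
  qed
  then have "hat (mat_power N (card (up_set a))) = 0" by (simp add: vec_eq_iff hat_mat_power x_def)
  then show ?thesis using unhat[of "mat_power N (card (up_set a))"] by simp
qed

text \<open>Indices in different classes have disjoint classes of equal size, which then is at most
  half of the dimension and so at most k.\<close>

lemma le_total:
  assumes N: "N \<in> tangent M" "mat_power N m = 0" and k: "mat_power N k \<noteq> 0" "CARD('n) \<le> 2 * k"
  shows "le a b"
proof (rule ccontr)
  assume not: "\<not> le a b"
  have "up_set a \<inter> up_set b = {}"
    unfolding up_set_def using not le_sym le_trans by blast
  then have "card (up_set a) + card (up_set b) \<le> CARD('n)"
    using card_mono[of UNIV "up_set a \<union> up_set b"] by (simp add: card_Un_disjoint)
  then have "2 * card (up_set a) \<le> CARD('n)" using card_up_set_le[of a b] by simp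
  then have "card (up_set a) \<le> k" using k(2) by simp
  then have "mat_power N k = mat_power N (k - card (up_set a)) ** mat_power N (card (up_set a))"
  proof (induction k)
    case (Suc k)
    then show ?case
      by (cases "card (up_set a) = Suc k") (simp_all add: Suc_diff_le matrix_mul_assoc[symmetric])
  qed simp
  then show False using k mat_power_vanishes[OF N] by simp
qed

section \<open>The case in which all roots occur\<close>

context
  assumes total: "\<And>a b. le a b"
begin

text \<open>The matrix is the coroot of the long root (a, bar a), obtained as the bracket of
  opposite root vectors. A long root is coupled only with itself, so these vectors have a single
  nonzero entry. Such coroots span the diagonal part of the symplectic algebra.\<close>

lemma coroot_hat_lie: "(\<chi> c d. if c = d then (if c = a then 1 else 0) - (if c = bar a then 1 else 0) else 0) \<in> hat_lie"
  (is "?E \<in> hat_lie")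
proof -
  obtain y where y: "y \<in> hat_lie" "y $ a $ bar a \<noteq> 0"
    and "\<And>c d. \<not> ((c = a \<and> d = bar a) \<or> (c = bar (bar a) \<and> d = bar a)) \<Longrightarrow> y $ c $ d = 0"
    using le_root_vector[OF total bar_neq(2)] by blast
  then have y0: "y $ c $ d = (if c = a then if d = bar a then y $ a $ bar a else 0 else 0)" for c d by auto
  obtain z where z: "z \<in> hat_lie" "z $ bar a $ a \<noteq> 0"
    and "\<And>c d. \<not> ((c = bar a \<and> d = a) \<or> (c = bar a \<and> d = bar (bar a))) \<Longrightarrow> z $ c $ d = 0"
    using le_root_vector[OF total bar_neq(1)] by blast
  then have z0: "z $ c $ d = (if c = bar a then if d = a then z $ bar a $ a else 0 else 0)" for c d by auto
  define t where "t = y $ a $ bar a * z $ bar a $ a"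
  have yz: "(y ** z) $ c $ d = (if c = a \<and> d = a then t else 0)" for c d
  proof -
    have "(y ** z) $ c $ d = (\<Sum>k\<in>UNIV. if k = bar a then if c = a \<and> d = a then t else 0 else 0)"
      unfolding matrix_mult_nth by (intro sum.cong refl) (subst y0, subst z0, auto simp: t_def)
    then show ?thesis by simp
  qed
  have zy: "(z ** y) $ c $ d = (if c = bar a \<and> d = bar a then t else 0)" for c d
  proof -
    have "(z ** y) $ c $ d = (\<Sum>k\<in>UNIV. if k = a then if c = bar a \<and> d = bar a then t else 0 else 0)"
      unfolding matrix_mult_nth by (intro sum.cong refl) (subst y0, subst z0, auto simp: t_def)
    then show ?thesis by simp
  qed
  have "t \<noteq> 0" using y z by (simp add: t_def)
  then have "?E = cscale (inverse t) (y ** z - z ** y)"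
    by (auto simp: vec_eq_iff yz zy)
  moreover have "cscale (inverse t) (y ** z - z ** y) \<in> hat_lie"
    using hat_lie_bracket[OF z(1) y(1)] by (rule cmat.subspace_scale[OF subspace_hat_lie])
  ultimately show ?thesis by simp
qed

text \<open>Elimination by the number of nonzero entries: a root vector clears an off-diagonal
  position together with its coupled one, and a coroot clears a dual pair on the diagonal.\<close>

lemma skew_hat_lie:
  assumes "\<And>a b. q $ (bar a) $ a * x $ a $ b = q $ b $ (bar b) * x $ (bar b) $ (bar a)"
  shows "x \<in> hat_lie"
  using assms
proof (induction "card {(a, b). x $ a $ b \<noteq> 0}" arbitrary: x rule: less_induct)
  case less
  have step: "x \<in> hat_lie" if y: "y \<in> hat_lie" and sub: "{(a, b). (x - y) $ a $ b \<noteq> 0} \<subset> {(a, b). x $ a $ b \<noteq> 0}" for y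
  proof -
    have "x - y \<in> hat_lie"
    proof (rule less.hyps)
      show "card {(a, b). (x - y) $ a $ b \<noteq> 0} < card {(a, b). x $ a $ b \<noteq> 0}"
        using sub by (intro psubset_card_mono) simp_all
      show "q $ (bar a) $ a * (x - y) $ a $ b = q $ b $ (bar b) * (x - y) $ (bar b) $ (bar a)" for a b
        using less.prems[of a b] hat_lie_skew[OF y, of a b] by (simp add: algebra_simps)
    qed
    from cmat.subspace_add[OF subspace_hat_lie this y] show ?thesis by simp
  qed
  consider (off) a b where "a \<noteq> b" "x $ a $ b \<noteq> 0" | (diag) a where "x $ a $ a \<noteq> 0" "\<forall>a b. a \<noteq> b \<longrightarrow> x $ a $ b = 0"
    | (zero) "x = 0"
  proof (cases "\<exists>a b. a \<noteq> b \<and> x $ a $ b \<noteq> 0")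
    case False
    show ?thesis
    proof (cases "\<exists>a. x $ a $ a \<noteq> 0")
      case True
      then obtain a where "x $ a $ a \<noteq> 0" by blast
      then show ?thesis by (rule diag) (use False in blast)
    next
      case nodiag: False
      show ?thesis by (rule zero) (use False nodiag in \<open>simp add: vec_eq_iff, metis\<close>)
    qed
  next
    case True
    then show ?thesis using off by blast
  qed
  then show ?case
  proof cases
    case (off a b)
    obtain y where y: "y \<in> hat_lie" "y $ a $ b \<noteq> 0"
      and y0: "\<And>c d. \<not> ((c = a \<and> d = b) \<or> (c = bar b \<and> d = bar a)) \<Longrightarrow> y $ c $ d = 0"
      using le_root_vector[OF total off(1)] by blast
    define t where "t = x $ a $ b / y $ a $ b"
    have ab: "x $ a $ b = t * y $ a $ b" using y by (simp add: t_def)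
    \<comment> \<open>Both x and y are skew, so the multiple of y that clears (a, b) clears (bar b,
      bar a) as well.\<close>
    have "q $ b $ bar b * x $ bar b $ bar a = q $ bar a $ a * x $ a $ b"
      by (rule less.prems[symmetric])
    also have "\<dots> = t * (q $ bar a $ a * y $ a $ b)" unfolding ab by (rule mult.left_commute)
    also have "\<dots> = q $ b $ bar b * (t * y $ bar b $ bar a)"
      unfolding hat_lie_skew[OF y(1), of a b] by (rule mult.left_commute)
    finally have "q $ b $ bar b * x $ bar b $ bar a = q $ b $ bar b * (t * y $ bar b $ bar a)" .
    then have ba: "x $ bar b $ bar a = t * y $ bar b $ bar a" using q_bar[of b] by simp
    show ?thesis
    proof (rule step)
      show "cscale t y \<in> hat_lie" by (rule cmat.subspace_scale[OF subspace_hat_lie y(1)])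
      have "(x - cscale t y) $ c $ d = 0" if "x $ c $ d = 0" for c d
        using that ab ba y0[of c d] by (cases "(c = a \<and> d = b) \<or> (c = bar b \<and> d = bar a)") auto
      moreover have "(x - cscale t y) $ a $ b = 0" using ab by simp
      ultimately show "{(c, d). (x - cscale t y) $ c $ d \<noteq> 0} \<subset> {(c, d). x $ c $ d \<noteq> 0}"
        using off(2) by (intro psubsetI) blast+
    qed
  next
    case (diag a)
    define E :: "complex^'n^'n" where
      "E = (\<chi> c d. if c = d then (if c = a then 1 else 0) - (if c = bar a then 1 else 0) else 0)"
    have "q $ bar a $ a * x $ a $ a = q $ bar a $ a * (- x $ bar a $ bar a)"
      using less.prems[of a a] unfolding q_skew[of a "bar a"] by simp
    then have "x $ a $ a = - x $ bar a $ bar a"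
      using q_bar[of "bar a"] by (metis bar_bar mult_left_cancel)
    then have aa: "x $ bar a $ bar a = - x $ a $ a" by simp
    show ?thesis
    proof (rule step)
      show "cscale (x $ a $ a) E \<in> hat_lie"
        unfolding E_def by (rule cmat.subspace_scale[OF subspace_hat_lie coroot_hat_lie])
      have "(x - cscale (x $ a $ a) E) $ c $ d = 0" if "x $ c $ d = 0" for c d
        using that aa diag by (auto simp: E_def)
      moreover have "(x - cscale (x $ a $ a) E) $ a $ a = 0" by (simp add: E_def)
      ultimately show "{(c, d). (x - cscale (x $ a $ a) E) $ c $ d \<noteq> 0} \<subset> {(c, d). x $ c $ d \<noteq> 0}"
        using diag(1) by (intro psubsetI) blast+
    qed
  qed (simp add: cmat.subspace_0[OF subspace_hat_lie])
qed

lemma skew_tangent: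
  assumes "transpose X ** G + G ** X = 0"
  shows "X \<in> tangent M"
proof -
  have "hat X \<in> hat_lie" using hat_skew[OF assms] by (rule skew_hat_lie)
  then obtain Y where "Y \<in> tangent M" "hat X = hat Y" by (auto simp: hat_lie_def)
  then show ?thesis using unhat by metis
qed

end

end


section \<open>Mumford-Tate groups and polarizations\<close>

definition form_matrix :: "(rat^'n \<Rightarrow> rat^'n \<Rightarrow> rat) \<Rightarrow> complex^'n^'n" where
  "form_matrix Q = (\<chi> i j. of_rat (Q (axis i 1) (axis j 1)))"

lemma map_of_rat_mult: "map_matrix of_rat (A ** B) = map_matrix of_rat A ** (map_matrix of_rat B :: complex^'n^'n)"
  by (simp add: vec_eq_iff matrix_matrix_mult_def of_rat_sum of_rat_mult)

lemma map_of_real_mult: "map_matrix of_real (A ** B) = map_matrix of_real A ** (map_matrix of_real B :: complex^'n^'n)"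
  by (simp add: vec_eq_iff matrix_matrix_mult_def)

lemma map_of_rat_power: "map_matrix of_rat (mat_power A k) = (mat_power (map_matrix of_rat A) k :: complex^'n^'n)"
  by (induction k) (simp_all add: map_of_rat_mult, simp add: vec_eq_iff mat_def)

lemma map_of_rat_eq_0_iff: "map_matrix of_rat A = (0 :: complex^'n^'n) \<longleftrightarrow> A = 0"
  by (simp add: vec_eq_iff)

lemma form_expansion:
  fixes Q :: "rat^'n \<Rightarrow> rat^'n \<Rightarrow> rat"
  assumes Q: "polarization_form w Q"
  shows "Q u v = (\<Sum>i\<in>UNIV. \<Sum>j\<in>UNIV. u $ i * v $ j * Q (axis i 1) (axis j 1))"
proof -
  have lin: "f u = (\<Sum>i\<in>UNIV. u $ i * f (axis i 1))" if "Vector_Spaces.linear (*s) (*) f"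
    for f :: "rat^'n \<Rightarrow> rat" and u
  proof -
    interpret Vector_Spaces.linear "(*s)" "(*)" f by (rule that)
    have "f u = f (\<Sum>i\<in>UNIV. u $ i *s axis i 1)" by (simp add: basis_expansion)
    then show ?thesis by (simp add: sum scale)
  qed
  have linear: "Vector_Spaces.linear (*s) (*) (Q u)" "Vector_Spaces.linear (*s) (*) (\<lambda>u. Q u v)" for u v
    using Q unfolding polarization_form_def by blast+
  have "Q u v = (\<Sum>i\<in>UNIV. u $ i * Q (axis i 1) v)" by (rule lin[OF linear(2)])
  also have "\<dots> = (\<Sum>i\<in>UNIV. u $ i * (\<Sum>j\<in>UNIV. v $ j * Q (axis i 1) (axis j 1)))"
    by (intro sum.cong refl arg_cong[where f = "(*) _"] lin[OF linear(1)])
  finally show ?thesis by (simp add: sum_distrib_left mult_ac)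
qed

text \<open>Nondegeneracy is a statement about rational vectors, so the inverse is found over the
  rationals and then mapped to complex matrices.\<close>

lemma form_matrix_invertible:
  fixes Q :: "rat^'n \<Rightarrow> rat^'n \<Rightarrow> rat"
  assumes Q: "polarization_form w Q"
  shows "invertible (form_matrix Q)"
proof -
  define R :: "rat^'n^'n" where "R = (\<chi> i j. Q (axis i 1) (axis j 1))"
  have "x = 0" if x: "transpose R *v x = 0" for x
  proof -
    have "Q x v = 0" for v
    proof -
      have "Q x v = (\<Sum>j\<in>UNIV. v $ j * (transpose R *v x) $ j)"
        unfolding form_expansion[OF Q, of x v]
        by (subst sum.swap) (simp add: matrix_vector_mult_def transpose_def R_def sum_distrib_left mult_ac)
      then show ?thesis unfolding x by simp
    qed
    then show ?thesis using Q unfolding polarization_form_def by blast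
  qed
  then have "\<exists>S. S ** transpose R = mat 1" unfolding matrix_left_invertible_ker by simp
  then obtain S where S: "S ** transpose R = mat 1" by (rule exE)
  then have S': "transpose R ** S = mat 1" using matrix_left_right_inverse by blast
  have G: "map_matrix of_rat R = form_matrix Q" by (simp add: vec_eq_iff R_def form_matrix_def)
  have tr: "R ** transpose S = mat 1" "transpose S ** R = mat 1"
    using arg_cong[OF S, of transpose] arg_cong[OF S', of transpose]
    by (simp_all add: matrix_transpose_mul transpose_mat)
  have one: "map_matrix of_rat (mat 1) = (mat 1 :: complex^'n^'n)" by (simp add: vec_eq_iff mat_def)
  show ?thesis
    unfolding invertible_def
    using map_of_rat_mult[of R "transpose S"] map_of_rat_mult[of "transpose S" R]
    by (intro exI[of _ "map_matrix of_rat (transpose S)"]) (simp add: tr one G)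
qed

lemma form_matrix_alternating:
  assumes "odd w" "polarization_form w Q"
  shows "transpose (form_matrix Q) = - form_matrix Q"
proof -
  have "Q u v = - Q v u" for u v using assms unfolding polarization_form_def by meson
  then have "Q (axis j 1) (axis i 1) = - Q (axis i 1) (axis j 1)" for i j .
  then have "of_rat (Q (axis j 1) (axis i 1)) = (- of_rat (Q (axis i 1) (axis j 1)) :: complex)" for i j
    by (metis of_rat_minus)
  then have "transpose (form_matrix Q) $ i $ j = (- form_matrix Q) $ i $ j" for i j
    unfolding transpose_def form_matrix_def vec_lambda_beta vector_uminus_component .
  then show ?thesis unfolding vec_eq_iff by blast
qed

lemma isometry_lie_algebra_iff:
  fixes Q :: "rat^'n \<Rightarrow> rat^'n \<Rightarrow> rat"
  assumes Q: "polarization_form w Q"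
  shows "X \<in> isometry_lie_algebra Q \<longleftrightarrow>
    transpose (map_matrix of_rat X) ** form_matrix Q + form_matrix Q ** map_matrix of_rat X = 0"
proof -
  define R :: "rat^'n^'n" where "R = (\<chi> i j. Q (axis i 1) (axis j 1))"
  \<comment> \<open>The Gram matrix of the form Q(Xu, v) + Q(u, Xv). It is rational, so its
    vanishing can be tested after extension of scalars.\<close>
  define S where "S = transpose X ** R + R ** X"
  have ax: "Q (X *v axis a 1) (axis b 1) + Q (axis a 1) (X *v axis b 1) = S $ a $ b" for a b
  proof -
    have "Q (X *v axis a 1) (axis b 1) = (\<Sum>i\<in>UNIV. X $ i $ a * R $ i $ b)"
      unfolding form_expansion[OF Q, of "X *v axis a 1"]
      by (simp add: R_def matrix_vector_mult_def axis_def if_distrib if_distribR cong: if_cong)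
    moreover have "Q (axis a 1) (X *v axis b 1) = (\<Sum>j\<in>UNIV. R $ a $ j * X $ j $ b)"
    proof -
      have "Q (axis a 1) (X *v axis b 1) =
          (\<Sum>i\<in>UNIV. if i = a then \<Sum>j\<in>UNIV. R $ a $ j * X $ j $ b else 0)"
        unfolding form_expansion[OF Q, of "axis a 1"]
        by (intro sum.cong refl) (auto simp: R_def matrix_vector_mult_def axis_def if_distrib mult_ac cong: if_cong)
      then show ?thesis by simp
    qed
    ultimately show ?thesis
      by (simp add: S_def matrix_matrix_mult_def transpose_def)
  qed
  have gen: "Q (X *v u) v + Q u (X *v v) = (\<Sum>a\<in>UNIV. \<Sum>b\<in>UNIV. u $ a * v $ b * S $ a $ b)" for u v
  proof -
    have "Q (X *v u) v = (\<Sum>i\<in>UNIV. \<Sum>b\<in>UNIV. \<Sum>a\<in>UNIV. u $ a * v $ b * (X $ i $ a * R $ i $ b))"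
      unfolding form_expansion[OF Q, of "X *v u"]
      unfolding matrix_vector_mult_def vec_lambda_beta R_def sum_distrib_right
      by (intro sum.cong refl) (simp only: mult_ac)
    also have "\<dots> = (\<Sum>b\<in>UNIV. \<Sum>i\<in>UNIV. \<Sum>a\<in>UNIV. u $ a * v $ b * (X $ i $ a * R $ i $ b))"
      by (rule sum.swap)
    also have "\<dots> = (\<Sum>b\<in>UNIV. \<Sum>a\<in>UNIV. \<Sum>i\<in>UNIV. u $ a * v $ b * (X $ i $ a * R $ i $ b))"
      by (rule sum.cong[OF refl], rule sum.swap)
    also have "\<dots> = (\<Sum>a\<in>UNIV. \<Sum>b\<in>UNIV. \<Sum>i\<in>UNIV. u $ a * v $ b * (X $ i $ a * R $ i $ b))"
      by (rule sum.swap)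
    also have "\<dots> = (\<Sum>a\<in>UNIV. \<Sum>b\<in>UNIV. u $ a * v $ b * (transpose X ** R) $ a $ b)"
      by (simp add: matrix_matrix_mult_def transpose_def sum_distrib_left)
    finally have 1: "Q (X *v u) v = (\<Sum>a\<in>UNIV. \<Sum>b\<in>UNIV. u $ a * v $ b * (transpose X ** R) $ a $ b)" .
    have "Q u (X *v v) = (\<Sum>a\<in>UNIV. \<Sum>j\<in>UNIV. \<Sum>b\<in>UNIV. u $ a * v $ b * (R $ a $ j * X $ j $ b))"
      unfolding form_expansion[OF Q, of u]
      unfolding matrix_vector_mult_def vec_lambda_beta R_def sum_distrib_right sum_distrib_left
      by (intro sum.cong refl) (simp only: mult_ac)
    also have "\<dots> = (\<Sum>a\<in>UNIV. \<Sum>b\<in>UNIV. \<Sum>j\<in>UNIV. u $ a * v $ b * (R $ a $ j * X $ j $ b))"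
      by (rule sum.cong[OF refl], rule sum.swap)
    also have "\<dots> = (\<Sum>a\<in>UNIV. \<Sum>b\<in>UNIV. u $ a * v $ b * (R ** X) $ a $ b)"
      by (simp add: matrix_matrix_mult_def sum_distrib_left)
    finally show ?thesis
      by (simp add: 1 S_def sum.distrib[symmetric] distrib_left)
  qed
  have "X \<in> isometry_lie_algebra Q \<longleftrightarrow> S = 0"
  proof
    assume "X \<in> isometry_lie_algebra Q"
    then have "S $ a $ b = 0" for a b using ax[of a b] by (simp add: isometry_lie_algebra_def)
    then show "S = 0" by (simp add: vec_eq_iff)
  qed (use gen in \<open>simp add: isometry_lie_algebra_def\<close>)
  also have "\<dots> \<longleftrightarrow> map_matrix of_rat S = (0 :: complex^'n^'n)" by (simp add: map_of_rat_eq_0_iff)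
  also have "map_matrix of_rat S =
      transpose (map_matrix of_rat X) ** form_matrix Q + form_matrix Q ** map_matrix of_rat X"
    by (simp add: S_def R_def form_matrix_def vec_eq_iff matrix_matrix_mult_def transpose_def
        of_rat_add of_rat_sum of_rat_mult)
  finally show ?thesis .
qed

lemma bilin_ext_form_matrix:
  "bilin_ext Q u v = (\<Sum>i\<in>UNIV. \<Sum>j\<in>UNIV. u $ i * form_matrix Q $ i $ j * v $ j)"
  by (simp add: bilin_ext_def form_matrix_def mult_ac)

lemma bilin_ext_add_left: "bilin_ext Q (u + u') v = bilin_ext Q u v + bilin_ext Q u' v"
  and bilin_ext_add_right: "bilin_ext Q u (v + v') = bilin_ext Q u v + bilin_ext Q u v'"
  and bilin_ext_scale: "bilin_ext Q (c *s u) (d *s v) = c * d * bilin_ext Q u v"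
  by (simp_all add: bilin_ext_def sum.distrib distrib_left distrib_right sum_distrib_left mult_ac)

lemma bilin_ext_zero: "bilin_ext Q 0 v = 0" "bilin_ext Q u 0 = 0"
  by (simp_all add: bilin_ext_def)

lemma bilin_ext_sum: "bilin_ext Q (\<Sum>p\<in>A. f p) (\<Sum>r\<in>B. g r) = (\<Sum>p\<in>A. \<Sum>r\<in>B. bilin_ext Q (f p) (g r))"
proof -
  have "bilin_ext Q u (\<Sum>r\<in>B. g r) = (\<Sum>r\<in>B. bilin_ext Q u (g r))" for u
    by (induction B rule: infinite_finite_induct) (simp_all add: bilin_ext_zero bilin_ext_add_right)
  then show ?thesis
    by (induction A rule: infinite_finite_induct) (simp_all add: bilin_ext_zero bilin_ext_add_left)
qed

section \<open>The circle action and the Mumford-Tate group\<close>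

abbreviation cmap :: "real^'n^'n \<Rightarrow> complex^'n^'n" where
  "cmap \<equiv> map_matrix complex_of_real"

lemma mult_vec_sum: "A *v (\<Sum>p\<in>S. f p) = (\<Sum>p\<in>S. A *v f p)" for A :: "complex^'n^'n"
  by (induction S rule: infinite_finite_induct) (simp_all add: matrix_vector_right_distrib)

lemma hodge_decomposition:
  assumes "hodge_structure w \<phi>"
  obtains f where "\<And>p. f p \<in> hodge_piece \<phi> p (w - p)" "finite {p. f p \<noteq> 0}" "v = (\<Sum>p | f p \<noteq> 0. f p)"
  using assms unfolding hodge_structure_def is_direct_sum_def by blast

text \<open>On the circle, the characters of dual Hodge pieces are inverse to each other.\<close>

lemma circle_isometry:
  assumes hs: "hodge_structure w \<phi>" and pol: "polarized_by Q \<phi>" and z: "cmod z = 1"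
  shows "bilin_ext Q (cmap (\<phi> z) *v u) (cmap (\<phi> z) *v v) = bilin_ext Q u v"
proof -
  have z0: "z \<noteq> 0" using z by auto
  have zz: "z * cnj z = 1" using z by (simp add: complex_norm_square[symmetric] flip: of_real_power)
  obtain f where f: "\<And>p. f p \<in> hodge_piece \<phi> p (w - p)" "finite {p. f p \<noteq> 0}" "u = (\<Sum>p | f p \<noteq> 0. f p)"
    by (rule hodge_decomposition[OF hs]) (rule that)
  obtain g where g: "\<And>p. g p \<in> hodge_piece \<phi> p (w - p)" "finite {p. g p \<noteq> 0}" "v = (\<Sum>p | g p \<noteq> 0. g p)"
    by (rule hodge_decomposition[OF hs]) (rule that)
  define ch where "ch p = z powi p * cnj z powi (w - p)" for p
  have fz: "cmap (\<phi> z) *v f p = ch p *s f p" "cmap (\<phi> z) *v g p = ch p *s g p" for p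
    using f(1)[of p] g(1)[of p] z0 by (simp_all add: hodge_piece_def ch_def)
  have "bilin_ext Q (ch p *s f p) (ch r *s g r) = bilin_ext Q (f p) (g r)" for p r
  proof (cases "r = w - p")
    case True
    have "ch p * ch r = (z * cnj z) powi p * (z * cnj z) powi (w - p)"
      unfolding ch_def True power_int_mult_distrib by (simp add: mult_ac)
    then have "ch p * ch r = 1" by (simp add: zz)
    then show ?thesis by (simp add: bilin_ext_scale)
  next
    case False
    then have "bilin_ext Q (f p) (g r) = 0"
      using pol f(1)[of p] g(1)[of r] unfolding polarized_by_def by blast
    then show ?thesis by (simp add: bilin_ext_scale)
  qed
  then show ?thesis
    unfolding f(3) g(3) mult_vec_sum fz bilin_ext_sum by simp
qed

lemma circle_isometry_matrix:
  assumes "hodge_structure w \<phi>" "polarized_by Q \<phi>" "cmod z = 1"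
  shows "transpose (cmap (\<phi> z)) ** form_matrix Q ** cmap (\<phi> z) = form_matrix Q"
proof -
  let ?A = "cmap (\<phi> z)"
  have ax: "?A *v axis a 1 = (\<chi> i. ?A $ i $ a)" for a
    by (simp add: vec_eq_iff matrix_vector_nth axis_def if_distrib cong: if_cong)
  have "(transpose ?A ** form_matrix Q ** ?A) $ a $ b = form_matrix Q $ a $ b" for a b
  proof -
    have "(transpose ?A ** form_matrix Q ** ?A) $ a $ b = bilin_ext Q (?A *v axis a 1) (?A *v axis b 1)"
      unfolding bilinear_entry bilin_ext_form_matrix ax by simp
    also have "\<dots> = bilin_ext Q (axis a 1) (axis b 1)" by (rule circle_isometry[OF assms])
    also have "\<dots> = form_matrix Q $ a $ b"
    proof -
      have "(\<Sum>j\<in>UNIV. x * form_matrix Q $ i $ j * axis b 1 $ j) = x * form_matrix Q $ i $ b" for x i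
        by (simp add: axis_def if_distrib cong: if_cong)
      moreover have "(\<Sum>i\<in>UNIV. axis a 1 $ i * form_matrix Q $ i $ b) = form_matrix Q $ a $ b"
        by (simp add: axis_def if_distrib if_distribR cong: if_cong)
      ultimately show ?thesis unfolding bilin_ext_form_matrix by simp
    qed
    finally show ?thesis .
  qed
  then show ?thesis by (simp add: vec_eq_iff)
qed

lemma isometry_group_algebraic:
  assumes rat: "\<And>i j. G $ i $ j \<in> \<rat>"
  shows "rat_algebraic_group {A :: complex^'n^'n. invertible A \<and> transpose A ** G ** A = G}"
proof -
  define p where "p i j A = (\<Sum>k\<in>UNIV. \<Sum>m\<in>UNIV. A $ k $ i * (G $ k $ m * A $ m $ j)) + (- G $ i $ j)"
    for i j and A :: "complex^'n^'n"
  have "p i j \<in> mat_polys \<rat>" for i j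
    unfolding p_def by (intro mat_polys_add mat_polys_sum mat_polys_mult mat_polys_entry mat_polys_const) (auto simp: rat)
  moreover have "transpose A ** G ** A = G \<longleftrightarrow> (\<forall>i j. p i j A = 0)" for A
    by (simp add: vec_eq_iff bilinear_entry p_def mult_ac)
  ultimately have "\<exists>S \<subseteq> mat_polys \<rat>. {A. invertible A \<and> transpose A ** G ** A = G} =
      {A. invertible A \<and> (\<forall>p\<in>S. p A = 0)}"
    by (intro exI[of _ "range (case_prod p)"]) auto
  moreover have "invertible (mat 1 :: complex^'n^'n)"
    unfolding invertible_def by (intro exI[of _ "mat 1"]) simp
  moreover have "transpose (A ** B) ** G ** (A ** B) = G"
    if "transpose A ** G ** A = G" "transpose B ** G ** B = G" for A B
  proof -
    have "transpose (A ** B) ** G ** (A ** B) = transpose B ** (transpose A ** G ** A) ** B"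
      by (simp add: matrix_transpose_mul matrix_mul_assoc)
    then show ?thesis using that by simp
  qed
  moreover have "invertible (matrix_inv A) \<and> transpose (matrix_inv A) ** G ** matrix_inv A = G"
    if A: "invertible A" "transpose A ** G ** A = G" for A
  proof -
    obtain B where B: "A ** B = mat 1" "B ** A = mat 1" using A(1) by (auto simp: invertible_def)
    have "transpose B ** G ** B = transpose B ** (transpose A ** G ** A) ** B" using A(2) by simp
    also have "\<dots> = transpose (A ** B) ** G ** (A ** B)" by (simp add: matrix_transpose_mul matrix_mul_assoc)
    finally have "transpose B ** G ** B = G" by (simp add: B transpose_mat)
    then show ?thesis using B unfolding matrix_inv_eqI[OF B] by (auto simp: invertible_def)
  qed
  ultimately show ?thesis
    unfolding rat_algebraic_group_def by (auto simp: transpose_mat intro: invertible_mult)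
qed

lemma circle_invertible:
  assumes "hodge_structure w \<phi>" "cmod z = 1"
  shows "invertible (cmap (\<phi> z))"
proof -
  have z: "z \<noteq> 0" using assms(2) by auto
  have "\<phi> z ** \<phi> (inverse z) = mat 1" "\<phi> (inverse z) ** \<phi> z = mat 1"
    using assms(1) z unfolding hodge_structure_def by (metis inverse_nonzero_iff_nonzero left_inverse right_inverse)+
  then have "cmap (\<phi> z) ** cmap (\<phi> (inverse z)) = cmap (mat 1)" "cmap (\<phi> (inverse z)) ** cmap (\<phi> z) = cmap (mat 1)"
    by (simp_all flip: map_of_real_mult)
  moreover have "cmap (mat 1) = mat 1" by (simp add: vec_eq_iff mat_def)
  ultimately show ?thesis
    unfolding invertible_def by (intro exI[of _ "cmap (\<phi> (inverse z))"]) simp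
qed

text \<open>The isometry group of the form is one of the groups in the intersection that defines the
  Mumford-Tate group.\<close>

lemma mumford_tate_group_isometry:
  assumes "hodge_structure w \<phi>" "polarized_by Q \<phi>" and A: "A \<in> mumford_tate_group \<phi>"
  shows "transpose A ** form_matrix Q ** A = form_matrix Q"
proof -
  let ?H = "{A. invertible A \<and> transpose A ** form_matrix Q ** A = form_matrix Q}"
  have "rat_algebraic_group ?H"
    by (rule isometry_group_algebraic) (simp add: form_matrix_def)
  moreover have "\<phi> ` sphere 0 1 \<subseteq> real_points ?H"
    using circle_isometry_matrix[OF assms(1,2)] circle_invertible[OF assms(1)] by (auto simp: real_points_def)
  ultimately show ?thesis using A unfolding mumford_tate_group_def by blast
qed

lemma mumford_tate_group_circle: "cmod z = 1 \<Longrightarrow> cmap (\<phi> z) \<in> mumford_tate_group \<phi>"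
  unfolding mumford_tate_group_def by (auto simp: real_points_def subset_iff)

text \<open>\<open>matrix_inv g\<close> is a chosen witness, so g must first be known to be
  invertible over the reals; this follows from injectivity of its complexification on real
  vectors.\<close>

lemma cmap_inverse:
  assumes "invertible (cmap g)"
  shows "cmap (matrix_inv g) = matrix_inv (cmap g)"
proof -
  obtain B where "B ** cmap g = mat 1" using assms by (auto simp: invertible_def)
  have "x = 0" if x: "g *v x = 0" for x
  proof -
    have "cmap g *v (\<chi> i. complex_of_real (x $ i)) = (\<chi> i. complex_of_real ((g *v x) $ i))"
      by (simp add: vec_eq_iff matrix_vector_mult_def)
    then have "cmap g *v (\<chi> i. complex_of_real (x $ i)) = 0" by (simp add: x vec_eq_iff)
    then have "(\<chi> i. complex_of_real (x $ i)) = 0"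
      using \<open>B ** cmap g = mat 1\<close> by (metis matrix_vector_mul_assoc matrix_vector_mul_lid matrix_vector_mult_0_right)
    then show ?thesis by (simp add: vec_eq_iff)
  qed
  then have "\<exists>h. h ** g = mat 1" unfolding matrix_left_invertible_ker by simp
  then obtain h where "h ** g = mat 1" by (rule exE)
  then have "g ** h = mat 1 \<and> h ** g = mat 1" using matrix_left_right_inverse by blast
  then have inv: "g ** matrix_inv g = mat 1 \<and> matrix_inv g ** g = mat 1"
    unfolding matrix_inv_def by (rule someI)
  have one: "cmap (mat 1) = mat 1" by (simp add: vec_eq_iff mat_def)
  show ?thesis
    using inv by (intro matrix_inv_eqI[symmetric]) (simp_all add: one flip: map_of_real_mult)
qed

text \<open>On the circle \<phi> is conjugate to \<phi>' by a real point of the larger group, which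
  therefore contains the image of \<phi> and, by minimality, its Mumford-Tate group. This places the
  torus T inside M.\<close>

lemma mumford_tate_group_mono:
  assumes alg: "rat_algebraic_group (mumford_tate_group \<phi>')"
    and \<phi>: "\<phi> \<in> mumford_tate_domain (mumford_tate_group \<phi>') \<phi>'"
  shows "mumford_tate_group \<phi> \<subseteq> mumford_tate_group \<phi>'"
proof -
  let ?M = "mumford_tate_group \<phi>'"
  obtain g where g: "cmap g \<in> ?M" "\<And>z. z \<noteq> 0 \<Longrightarrow> \<phi> z = g ** \<phi>' z ** matrix_inv g"
    using \<phi> by (auto simp: mumford_tate_domain_def real_points_def)
  have inv: "invertible (cmap g)" using alg g(1) by (auto simp: rat_algebraic_group_def)
  have "cmap (\<phi> z) \<in> ?M" if z: "cmod z = 1" for z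
  proof -
    have "z \<noteq> 0" using z by auto
    then have "\<phi> z = g ** \<phi>' z ** matrix_inv g" by (rule g(2))
    then have "cmap (\<phi> z) = cmap g ** cmap (\<phi>' z) ** matrix_inv (cmap g)"
      by (simp add: map_of_real_mult cmap_inverse[OF inv])
    then show ?thesis
      using alg g(1) mumford_tate_group_circle[OF z, of \<phi>'] by (simp add: rat_algebraic_group_def)
  qed
  then have "?M \<in> {H. rat_algebraic_group H \<and> \<phi> ` sphere 0 1 \<subseteq> real_points H}"
    using alg by (auto simp: real_points_def)
  then show ?thesis unfolding mumford_tate_group_def[of \<phi>] by (rule Inter_lower)
qed

lemma circle_characters_separate:
  assumes "p \<noteq> p'"
  shows "\<exists>z\<in>sphere (0 :: complex) 1. z powi p * cnj z powi (w - p) \<noteq> z powi p' * cnj z powi (w - p')"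
proof -
  \<comment> \<open>On the circle the character of index p is \<open>z powi (2 * p - w)\<close>;
    this z makes the quotient of the two characters equal to -1.\<close>
  define z where "z = cis (pi / of_int (2 * (p - p')))"
  have z: "cmod z = 1" "z \<noteq> 0" by (simp_all add: z_def)
  have "cnj z = inverse z" by (simp add: z_def cis_cnj)
  then have ch: "z powi p * cnj z powi (w - p) = z powi (2 * p - w)" for p
    using z(2) by (simp add: power_int_inverse power_int_minus[symmetric] power_int_add[symmetric])
  have "z powi (2 * p - w) \<noteq> z powi (2 * p' - w)"
  proof
    assume eq: "z powi (2 * p - w) = z powi (2 * p' - w)"
    have "z powi (2 * p - w) = z powi (2 * p' - w) * z powi (2 * (p - p'))"
      using z(2) by (simp add: power_int_add[symmetric] algebra_simps)
    then have "z powi (2 * (p - p')) = 1" using eq z(2) by simp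
    moreover have "z powi (2 * (p - p')) = cis pi"
      using assms by (simp add: z_def cis_power_int)
    ultimately show False by simp
  qed
  then show ?thesis using z(1) by (intro bexI[of _ z]) (auto simp: ch)
qed

text \<open>The circle already separates the Hodge pieces, so a subspace stable under it contains
  the Hodge components of its vectors. Uniqueness is inherited from the whole space.\<close>

lemma stable_subspace_sub_hodge:
  assumes hs: "hodge_structure w \<phi>" and U: "vec.subspace U"
    and stable: "\<And>z u. cmod z = 1 \<Longrightarrow> u \<in> U \<Longrightarrow> cmap (\<phi> z) *v u \<in> U"
  shows "is_direct_sum U (\<lambda>p. U \<inter> hodge_piece \<phi> p (w - p))"
proof -
  have ds: "is_direct_sum UNIV (\<lambda>p. hodge_piece \<phi> p (w - p))" using hs by (simp add: hodge_structure_def)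
  have "\<exists>!f. (\<forall>p. f p \<in> U \<inter> hodge_piece \<phi> p (w - p)) \<and> finite {p. f p \<noteq> 0} \<and> v = (\<Sum>p | f p \<noteq> 0. f p)"
    if v: "v \<in> U" for v
  proof -
    obtain f where f: "\<And>p. f p \<in> hodge_piece \<phi> p (w - p)" "finite {p. f p \<noteq> 0}" "v = (\<Sum>p | f p \<noteq> 0. f p)"
      by (rule hodge_decomposition[OF hs]) (rule that)
    have "f p \<in> U" if p: "f p \<noteq> 0" for p
    proof (rule vec.weight_components[OF U f(2), where T = "sphere 0 1" and
          \<psi> = "\<lambda>p z. z powi p * cnj z powi (w - p)"])
      fix z c assume z: "z \<in> sphere (0 :: complex) 1" and s: "(\<Sum>p | f p \<noteq> 0. c p *s f p) \<in> U"
      have "z \<noteq> 0" "cmod z = 1" using z by auto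
      have "cmap (\<phi> z) *v f p = (z powi p * cnj z powi (w - p)) *s f p" for p
        using f(1)[of p] \<open>z \<noteq> 0\<close> by (simp add: hodge_piece_def)
      then have "cmap (\<phi> z) *v (\<Sum>p | f p \<noteq> 0. c p *s f p) =
          (\<Sum>p | f p \<noteq> 0. (z powi p * cnj z powi (w - p) * c p) *s f p)"
        by (simp add: mult_vec_sum vector_scalar_commute mult_ac)
      then show "(\<Sum>p | f p \<noteq> 0. (z powi p * cnj z powi (w - p) * c p) *s f p) \<in> U"
        using stable[OF \<open>cmod z = 1\<close> s] by simp
    next
      show "(\<Sum>p | f p \<noteq> 0. f p) \<in> U" using v f(3) by simp
    qed (use p circle_characters_separate in auto)
    then have fU: "f p \<in> U" for p using vec.subspace_0[OF U] by (cases "f p = 0") auto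
    show ?thesis
    proof (rule ex1I[of _ f])
      show "(\<forall>p. f p \<in> U \<inter> hodge_piece \<phi> p (w - p)) \<and> finite {p. f p \<noteq> 0} \<and> v = (\<Sum>p | f p \<noteq> 0. f p)"
        using f fU by blast
    next
      fix g assume "(\<forall>p. g p \<in> U \<inter> hodge_piece \<phi> p (w - p)) \<and> finite {p. g p \<noteq> 0} \<and> v = (\<Sum>p | g p \<noteq> 0. g p)"
      then have "(\<forall>p. g p \<in> hodge_piece \<phi> p (w - p)) \<and> finite {p. g p \<noteq> 0} \<and> v = (\<Sum>p | g p \<noteq> 0. g p)"
        by blast
      moreover have "(\<forall>p. f p \<in> hodge_piece \<phi> p (w - p)) \<and> finite {p. f p \<noteq> 0} \<and> v = (\<Sum>p | f p \<noteq> 0. f p)"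
        using f by blast
      moreover have "\<exists>!f. (\<forall>p. f p \<in> hodge_piece \<phi> p (w - p)) \<and> finite {p. f p \<noteq> 0} \<and> v = (\<Sum>p | f p \<noteq> 0. f p)"
        using ds unfolding is_direct_sum_def by blast
      ultimately show "g = f" by blast
    qed
  qed
  moreover have "vec.subspace (U \<inter> hodge_piece \<phi> p (w - p))" for p
    using ds U unfolding is_direct_sum_def by (intro vec.subspace_inter) auto
  ultimately show ?thesis unfolding is_direct_sum_def by blast
qed

text \<open>The rational vectors in U form a rational subspace W with complexification U. Stability
  under the circle makes W a sub-Hodge structure, to which irreducibility applies.\<close>

lemma hodge_irreducible_subspace:
  fixes U :: "(complex^'n) set"
  assumes hs: "hodge_structure w \<phi>" and irr: "hodge_irreducible w \<phi>" and U: "vec.subspace U"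
    and stable: "\<And>A u. A \<in> mumford_tate_group \<phi> \<Longrightarrow> u \<in> U \<Longrightarrow> A *v u \<in> U"
    and rat: "U \<subseteq> vec.span {r \<in> U. \<forall>i. r $ i \<in> \<rat>}"
  shows "U = {0} \<or> U = UNIV"
proof -
  define e :: "rat^'n \<Rightarrow> complex^'n" where "e r = (\<chi> i. of_rat (r $ i))" for r
  define W where "W = {r. e r \<in> U}"
  have e: "e 0 = 0" "e (x + y) = e x + e y" "e (c *s x) = of_rat c *s e x" for x y c
    by (simp_all add: e_def vec_eq_iff of_rat_add of_rat_mult)
  have W: "vec.subspace W"
    unfolding W_def using U by (auto simp: vec.subspace_def e)
  have image: "e ` W = {r \<in> U. \<forall>i. r $ i \<in> \<rat>}"
  proof (intro set_eqI iffI)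
    fix r assume r: "r \<in> {r \<in> U. \<forall>i. r $ i \<in> \<rat>}"
    then have "\<forall>i. \<exists>x. r $ i = of_rat x" unfolding Rats_def by blast
    from choice[OF this] obtain x where "\<forall>i. r $ i = of_rat (x i)" by blast
    then have "r = e (\<chi> i. x i)" by (simp add: e_def vec_eq_iff)
    then show "r \<in> e ` W" using r by (auto simp: W_def)
  qed (auto simp: W_def e_def)
  have compl: "complexification W = vec.span (e ` W)"
    by (simp add: complexification_def e_def)
  have "vec.span (e ` W) = U"
    using rat U by (intro antisym vec.span_minimal) (auto simp: image)
  then have WU: "complexification W = U" by (simp add: compl)
  have "sub_hodge_structure w \<phi> W"
    unfolding sub_hodge_structure_def WU
    using W stable_subspace_sub_hodge[OF hs U] stable mumford_tate_group_circle by blast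
  then have "W = {0} \<or> W = UNIV" using irr by (simp add: hodge_irreducible_def)
  then show ?thesis
  proof
    assume "W = {0}"
    then have "complexification W = {0}" unfolding compl by (simp add: e vec.span_insert_0)
    then show ?thesis using WU by simp
  next
    assume "W = UNIV"
    have "x \<in> U" for x
    proof -
      have "axis i 1 = e (axis i 1)" for i by (simp add: e_def axis_def vec_eq_iff)
      then have ax: "axis i 1 \<in> U" for i using \<open>W = UNIV\<close> by (metis UNIV_I W_def mem_Collect_eq)
      have "(\<Sum>i\<in>UNIV. x $ i *s axis i 1) \<in> U" by (intro vec.subspace_sum vec.subspace_scale U ax)
      then show ?thesis by (simp add: basis_expansion)
    qed
    then show ?thesis by blast
  qed
qed

theorem theorem4p6:
  fixes Q :: "rat ^ 'n \<Rightarrow> rat ^ 'n \<Rightarrow> rat"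
    and w :: int and h :: "int \<Rightarrow> int \<Rightarrow> nat"
    and \<phi> \<phi>' :: "complex \<Rightarrow> real ^ 'n ^ 'n"
    and M :: "(complex ^ 'n ^ 'n) set"
    and N :: "rat ^ 'n ^ 'n" and l :: nat
  assumes "odd w" and "polarization_form w Q"
    and "\<phi> \<in> period_domain Q w h"
    and "hodge_irreducible w \<phi>" and "is_CM \<phi>" and "nondegenerate \<phi>"
    and "\<phi>' \<in> period_domain Q w h" and "M = mumford_tate_group \<phi>'"
    and "\<phi> \<in> mumford_tate_domain M \<phi>'"
    and "N \<in> rat_lie_algebra M" and "nilpotent_mat N"
    and "real l > real CARD('n) / 2" and "mat_power N (l - 1) \<noteq> 0"
  shows "lie_complexification (rat_lie_algebra M) = lie_complexification (isometry_lie_algebra Q)"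
proof -
  have hs: "hodge_structure w \<phi>" "polarized_by Q \<phi>" and hs': "hodge_structure w \<phi>'" "polarized_by Q \<phi>'"
    using assms(3,7) by (simp_all add: period_domain_def)
  have algT: "rat_algebraic_group (mumford_tate_group \<phi>)" and algM: "rat_algebraic_group M"
    using hs(1) hs'(1) unfolding assms(8) hodge_structure_def by (auto intro: mumford_tate_group_algebraic)
  have dim: "2 * alg_dim (mumford_tate_group \<phi>) = CARD('n)"
    using assms(6) by (simp add: nondegenerate_def)
  interpret irreducible_torus "mumford_tate_group \<phi>" "form_matrix Q"
  proof
    show "rat_algebraic_group (mumford_tate_group \<phi>)" by (rule algT)
    show "A ** B = B ** A" if "A \<in> mumford_tate_group \<phi>" "B \<in> mumford_tate_group \<phi>" for A B
      using assms(5) that by (simp add: is_CM_def)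
    show "form_matrix Q $ i $ j \<in> \<rat>" for i j by (simp add: form_matrix_def)
    show "transpose A ** form_matrix Q ** A = form_matrix Q" if "A \<in> mumford_tate_group \<phi>" for A
      using mumford_tate_group_isometry[OF hs that] .
    show "invertible (form_matrix Q)" using form_matrix_invertible[OF assms(2)] .
    show "transpose (form_matrix Q) = - form_matrix Q" using form_matrix_alternating[OF assms(1,2)] .
    show "2 * alg_dim (mumford_tate_group \<phi>) = CARD('n)" by (rule dim)
    show "U = {0} \<or> U = UNIV"
      if "vec.subspace U" "\<And>A u. A \<in> mumford_tate_group \<phi> \<Longrightarrow> u \<in> U \<Longrightarrow> A *v u \<in> U"
        "U \<subseteq> vec.span {r \<in> U. \<forall>i. r $ i \<in> \<rat>}" for U
      using hodge_irreducible_subspace[OF hs(1) assms(4) that] .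
  qed
  obtain P P' :: "complex ^ 'n ^ 'n" where "P ** P' = mat 1" "P' ** P = mat 1" "\<And>a. column a P \<in> eigenvectors (mumford_tate_group \<phi>)"
    by (rule eigenbasis) (rule that)
  then interpret lie_over_torus "mumford_tate_group \<phi>" "form_matrix Q" P P' M
    using mumford_tate_group_mono[of \<phi>' \<phi>] assms(8,9) algM mumford_tate_group_isometry[OF hs']
    by unfold_locales auto
  let ?N = "map_matrix of_rat N :: complex ^ 'n ^ 'n"
  obtain m where "mat_power N m = 0" using assms(11) by (auto simp: nilpotent_mat_def)
  then have N: "?N \<in> tangent M" "mat_power ?N m = 0"
    using assms(10) by (simp_all add: rat_lie_algebra_iff map_of_rat_power[symmetric] map_of_rat_eq_0_iff)
  have nz: "mat_power ?N (l - 1) \<noteq> 0"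
    using assms(13) by (simp add: map_of_rat_power[symmetric] map_of_rat_eq_0_iff)
  \<comment> \<open>The dimension of V is even, being twice that of T, so 2 l exceeds it by at least
    2.\<close>
  have "CARD('n) \<le> 2 * (l - 1)"
  proof -
    have "real (2 * l) > real CARD('n)" using assms(12) by simp
    then have "2 * l > CARD('n)" by linarith
    then show ?thesis using dim by presburger
  qed
  note total = le_total[OF N nz this]
  \<comment> \<open>The two Lie algebras agree over the rationals already, since membership in
    either is tested on the complex matrix of X.\<close>
  have "rat_lie_algebra M = isometry_lie_algebra Q"
  proof (intro set_eqI)
    fix X
    have "X \<in> rat_lie_algebra M \<longleftrightarrow> map_matrix of_rat X \<in> tangent M" by (rule rat_lie_algebra_iff)
    also have "\<dots> \<longleftrightarrow> transpose (map_matrix of_rat X) ** form_matrix Q + form_matrix Q ** map_matrix of_rat X = 0"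
      using skew_tangent[OF total] tangent_skew[OF algM formM] by blast
    also have "\<dots> \<longleftrightarrow> X \<in> isometry_lie_algebra Q" by (rule isometry_lie_algebra_iff[OF assms(2), symmetric])
    finally show "X \<in> rat_lie_algebra M \<longleftrightarrow> X \<in> isometry_lie_algebra Q" .
  qed
  then show ?thesis by simp
qed

end
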